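(* Let $A_0,\dots,A_l$, $l\le k$, be finite sets in $\mathbb Z^k$. If neither of the sets $A_0,\dots,A_l$ is contained in an affine hyperplane of $\mathbb R^k$, and at least one of them is not dual defect, then the collection $A_0,\dots,A_l$ is not dual defect.
   Context: For a finite set $A\subset\mathbb Z^k$, $\mathbb C[A]$ is the space of Laurent polynomials $\sum_{a\in A}c_ay^a$ on $(\mathbb C\setminus0)^k$. $\Sigma_{A_0,\dots,A_l}\subset\mathbb C[A_0]\oplus\dots\oplus\mathbb C[A_l]$ is the set of all collections $(\varphi_0,\dots,\varphi_l)$ whose differentials are linearly dependent at some point of $\{y\in(\mathbb C\setminus0)^k\mid\varphi_0(y)=\dots=\varphi_l(y)=0\}$. The collection $A_0,\dots,A_l$ is dual defect if the closure of $\Sigma_{A_0,\dots,A_l}$ is not a hypersurface. A single set $A$ is dual defect if the closure of $\Sigma_A=\{\varphi\in\mathbb C[A]\mid\varphi(y)=0,\ d\varphi(y)=0\text{ for some }y\in(\mathbb C\setminus0)^k\}$ is not a hypersurface in $\mathbb C[A]$. *)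

theory Defs
  imports "HOL-Analysis.Analysis"
begin

text \<open>The finite-dimensional complex vector space with coordinates indexed by a (finite) set \<open>S\<close>,
  realised as the functions vanishing outside \<open>S\<close>. For \<open>S = A\<close> a finite set of exponents this is the
  space of Laurent polynomials with exponents in \<open>A\<close>, given by their coefficients.\<close>

definition coord_space :: "'v set \<Rightarrow> ('v \<Rightarrow> complex) set" where
  "coord_space S = {x. \<forall>v. v \<notin> S \<longrightarrow> x v = 0}"

inductive polynomial_fun :: "(('v \<Rightarrow> complex) \<Rightarrow> complex) \<Rightarrow> bool" where
  const: "polynomial_fun (\<lambda>x. c)"
| coord: "polynomial_fun (\<lambda>x. x v)"
| add: "polynomial_fun f \<Longrightarrow> polynomial_fun g \<Longrightarrow> polynomial_fun (\<lambda>x. f x + g x)"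
| mult: "polynomial_fun f \<Longrightarrow> polynomial_fun g \<Longrightarrow> polynomial_fun (\<lambda>x. f x * g x)"

definition zariski_closure :: "'v set \<Rightarrow> ('v \<Rightarrow> complex) set \<Rightarrow> ('v \<Rightarrow> complex) set" where
  "zariski_closure S X =
     {x \<in> coord_space S. \<forall>f. polynomial_fun f \<longrightarrow> (\<forall>z\<in>X. f z = 0) \<longrightarrow> f x = 0}"

definition hypersurface :: "'v set \<Rightarrow> ('v \<Rightarrow> complex) set \<Rightarrow> bool" where
  "hypersurface S V \<longleftrightarrow>
     (\<exists>f. polynomial_fun f \<and> \<not> f constant_on coord_space S \<and> V = {x \<in> coord_space S. f x = 0})"

definition torus :: "(complex ^ 'k) set" where
  "torus = {y. \<forall>j. y $ j \<noteq> 0}"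

definition laurent :: "(int ^ 'k) set \<Rightarrow> (int ^ 'k \<Rightarrow> complex) \<Rightarrow> complex ^ 'k \<Rightarrow> complex" where
  "laurent A c y = (\<Sum>a\<in>A. c a * (\<Prod>j\<in>UNIV. (y $ j) powi (a $ j)))"

text \<open>Laurent polynomials are holomorphic on the torus, so there their (real) Frechet derivative is
  the complex-linear differential.\<close>

abbreviation differential ::
    "(int ^ 'k) set \<Rightarrow> (int ^ 'k \<Rightarrow> complex) \<Rightarrow> complex ^ 'k \<Rightarrow> complex ^ 'k \<Rightarrow> complex" where
  "differential A c y \<equiv> frechet_derivative (laurent A c) (at y)"

definition Sigma_single :: "(int ^ 'k) set \<Rightarrow> (int ^ 'k \<Rightarrow> complex) set" where
  "Sigma_single A =
     {c \<in> coord_space A. \<exists>y\<in>torus. laurent A c y = 0 \<and> (\<forall>v. differential A c y v = 0)}"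

definition dual_defect_single :: "(int ^ 'k) set \<Rightarrow> bool" where
  "dual_defect_single A \<longleftrightarrow> \<not> hypersurface A (zariski_closure A (Sigma_single A))"

text \<open>A collection \<open>A\<^sub>0, \<dots>, A\<^sub>l\<close> is a function \<open>A\<close> on \<open>nat\<close> of which only the values at indices
  \<open>i \<le> l\<close> matter. The direct sum of the spaces of Laurent polynomials has coordinates indexed by the
  disjoint union of the \<open>A i\<close>; the \<open>i\<close>-th component of \<open>\<phi>\<close> is \<open>\<lambda>a. \<phi> (i, a)\<close>.\<close>

definition exponents :: "nat \<Rightarrow> (nat \<Rightarrow> (int ^ 'k) set) \<Rightarrow> (nat \<times> (int ^ 'k)) set" where
  "exponents l A = (SIGMA i:{..l}. A i)"

definition Sigma_collection ::
    "nat \<Rightarrow> (nat \<Rightarrow> (int ^ 'k) set) \<Rightarrow> (nat \<times> (int ^ 'k) \<Rightarrow> complex) set" where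
  "Sigma_collection l A =
     {\<phi> \<in> coord_space (exponents l A). \<exists>y\<in>torus.
        (\<forall>i\<le>l. laurent (A i) (\<lambda>a. \<phi> (i, a)) y = 0) \<and>
        (\<exists>\<mu> :: nat \<Rightarrow> complex. (\<exists>i\<le>l. \<mu> i \<noteq> 0) \<and>
           (\<forall>v. (\<Sum>i\<le>l. \<mu> i * differential (A i) (\<lambda>a. \<phi> (i, a)) y v) = 0))}"

definition dual_defect :: "nat \<Rightarrow> (nat \<Rightarrow> (int ^ 'k) set) \<Rightarrow> bool" where
  "dual_defect l A \<longleftrightarrow>
     \<not> hypersurface (exponents l A) (zariski_closure (exponents l A) (Sigma_collection l A))"

definition in_affine_hyperplane :: "(int ^ 'k) set \<Rightarrow> bool" where
  "in_affine_hyperplane A \<longleftrightarrow>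
     (\<exists>(n :: real ^ 'k) b. n \<noteq> 0 \<and> (\<lambda>a. \<chi> j. real_of_int (a $ j)) ` A \<subseteq> {x. n \<bullet> x = b})"

end

theory Submission
  imports Defs "HOL-Complex_Analysis.Conformal_Mappings" "HOL-Library.Function_Algebras"
    "HOL-Computational_Algebra.Fundamental_Theorem_Algebra"
begin

text \<open>Write \<open>y = exp \<eta>\<close>. The discriminant of the collection is then the set of all
  \<open>x (i, a) = w (i, a) * exp (- \<langle>\<eta>, a\<rangle>)\<close> with \<open>w\<close> in a linear space depending on the multiplier
  \<open>\<mu>\<close>. Two points of it are joined by an entire curve, so its vanishing ideal \<open>I\<close> is prime, and
  counting monomials against parameters shows \<open>I \<noteq> 0\<close>. Such an ideal is principal, hence cuts out a
  hypersurface, as soon as it contains no nonzero polynomial that is invariant under translation in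
  some direction \<open>v\<close> along which an element of \<open>I\<close> has constant leading coefficient.

  If one member is not dual defect, its discriminant projects dominantly along a coordinate axis; in
  characteristic zero this forces a singular \<open>\<phi>\<^sub>0\<close> with nondegenerate Hessian \<open>H\<close>. As \<open>l \<le> k\<close>, the
  other members can be chosen through the singular point with gradients \<open>H u\<^sub>i\<close>, where the \<open>u\<^sub>i\<close>
  are \<open>H\<close>-orthogonal and nonisotropic. There the parametrisation is an immersion onto a
  hypersurface germ, which excludes relations invariant under a transversal direction.\<close>

section \<open>Polynomial functions along lines\<close>

text \<open>Polynomials are treated as functions, and degree, divisibility and vanishing are tested
  on complex lines, where they become statements about \<open>complex poly\<close>.

  The hyperplane hypothesis makes value and gradient at a torus point independent linear conditions
  on the coefficients of each member. For a fixed multiplier the admissible \<open>w\<close>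
  therefore form a space of constant dimension, which is why parameters can be joined by curves and
  why there is one parameter fewer than there are coefficients.

  The special point lies over \<open>\<eta> = 0\<close> with its multiplier concentrated at the
  singular member \<open>i0\<close>. The velocities realised there are those whose coordinates in
  member \<open>i0\<close> sum to zero, so any \<open>v\<close> with nonzero sum is transversal.
  This is an open condition and can be met together with the nonvanishing of a leading form.\<close>

definition line :: "(('v \<Rightarrow> complex) \<Rightarrow> complex) \<Rightarrow> ('v \<Rightarrow> complex) \<Rightarrow> ('v \<Rightarrow> complex) \<Rightarrow> complex poly" where
  "line f z w = (THE p. \<forall>T. poly p T = f (\<lambda>v. z v + T * w v))"

lemma line_eqI:
  assumes "\<And>T. poly p T = f (\<lambda>v. z v + T * w v)"
  shows "line f z w = p"
  unfolding line_def
proof (rule the_equality)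
  fix q assume "\<forall>T. poly q T = f (\<lambda>v. z v + T * w v)"
  with assms have "poly q = poly p" by auto
  then show "q = p" by (simp add: poly_eq_poly_eq_iff)
qed (use assms in auto)

lemma poly_line_exists:
  assumes "polynomial_fun f"
  shows "\<exists>p. \<forall>T. poly p T = f (\<lambda>v. z v + T * w v)"
  using assms
proof induction
  case (const c)
  then show ?case by (intro exI[of _ "[:c:]"]) auto
next
  case (coord v)
  then show ?case by (intro exI[of _ "[:z v, w v:]"]) auto
next
  case (add f g)
  then obtain p q where "\<forall>T. poly p T = f (\<lambda>v. z v + T * w v)" "\<forall>T. poly q T = g (\<lambda>v. z v + T * w v)"
    by auto
  then show ?case by (intro exI[of _ "p + q"]) auto
next
  case (mult f g)
  then obtain p q where "\<forall>T. poly p T = f (\<lambda>v. z v + T * w v)" "\<forall>T. poly q T = g (\<lambda>v. z v + T * w v)"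
    by auto
  then show ?case by (intro exI[of _ "p * q"]) auto
qed

lemma poly_line:
  assumes "polynomial_fun f"
  shows "poly (line f z w) T = f (\<lambda>v. z v + T * w v)"
proof -
  obtain p where "\<forall>T. poly p T = f (\<lambda>v. z v + T * w v)"
    using poly_line_exists[OF assms] by blast
  with line_eqI[of p f z w] show ?thesis by simp
qed

lemma poly_line_0: "polynomial_fun f \<Longrightarrow> poly (line f z w) 0 = f z"
  by (simp add: poly_line)

lemma line_const [simp]: "line (\<lambda>x. c) z w = [:c:]"
  by (rule line_eqI) simp

lemma line_coord [simp]: "line (\<lambda>x. x v) z w = [:z v, w v:]"
  by (rule line_eqI) simp

lemma line_add:
  "polynomial_fun f \<Longrightarrow> polynomial_fun g \<Longrightarrow> line (\<lambda>x. f x + g x) z w = line f z w + line g z w"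
  by (rule line_eqI) (simp add: poly_line)

lemma line_mult:
  "polynomial_fun f \<Longrightarrow> polynomial_fun g \<Longrightarrow> line (\<lambda>x. f x * g x) z w = line f z w * line g z w"
  by (rule line_eqI) (simp add: poly_line)

lemma polynomial_fun_uminus: "polynomial_fun f \<Longrightarrow> polynomial_fun (\<lambda>x. - f x)"
  using polynomial_fun.mult[OF polynomial_fun.const[of "-1"]] by fastforce

lemma polynomial_fun_diff:
  "polynomial_fun f \<Longrightarrow> polynomial_fun g \<Longrightarrow> polynomial_fun (\<lambda>x. f x - g x)"
  using polynomial_fun.add[OF _ polynomial_fun_uminus] by fastforce

lemma polynomial_fun_cmult: "polynomial_fun f \<Longrightarrow> polynomial_fun (\<lambda>x. c * f x)"
  using polynomial_fun.mult[OF polynomial_fun.const[of c]] by fastforce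

lemma polynomial_fun_divide_const: "polynomial_fun f \<Longrightarrow> polynomial_fun (\<lambda>x. f x / c)"
  using polynomial_fun_cmult[of f "1 / c"] by simp

lemma polynomial_fun_power: "polynomial_fun f \<Longrightarrow> polynomial_fun (\<lambda>x. f x ^ n)"
  by (induction n) (auto intro: polynomial_fun.intros)

lemma polynomial_fun_sum:
  "(\<And>i. i \<in> I \<Longrightarrow> polynomial_fun (f i)) \<Longrightarrow> polynomial_fun (\<lambda>x. \<Sum>i\<in>I. f i x)"
  by (induction I rule: infinite_finite_induct) (auto intro: polynomial_fun.intros)

lemma polynomial_fun_prod:
  "(\<And>i. i \<in> I \<Longrightarrow> polynomial_fun (f i)) \<Longrightarrow> polynomial_fun (\<lambda>x. \<Prod>i\<in>I. f i x)"
  by (induction I rule: infinite_finite_induct) (auto intro: polynomial_fun.intros)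

lemmas polynomial_fun_intros = polynomial_fun.intros polynomial_fun_uminus polynomial_fun_diff
  polynomial_fun_cmult polynomial_fun_divide_const polynomial_fun_power polynomial_fun_sum polynomial_fun_prod

lemma polynomial_fun_compose:
  assumes "polynomial_fun f" "\<And>v. polynomial_fun (\<lambda>x. g x v)"
  shows "polynomial_fun (\<lambda>x. f (g x))"
  using assms(1) by induction (auto intro: polynomial_fun.intros assms(2))

text \<open>Keeps leading coefficients and directional derivatives among the polynomial functions,
  so that they can be restricted to lines again.\<close>

lemma polynomial_fun_coeff_line:
  assumes "polynomial_fun f"
    and Z: "\<And>v. polynomial_fun (\<lambda>x. Z x v)" and W: "\<And>v. polynomial_fun (\<lambda>x. W x v)"
  shows "polynomial_fun (\<lambda>x. coeff (line f (Z x) (W x)) i)"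
  using assms(1)
proof (induction arbitrary: i)
  case (const c)
  then show ?case by (cases i) (auto intro: polynomial_fun.intros)
next
  case (coord v)
  then show ?case
  proof (cases i)
    case (Suc j)
    then show ?thesis by (cases j) (auto intro: polynomial_fun.intros W)
  qed (auto intro: Z)
next
  case (add f g)
  then show ?case by (auto simp: line_add intro: polynomial_fun.intros)
next
  case (mult f g)
  then show ?case unfolding line_mult[OF mult.hyps(1,2)] coeff_mult by (intro polynomial_fun_sum polynomial_fun.mult mult.IH)
qed

lemma degree_line_bounded:
  assumes "polynomial_fun f"
  shows "\<exists>n. \<forall>z w. degree (line f z w) \<le> n"
  using assms
proof induction
  case (add f g)
  then obtain m n where "\<forall>z w. degree (line f z w) \<le> m" "\<forall>z w. degree (line g z w) \<le> n" by auto
  then show ?case using add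
    by (intro exI[of _ "max m n"]) (auto simp: line_add intro!: degree_add_le intro: le_max_iff_disj[THEN iffD2])
next
  case (mult f g)
  then obtain m n where "\<forall>z w. degree (line f z w) \<le> m" "\<forall>z w. degree (line g z w) \<le> n" by auto
  then show ?case using mult
    by (intro exI[of _ "m + n"])
       (auto simp: line_mult intro!: order_trans[OF degree_mult_le] add_mono)
qed (auto intro: exI[of _ 0] exI[of _ 1] simp: degree_pCons_eq_if)

lemma line_scale:
  assumes "polynomial_fun f"
  shows "coeff (line f z (\<lambda>v. c * w v)) i = c ^ i * coeff (line f z w) i"
proof -
  have "line f z (\<lambda>v. c * w v) = pcompose (line f z w) [:0, c:]"
    by (rule line_eqI) (simp add: poly_pcompose poly_line assms ac_simps)
  then show ?thesis by (simp add: coeff_pcompose_linear)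
qed

lemma line_shift:
  assumes "polynomial_fun f"
  shows "line f (\<lambda>v. z v + s * w v) w = pcompose (line f z w) [:s, 1:]"
  by (rule line_eqI) (simp add: poly_pcompose poly_line assms algebra_simps)

text \<open>On the line through \<open>x\<close> and \<open>y\<close> both restrictions are nonzero
  elements of an integral domain.\<close>

lemma polynomial_fun_mult_nonzero:
  assumes "polynomial_fun f" "polynomial_fun g" "f x \<noteq> 0" "g y \<noteq> 0"
  shows "\<exists>z. f z \<noteq> 0 \<and> g z \<noteq> 0"
proof -
  define w where "w = (\<lambda>v. y v - x v)"
  have "poly (line f x w) 0 \<noteq> 0" "poly (line g x w) 1 \<noteq> 0"
    using assms by (auto simp: poly_line w_def)
  then have "line f x w \<noteq> 0" "line g x w \<noteq> 0" by auto
  then have "line f x w * line g x w \<noteq> 0" by simp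
  then obtain T where "poly (line f x w * line g x w) T \<noteq> 0"
    using poly_eq_poly_eq_iff[of "line f x w * line g x w" 0] by (auto simp: fun_eq_iff)
  then show ?thesis using assms by (auto simp: poly_line)
qed

lemma polynomial_fun_prod_nonzero:
  assumes "finite I" "\<And>i. i \<in> I \<Longrightarrow> polynomial_fun (f i)" "\<And>i. i \<in> I \<Longrightarrow> \<exists>x. f i x \<noteq> 0"
  shows "\<exists>x. (\<Prod>i\<in>I. f i x) \<noteq> 0"
  using assms
proof (induction I rule: finite_induct)
  case (insert i I)
  then obtain x y where "f i x \<noteq> 0" "(\<Prod>i\<in>I. f i y) \<noteq> 0" by (metis insertI1 insertI2)
  moreover have "polynomial_fun (f i)" "polynomial_fun (\<lambda>x. \<Prod>i\<in>I. f i x)"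
    using insert by (auto intro: polynomial_fun_prod)
  ultimately show ?case using polynomial_fun_mult_nonzero[of "f i" "\<lambda>x. \<Prod>i\<in>I. f i x"] insert(1,2)
    by (metis mult_eq_0_iff prod.insert)
qed auto

section \<open>Homogeneous components and leading forms\<close>

lemma coeff_mult_top:
  fixes p q :: "'a::comm_ring_1 poly"
  assumes "\<And>i. i > m \<Longrightarrow> coeff p i = 0" "\<And>i. i > n \<Longrightarrow> coeff q i = 0"
  shows "coeff (p * q) (m + n) = coeff p m * coeff q n"
    and "i > m + n \<Longrightarrow> coeff (p * q) i = 0"
proof -
  have "degree p \<le> m" "degree q \<le> n" using assms by (auto intro: degree_le)
  then have "degree (p * q) \<le> m + n" using degree_mult_le[of p q] by linarith
  then show "i > m + n \<Longrightarrow> coeff (p * q) i = 0" by (simp add: coeff_eq_0)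
  have "coeff p i * coeff q (m + n - i) = (if i = m then coeff p m * coeff q n else 0)" if "i \<le> m + n" for i
    using that assms by (cases "i < m"; cases "i = m") auto
  then have "coeff (p * q) (m + n) = (\<Sum>i\<le>m + n. if i = m then coeff p m * coeff q n else 0)"
    unfolding coeff_mult by (intro sum.cong) auto
  then show "coeff (p * q) (m + n) = coeff p m * coeff q n" by simp
qed

definition homogeneous_part :: "(('v \<Rightarrow> complex) \<Rightarrow> complex) \<Rightarrow> nat \<Rightarrow> ('v \<Rightarrow> complex) \<Rightarrow> complex" where
  "homogeneous_part f i w = coeff (line f (\<lambda>v. 0) w) i"

text \<open>Homogeneity gives \<open>h (z + T w) = T ^ n * h (w + z / T)\<close>, so the restriction
  in direction \<open>w\<close> is, up to powers of \<open>T\<close>, the reversal of the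
  restriction with \<open>z\<close> and \<open>w\<close> exchanged. The factor
  \<open>monom 1 m\<close> clears the denominators.\<close>

lemma homogeneous_line_coeff:
  assumes f: "polynomial_fun h" and hom: "\<And>T x. h (\<lambda>v. T * x v) = T ^ n * h x"
  shows "coeff (line h z w) n = h w" "i > n \<Longrightarrow> coeff (line h z w) i = 0"
proof -
  define p q where "p = line h z w" and "q = line h w z"
  define m where "m = degree q"
  have "poly (p * monom 1 m) T = poly (monom 1 n * reflect_poly q) T" if "T \<noteq> 0" for T
  proof -
    have "poly p T = h (\<lambda>v. T * (w v + inverse T * z v))"
      using that unfolding p_def poly_line[OF f] by (simp add: distrib_left mult.assoc[symmetric] add.commute)
    also have "\<dots> = T ^ n * poly q (inverse T)" by (simp add: hom q_def poly_line f)
    finally show ?thesis using that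
      by (simp add: poly_monom poly_reflect_poly_nz m_def)
  qed
  then have "UNIV - {0} \<subseteq> {T. poly (p * monom 1 m - monom 1 n * reflect_poly q) T = 0}" by auto
  then have "infinite {T. poly (p * monom 1 m - monom 1 n * reflect_poly q) T = 0}"
    by (metis finite_subset infinite_UNIV_char_0 infinite_remove)
  then have eq: "p * monom 1 m = monom 1 n * reflect_poly q"
    using poly_roots_finite[of "p * monom 1 m - monom 1 n * reflect_poly q"] by auto
  have "coeff p i = coeff (reflect_poly q) (i + m - n)" if "i \<ge> n" for i
    using arg_cong[OF eq, of "\<lambda>p. coeff p (i + m)"] that
    by (simp add: coeff_monom_mult mult.commute[of p])
  then have *: "coeff p i = (if i > n then 0 else coeff q 0)" if "i \<ge> n" for i
    using that by (auto simp: m_def coeff_reflect_poly)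
  show "coeff (line h z w) n = h w"
    using *[of n] poly_line[OF f, of w z 0] by (simp add: p_def q_def poly_0_coeff_0)
  show "i > n \<Longrightarrow> coeff (line h z w) i = 0" using *[of i] by (simp add: p_def)
qed

text \<open>\<open>g\<close> is the highest nonzero homogeneous component. The lower components do
  not reach \<open>T ^ n\<close>, so this coefficient depends on the direction only; any
  \<open>w\<close> with \<open>g w \<noteq> 0\<close> is a direction along which \<open>f\<close>
  has constant leading coefficient.\<close>

lemma leading_form:
  assumes f: "polynomial_fun f" and nz: "f x \<noteq> 0"
  obtains n g where "polynomial_fun g" "\<exists>w. g w \<noteq> 0"
    "\<And>z w. coeff (line f z w) n = g w" "\<And>z w i. i > n \<Longrightarrow> coeff (line f z w) i = 0"
proof -
  let ?h = "homogeneous_part f"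
  obtain N where N: "\<And>z w. degree (line f z w) \<le> N" using degree_line_bounded[OF f] by auto
  have sum: "f w = (\<Sum>i\<le>N. ?h i w)" for w
  proof -
    have "f w = poly (line f (\<lambda>v. 0) w) 1" by (simp add: poly_line f)
    also have "\<dots> = (\<Sum>i\<le>N. ?h i w)"
      using poly_as_sum_of_monoms'[OF N[of "\<lambda>v. 0" w]]
      by (subst poly_altdef, unfold homogeneous_part_def)
         (auto intro!: sum.mono_neutral_left simp: N le_degree)
    finally show ?thesis .
  qed
  define I where "I = {i. \<exists>w. ?h i w \<noteq> 0}"
  have "i \<le> N" if iI: "i \<in> I" for i
  proof -
    obtain w where "coeff (line f (\<lambda>v. 0) w) i \<noteq> 0"
      using iI unfolding I_def homogeneous_part_def by blast
    then show ?thesis using le_degree N order_trans by blast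
  qed
  then have fin: "finite I" and sub: "I \<subseteq> {..N}" by (auto intro: finite_subset[of I "{..N}"])
  have ne: "I \<noteq> {}"
  proof
    assume "I = {}"
    then have "?h i x = 0" for i by (auto simp: I_def)
    then show False using sum[of x] nz by simp
  qed
  define n where "n = Max I"
  have nI: "n \<in> I" unfolding n_def using fin ne by (rule Max_in)
  have big: "?h i w = 0" if "i > n" for i w
    using that Max_ge[OF fin, of i] by (fastforce simp: n_def I_def)
  have hp: "polynomial_fun (?h i)" for i
    unfolding homogeneous_part_def by (intro polynomial_fun_coeff_line[OF f] polynomial_fun.intros)
  have hhom: "?h i (\<lambda>v. T * x v) = T ^ i * ?h i x" for i T x
    by (simp add: homogeneous_part_def line_scale f)
  have line_f: "line f z w = (\<Sum>i\<le>N. line (?h i) z w)" for z w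
    by (rule line_eqI) (simp add: poly_sum poly_line hp sum)
  have c: "coeff (line f z w) j = (\<Sum>i\<le>N. coeff (line (?h i) z w) j)" for z w j
    by (simp add: line_f coeff_sum)
  have z: "coeff (line (?h i) z w) j = 0" if "j > n \<or> j = n \<and> i \<noteq> n" for i j z w
  proof (cases "i > n")
    case True
    then have "?h i = (\<lambda>x. 0)" using big by auto
    then show ?thesis by simp
  next
    case False
    then show ?thesis using homogeneous_line_coeff(2)[OF hp hhom] that by auto
  qed
  show ?thesis
  proof
    show "polynomial_fun (?h n)" by (rule hp)
    show "\<exists>w. ?h n w \<noteq> 0" using nI by (auto simp: I_def)
    show "coeff (line f z w) j = 0" if "j > n" for j z w
      unfolding c using z that by (intro sum.neutral) auto
    show "coeff (line f z w) n = ?h n w" for z w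
    proof -
      have "coeff (line f z w) n = (\<Sum>i\<le>N. if i = n then coeff (line (?h n) z w) n else 0)"
        unfolding c using z by (intro sum.cong) auto
      also have "\<dots> = coeff (line (?h n) z w) n" using nI sub by (auto simp: sum.delta)
      finally show ?thesis using homogeneous_line_coeff(1)[OF hp hhom] by simp
    qed
  qed
qed

section \<open>Polynomial functions on holomorphic curves\<close>

lemma tendsto_polynomial_fun:
  assumes "polynomial_fun f" "\<And>v. ((\<lambda>s. g s v) \<longlongrightarrow> w v) F"
  shows "((\<lambda>s. f (g s)) \<longlongrightarrow> f w) F"
  using assms(1) by induction (auto intro: tendsto_intros assms(2))

lemma polynomial_fun_holomorphic:
  assumes "polynomial_fun f" "\<And>v. (\<lambda>s. g s v) holomorphic_on U"
  shows "(\<lambda>s. f (g s)) holomorphic_on U"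
  using assms(1) by induction (auto intro: holomorphic_intros assms(2))

text \<open>The linear coefficient on the line through \<open>g t\<close> in direction
  \<open>w\<close> is the directional derivative, so this is the chain rule.\<close>

lemma polynomial_fun_has_field_derivative:
  assumes "polynomial_fun f" "\<And>v. ((\<lambda>s. g s v) has_field_derivative w v) (at t)"
  shows "((\<lambda>s. f (g s)) has_field_derivative coeff (line f (g t) w) 1) (at t)"
  using assms(1)
proof induction
  case (mult f1 f2)
  show ?case
    by (rule derivative_eq_intros mult)+
       (simp add: line_mult mult coeff_mult poly_0_coeff_0[symmetric] poly_line_0)
qed (auto intro!: derivative_eq_intros assms(2) simp: line_add)

text \<open>The lowest form of \<open>h\<close> at \<open>x0\<close> vanishes at the velocity of each such curve.\<close>

lemma polynomial_fun_zero_if_all_tangents: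
  assumes h: "polynomial_fun h"
    and curve: "\<And>\<psi>. \<exists>\<gamma>. \<gamma> 0 = x0 \<and> (\<forall>s. h (\<gamma> s) = 0) \<and>
      (\<forall>v. ((\<lambda>s. \<gamma> s v) has_field_derivative \<psi> v) (at (0::complex)))"
  shows "h x = 0"
proof (rule ccontr)
  assume nz: "h x \<noteq> 0"
  define k where "k = (\<lambda>i w. coeff (line h x0 w) i)"
  obtain N where N: "\<And>z w. degree (line h z w) \<le> N" using degree_line_bounded[OF h] by auto
  have kp: "polynomial_fun (k i)" for i
    unfolding k_def by (rule polynomial_fun_coeff_line[OF h]) (auto intro: polynomial_fun.intros)
  have sum: "h (\<lambda>v. x0 v + T * w v) = (\<Sum>i\<le>N. k i w * T ^ i)" for T w
    unfolding poly_line[OF h, symmetric] k_def poly_altdef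
    by (rule sum.mono_neutral_left) (auto simp: N coeff_eq_0)
  define P where "P = (\<lambda>i. \<exists>w. k i w \<noteq> 0)"
  have "\<exists>i. P i"
  proof (rule ccontr)
    assume "\<not> ?thesis"
    then show False using sum[of 1 "\<lambda>v. x v - x0 v"] nz by (simp add: P_def)
  qed
  then obtain d where d: "P d" "\<And>i. i < d \<Longrightarrow> \<not> P i" by (metis exists_least_iff)
  then have dN: "d \<le> N" using N unfolding P_def k_def
    by (metis coeff_eq_0 le_less_trans not_le)
  have "k d \<psi> = 0" for \<psi>
  proof -
    obtain \<gamma> where g: "\<gamma> 0 = x0" "\<And>s. h (\<gamma> s) = 0"
      "\<And>v. ((\<lambda>s. \<gamma> s v) has_field_derivative \<psi> v) (at (0::complex))" using curve by metis
    \<comment> \<open>Secant directions: \<open>\<gamma> s = x0 + s * w s\<close> and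
      \<open>w s\<close> tends to \<open>\<psi>\<close>. Dividing \<open>h (\<gamma> s) = 0\<close>
      by \<open>s ^ d\<close> leaves only the lowest form in the limit.\<close>
    define w where "w = (\<lambda>s v. (\<gamma> s v - x0 v) / s)"
    have w: "((\<lambda>s. w s v) \<longlongrightarrow> \<psi> v) (at 0)" for v
      using g(3)[of v] by (simp add: has_field_derivative_iff w_def g(1))
    have "((\<lambda>s. \<Sum>i\<in>{d..N}. k i (w s) * s ^ (i - d)) \<longlongrightarrow> (\<Sum>i\<in>{d..N}. k i \<psi> * 0 ^ (i - d))) (at 0)"
      by (intro tendsto_intros tendsto_polynomial_fun[OF kp] w)
    also have "(\<Sum>i\<in>{d..N}. k i \<psi> * 0 ^ (i - d)) = (\<Sum>i\<in>{d..N}. if i = d then k d \<psi> else 0)"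
      by (intro sum.cong) auto
    also have "\<dots> = k d \<psi>" using dN by simp
    finally have lim: "((\<lambda>s. \<Sum>i\<in>{d..N}. k i (w s) * s ^ (i - d)) \<longlongrightarrow> k d \<psi>) (at 0)" .
    have "(\<Sum>i\<in>{d..N}. k i (w s) * s ^ (i - d)) = 0" if "s \<noteq> 0" for s
    proof -
      have "0 = h (\<lambda>v. x0 v + s * w s v)" using that by (simp add: w_def g(2))
      also have "\<dots> = (\<Sum>i\<le>N. k i (w s) * s ^ i)" by (rule sum)
      also have "\<dots> = (\<Sum>i\<in>{d..N}. k i (w s) * s ^ i)"
        using d(2) by (intro sum.mono_neutral_right) (auto simp: P_def)
      also have "\<dots> = s ^ d * (\<Sum>i\<in>{d..N}. k i (w s) * s ^ (i - d))"
        by (auto simp: sum_distrib_left power_add[symmetric] intro!: sum.cong)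
      finally show ?thesis using that by simp
    qed
    then have "((\<lambda>s. 0) \<longlongrightarrow> k d \<psi>) (at (0::complex))"
      by (intro Lim_transform_eventually[OF lim]) (auto simp: eventually_at intro: exI[of _ 1])
    then show ?thesis by (simp add: tendsto_const_iff)
  qed
  then show False using d(1) by (auto simp: P_def)
qed

section \<open>Principal vanishing ideals\<close>

lemma complex_root_exists:
  fixes p :: "complex poly"
  assumes "degree p \<noteq> 0"
  obtains r q where "p = [:- r, 1:] * q" "degree p = Suc (degree q)" "q \<noteq> 0" "poly p r = 0"
proof -
  obtain r where r: "poly p r = 0"
    using alg_closed_imp_poly_has_root[of p] assms by auto
  then obtain q where q: "p = [:- r, 1:] * q" by (auto simp: poly_eq_0_iff_dvd dvd_def)
  then have "q \<noteq> 0" using assms by auto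
  then have "degree p = Suc (degree q)" unfolding q by (subst degree_mult_eq) auto
  with r q \<open>q \<noteq> 0\<close> show ?thesis using that by blast
qed

text \<open>Up to sign, the constant term is the leading coefficient times the product of the roots;
  the induction splits off one root at a time.\<close>

lemma norm_poly_0_le:
  fixes p :: "complex poly"
  assumes "\<And>r. poly p r = 0 \<Longrightarrow> norm r \<le> \<rho>" "p \<noteq> 0"
  shows "norm (poly p 0) \<le> norm (lead_coeff p) * \<rho> ^ degree p"
  using assms
proof (induction "degree p" arbitrary: p)
  case 0
  then obtain c where "p = [:c:]" by (metis degree_eq_zeroE)
  then show ?case by simp
next
  case (Suc n)
  then have "degree p \<noteq> 0" by simp
  then obtain r q where q: "p = [:- r, 1:] * q" "degree p = Suc (degree q)" "q \<noteq> 0" "poly p r = 0"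
    by (rule complex_root_exists)
  have "norm (poly q 0) \<le> norm (lead_coeff q) * \<rho> ^ degree q"
    using Suc.prems(1) Suc.hyps(2) q by (intro Suc.hyps(1)) auto
  moreover have "norm r \<le> \<rho>" using Suc.prems(1) q(4) by blast
  ultimately have "norm r * norm (poly q 0) \<le> \<rho> * (norm (lead_coeff q) * \<rho> ^ degree q)"
    using norm_ge_zero order_trans by (intro mult_mono) blast+
  moreover have lc: "lead_coeff p = lead_coeff q" unfolding q(1) lead_coeff_mult by simp
  moreover have "norm (poly p 0) = norm r * norm (poly q 0)" by (simp add: q(1) norm_mult)
  ultimately show ?case unfolding lc unfolding q(2) by (simp add: ac_simps)
qed

text \<open>A form of Cauchy's root bound: outside the unit disc every lower power of
  \<open>r\<close> is at most \<open>r ^ (n - 1)\<close> in norm. For a fixed leading coefficient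
  the bound is continuous in the other coefficients.\<close>

lemma norm_poly_root_le:
  fixes p :: "complex poly"
  assumes "poly p r = 0" "coeff p n \<noteq> 0" "\<And>i. i > n \<Longrightarrow> coeff p i = 0"
  shows "norm r \<le> 1 + (\<Sum>i<n. norm (coeff p i)) / norm (coeff p n)"
proof (cases "norm r \<le> 1")
  case True
  then show ?thesis by (smt (verit) divide_nonneg_nonneg norm_ge_zero sum_nonneg)
next
  case False
  define S where "S = (\<Sum>i<n. norm (coeff p i))"
  have deg: "degree p = n" using assms(2,3)
    by (metis degree_le le_antisym le_degree not_le_imp_less)
  have eq: "(\<Sum>i<n. coeff p i * r ^ i) + coeff p n * r ^ n = 0"
    using assms(1) by (simp add: poly_altdef deg lessThan_Suc_atMost[symmetric])
  have "n \<noteq> 0" using eq assms(2) by (cases n) auto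
  then obtain m where m: "n = Suc m" by (cases n) auto
  have "norm (coeff p n) * norm r ^ n = norm (\<Sum>i<n. coeff p i * r ^ i)"
    using eq by (metis add_eq_0_iff norm_minus_cancel norm_mult norm_power)
  also have "\<dots> \<le> (\<Sum>i<n. norm (coeff p i) * norm r ^ m)"
  proof (rule sum_norm_le)
    fix i assume "i \<in> {..<n}"
    then have "norm r ^ i \<le> norm r ^ m" using False m by (intro power_increasing) auto
    then show "norm (coeff p i * r ^ i) \<le> norm (coeff p i) * norm r ^ m"
      by (simp add: norm_mult norm_power mult_left_mono)
  qed
  also have "\<dots> = S * norm r ^ m" by (simp add: S_def sum_distrib_right)
  finally have "(norm (coeff p n) * norm r) * norm r ^ m \<le> S * norm r ^ m" by (simp add: m ac_simps)
  moreover have "norm r ^ m > 0" using False by (intro zero_less_power) linarith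
  ultimately have "norm (coeff p n) * norm r \<le> S" by (simp only: mult_le_cancel_right_pos)
  then have "norm r \<le> S / norm (coeff p n)" using assms(2) by (simp add: field_simps)
  then show ?thesis by (simp add: S_def)
qed

text \<open>A removable singularity argument: the bound forces \<open>r\<close> to vanish at every
  root of \<open>b\<close>, and cancelling a common linear factor preserves the bound away from that
  root. The exceptional set \<open>F\<close> collects the cancelled roots, which takes care of
  multiplicities.\<close>

lemma poly_dvd_if_bounded_quotient:
  fixes b r :: "complex poly" and B :: "complex \<Rightarrow> real"
  assumes "b \<noteq> 0" "finite F" "continuous_on UNIV B"
    and "\<And>T. T \<notin> F \<Longrightarrow> norm (poly r T) \<le> B T * norm (poly b T)"
  shows "b dvd r"
  using assms(1,2,4)
proof (induction "degree b" arbitrary: b r F)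
  case 0
  then obtain c where "b = [:c:]" "c \<noteq> 0" by (metis degree_eq_zeroE pCons_0_0)
  then show ?case by (intro dvdI[of _ _ "smult (1 / c) r"]) simp
next
  case (Suc n)
  then have "degree b \<noteq> 0" by simp
  then obtain t b' where b: "b = [:- t, 1:] * b'" "degree b = Suc (degree b')" "b' \<noteq> 0" "poly b t = 0"
    by (rule complex_root_exists)
  have ev: "\<forall>\<^sub>F T in at t. T \<notin> F"
    using islimpt_finite[OF Suc.prems(2), of t] by (simp add: islimpt_iff_eventually)
  have "((\<lambda>T. B T * norm (poly b T)) \<longlongrightarrow> B t * norm (poly b t)) (at t)"
    using assms(3) by (intro tendsto_intros poly_isCont[unfolded isCont_def])
      (simp add: continuous_on_eq_continuous_at isCont_def)
  then have 1: "((\<lambda>T. B T * norm (poly b T)) \<longlongrightarrow> 0) (at t)" using b(4) by simp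
  have "((\<lambda>T. poly r T) \<longlongrightarrow> 0) (at t)"
    using ev by (intro Lim_null_comparison[OF _ 1]) (auto elim!: eventually_mono intro: Suc.prems(3))
  moreover have "((\<lambda>T. poly r T) \<longlongrightarrow> poly r t) (at t)" using poly_isCont isCont_def by blast
  ultimately have "poly r t = 0" using tendsto_unique[OF at_neq_bot] by metis
  then obtain r' where r: "r = [:- t, 1:] * r'" by (auto simp: poly_eq_0_iff_dvd dvd_def)
  have "norm (poly r' T) \<le> B T * norm (poly b' T)" if "T \<notin> insert t F" for T
  proof -
    have "norm (T - t) * norm (poly r' T) \<le> norm (T - t) * (B T * norm (poly b' T))"
      using Suc.prems(3)[of T] that by (simp add: b(1) r norm_mult[symmetric] algebra_simps)
    then show ?thesis using that by (simp add: mult_le_cancel_left_pos)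
  qed
  then have "b' dvd r'" using Suc.hyps b Suc.prems(2) by (metis finite_insert nat.inject)
  then show ?case unfolding b(1) r by (rule mult_dvd_mono[OF dvd_refl])
qed

section \<open>Division along a fixed direction\<close>

definition line_degree_less :: "('v \<Rightarrow> complex) \<Rightarrow> (('v \<Rightarrow> complex) \<Rightarrow> complex) \<Rightarrow> nat \<Rightarrow> bool" where
  "line_degree_less v f n \<longleftrightarrow> (\<forall>z. \<forall>i\<ge>n. coeff (line f z v) i = 0)"

lemma line_degree_less_mono: "line_degree_less v f m \<Longrightarrow> m \<le> n \<Longrightarrow> line_degree_less v f n"
  by (auto simp: line_degree_less_def)

lemma line_degree_less_exists: "polynomial_fun f \<Longrightarrow> \<exists>n. line_degree_less v f n"
  using degree_line_bounded[of f] unfolding line_degree_less_def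
  by (metis Suc_le_lessD coeff_eq_0 le_less_trans)

text \<open>Moving the base point along \<open>v\<close> substitutes \<open>T + s\<close> for
  \<open>T\<close>, which preserves the leading coefficient. Top coefficients are thus invariant
  under translation by \<open>v\<close>, the kind of polynomial that the ideal must not
  contain.\<close>

lemma top_coeff_invariant:
  assumes f: "polynomial_fun f" and d: "line_degree_less v f (Suc n)"
  shows "coeff (line f (\<lambda>u. z u + s * v u) v) n = coeff (line f z v) n"
proof -
  let ?p = "line f z v"
  have deg: "degree ?p \<le> n" using d by (intro degree_le) (auto simp: line_degree_less_def)
  have "coeff (pcompose ?p [:s, 1:]) n = coeff ?p n"
  proof (cases "degree ?p = n")
    case True
    then show ?thesis using lead_coeff_comp[of "[:s, 1:]" ?p] by (simp add: degree_pcompose)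
  next
    case False
    then have "degree (pcompose ?p [:s, 1:]) < n" "degree ?p < n" using deg by (auto simp: degree_pcompose)
    then show ?thesis by (simp add: coeff_eq_0)
  qed
  then show ?thesis by (simp add: line_shift f)
qed

lemma line_top_coeff:
  assumes f: "polynomial_fun f" and d: "line_degree_less v f (Suc n)"
  shows "line (\<lambda>x. coeff (line f x v) n) z v = [:coeff (line f z v) n:]"
  by (rule line_eqI) (simp add: top_coeff_invariant[OF assms])

lemma polynomial_fun_top_coeff:
  "polynomial_fun f \<Longrightarrow> polynomial_fun (\<lambda>x. coeff (line f x v) n)"
  by (rule polynomial_fun_coeff_line) (auto intro: polynomial_fun.intros)

text \<open>Univariate pseudo-division with coefficients that vary with the base point: the top
  coefficients \<open>c\<close> and \<open>e\<close> are constant on each line in direction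
  \<open>v\<close>, so multiplying by them does not raise the degree.\<close>

lemma pseudo_division:
  assumes f: "polynomial_fun f" and fd: "line_degree_less v f (Suc d)"
    and g: "polynomial_fun g" and v: "v s \<noteq> 0"
  shows "\<exists>m q r. polynomial_fun q \<and> polynomial_fun r \<and> line_degree_less v r d \<and>
    (\<forall>x. coeff (line f x v) d ^ m * g x = q x * f x + r x)"
proof -
  define c where "c = (\<lambda>x. coeff (line f x v) d)"
  have cp: "polynomial_fun c" unfolding c_def by (rule polynomial_fun_top_coeff[OF f])
  have lc: "line c z v = [:c z:]" for z unfolding c_def by (rule line_top_coeff[OF f fd])
  obtain n where "line_degree_less v g n" using line_degree_less_exists[OF g] by blast
  with g have "\<exists>m q r. polynomial_fun q \<and> polynomial_fun r \<and> line_degree_less v r d \<and>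
    (\<forall>x. c x ^ m * g x = q x * f x + r x)"
  proof (induction n arbitrary: g)
    case 0
    then show ?case using line_degree_less_mono[of v g 0 d]
      by (intro exI[of _ 0] exI[of _ "\<lambda>x. 0"] exI[of _ g]) (auto intro: polynomial_fun.intros)
  next
    case (Suc n)
    show ?case
    proof (cases "n < d")
      case True
      then show ?thesis using line_degree_less_mono[of v g "Suc n" d] Suc.prems
        by (intro exI[of _ 0] exI[of _ "\<lambda>x. 0"] exI[of _ g]) (auto intro: polynomial_fun.intros)
    next
      case False
      define e where "e = (\<lambda>x. coeff (line g x v) n)"
      \<comment> \<open>The coordinate \<open>x s / v s\<close> has slope one along
        \<open>v\<close>, so \<open>M\<close> has degree \<open>n - d\<close> and leading
        coefficient one there.\<close>
      define M where "M = (\<lambda>x. (x s / v s) ^ (n - d))"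
      have ep: "polynomial_fun e" unfolding e_def by (rule polynomial_fun_top_coeff[OF Suc.prems(1)])
      have le: "line e z v = [:e z:]" for z unfolding e_def by (rule line_top_coeff[OF Suc.prems])
      have Mp: "polynomial_fun M" unfolding M_def by (intro polynomial_fun_intros)
      have lM: "line M z v = [:z s / v s, 1:] ^ (n - d)" for z
        by (rule line_eqI) (use v in \<open>simp add: M_def poly_power field_simps\<close>)
      have lMf: "line (\<lambda>x. M x * f x) z v = line M z v * line f z v" for z
        by (simp add: line_mult Mp f)
      define g' where "g' = (\<lambda>x. c x * g x + (- e x) * (M x * f x))"
      have g'p: "polynomial_fun g'" unfolding g'_def by (intro polynomial_fun_intros cp ep Mp f Suc.prems)
      have lg': "line g' z v = smult (c z) (line g z v) + smult (- e z) (line M z v * line f z v)" for z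
      proof -
        have "line (\<lambda>x. - e x) z v = [:- e z:]"
          using line_mult[OF polynomial_fun.const[of "-1"] ep, of z v] by (simp add: le)
        then show ?thesis unfolding g'_def
          by (subst line_add line_mult, (intro polynomial_fun_intros cp ep Mp f Suc.prems)+)+
             (simp add: lc lMf)
      qed
      have Mc: "coeff (line M z v) (n - d) = 1" "\<And>i. i > n - d \<Longrightarrow> coeff (line M z v) i = 0" for z
      proof -
        have "degree (line M z v) = n - d" unfolding lM by (simp add: degree_power_eq)
        moreover have "lead_coeff (line M z v) = 1" unfolding lM by (simp add: lead_coeff_power)
        ultimately show "coeff (line M z v) (n - d) = 1" "\<And>i. i > n - d \<Longrightarrow> coeff (line M z v) i = 0"
          by (auto simp: coeff_eq_0)
      qed
      have fc: "\<And>i. i > d \<Longrightarrow> coeff (line f z v) i = 0" for z using fd by (auto simp: line_degree_less_def)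
      have "line_degree_less v g' n" unfolding line_degree_less_def
      proof (intro allI impI)
        fix z i assume i: "n \<le> i"
        have nd: "n - d + d = n" using False by simp
        show "coeff (line g' z v) i = 0"
        proof (cases "i = n")
          case True
          have "coeff (line M z v * line f z v) n = c z"
            using coeff_mult_top(1)[where p = "line M z v" and q = "line f z v" and m = "n - d" and n = d, OF Mc(2) fc] by (simp add: nd Mc c_def)
          then show ?thesis by (simp add: lg' True e_def)
        next
          case False
          then have "coeff (line M z v * line f z v) i = 0"
            using coeff_mult_top(2)[where p = "line M z v" and q = "line f z v" and m = "n - d" and n = d, OF Mc(2) fc, of i] i by (simp add: nd)
          moreover have "coeff (line g z v) i = 0"
            using Suc.prems(2) i False by (auto simp: line_degree_less_def)
          ultimately show ?thesis by (simp add: lg')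
        qed
      qed
      from Suc.IH[OF g'p this] obtain m q r where
        qr: "polynomial_fun q" "polynomial_fun r" "line_degree_less v r d"
        "\<And>x. c x ^ m * g' x = q x * f x + r x" by blast
      have "c x ^ Suc m * g x = (q x + c x ^ m * (e x * M x)) * f x + r x" for x
        using qr(4)[of x] by (simp add: g'_def algebra_simps)
      moreover have "polynomial_fun (\<lambda>x. q x + c x ^ m * (e x * M x))"
        by (intro polynomial_fun_intros qr cp ep Mp)
      ultimately show ?thesis using qr by blast
    qed
  qed
  then show ?thesis by (simp add: c_def)
qed

text \<open>In a direction \<open>w\<close> where \<open>b\<close> has constant leading coefficient,
  pseudo-division is true division up to the constant \<open>\<kappa>\<close>. On each line in
  direction \<open>w\<close> the bound makes \<open>b\<close> divide the remainder, whose degree is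
  too small for it to be nonzero.\<close>

lemma polynomial_fun_dvd_if_bounded_quotient:
  assumes a: "polynomial_fun a" and b: "polynomial_fun b" "b x0 \<noteq> 0"
    and B: "\<And>z w. continuous_on UNIV (\<lambda>T::complex. B (\<lambda>v. z v + T * w v) :: real)"
    and bound: "\<And>x. b x \<noteq> 0 \<Longrightarrow> norm (a x) \<le> B x * norm (b x)"
  shows "\<exists>q. polynomial_fun q \<and> (\<forall>x. a x = q x * b x)"
proof -
  obtain n g w where g: "polynomial_fun g" "g w \<noteq> 0"
    "\<And>z w. coeff (line b z w) n = g w" "\<And>z w i. i > n \<Longrightarrow> coeff (line b z w) i = 0"
    using leading_form[of b x0] b by metis
  show ?thesis
  proof (cases "n = 0")
    \<comment> \<open>Here \<open>b\<close> is constant. This case stands apart because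
      \<open>w\<close> may then be zero and offer no coordinate \<open>s\<close> for the
      division.\<close>
    case True
    have "b x = g w" for x
    proof -
      have "degree (line b x w) \<le> 0" using g(4) True by (intro degree_le) auto
      then show ?thesis using g(3)[of x w] True poly_line_0[OF b(1), of x w] by (simp add: poly_0_coeff_0)
    qed
    then show ?thesis using g(2) polynomial_fun_divide_const[OF a, of "g w"]
      by (intro exI[of _ "\<lambda>x. a x / g w"]) auto
  next
    case False
    have "\<exists>s. w s \<noteq> 0"
    proof (rule ccontr)
      assume "\<not> ?thesis"
      then have w: "w = (\<lambda>v. 0)" by auto
      have "line b (\<lambda>v. 0) w = [:b (\<lambda>v. 0):]" by (rule line_eqI) (simp add: w)
      then show False using g(2) g(3)[of "\<lambda>v. 0" w] False by (cases n) auto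
    qed
    then obtain s where s: "w s \<noteq> 0" by blast
    have "line_degree_less w b (Suc n)" using g(4) by (auto simp: line_degree_less_def)
    from pseudo_division[OF b(1) this a s] obtain m q r where
      qr: "polynomial_fun q" "polynomial_fun r" "line_degree_less w r n"
      "\<And>x. coeff (line b x w) n ^ m * a x = q x * b x + r x" by blast
    define \<kappa> where "\<kappa> = g w ^ m"
    have qr': "\<kappa> * a x = q x * b x + r x" for x using qr(4)[of x] by (simp add: g(3) \<kappa>_def)
    have k: "\<kappa> \<noteq> 0" using g(2) by (simp add: \<kappa>_def)
    have "r x = 0" for x
    proof -
      let ?b = "line b x w" and ?r = "line r x w"
      have b0: "?b \<noteq> 0" using g(2) g(3)[of x w] by auto
      define C where "C = (\<lambda>T. norm \<kappa> * B (\<lambda>v. x v + T * w v) + norm (poly (line q x w) T))"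
      have "?b dvd ?r"
      proof (rule poly_dvd_if_bounded_quotient[OF b0])
        show "finite {T. poly ?b T = 0}" by (rule poly_roots_finite[OF b0])
        show "continuous_on UNIV C" unfolding C_def by (intro continuous_intros B)
        fix T assume "T \<notin> {T. poly ?b T = 0}"
        then have nz: "b (\<lambda>v. x v + T * w v) \<noteq> 0" by (simp add: poly_line b)
        let ?x = "\<lambda>v. x v + T * w v"
        have "r ?x = \<kappa> * a ?x - q ?x * b ?x" using qr' by simp
        then have "norm (r ?x) \<le> norm \<kappa> * norm (a ?x) + norm (q ?x) * norm (b ?x)"
          using norm_triangle_ineq4[of "\<kappa> * a ?x" "q ?x * b ?x"] by (simp only: norm_mult)
        also have "\<dots> \<le> norm \<kappa> * (B ?x * norm (b ?x)) + norm (q ?x) * norm (b ?x)"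
          using bound[OF nz] by (intro add_right_mono mult_left_mono) auto
        finally show "norm (poly ?r T) \<le> C T * norm (poly ?b T)"
          by (simp add: poly_line b qr C_def algebra_simps)
      qed
      moreover have "degree ?r < n" using qr(3) False
        by (auto simp: line_degree_less_def intro!: degree_lessI)
      moreover have "degree ?b = n" using g(2-4) by (intro antisym degree_le le_degree) auto
      ultimately have "?r = 0" using dvd_imp_degree_le[of ?b ?r] by linarith
      then show ?thesis using poly_line_0[OF qr(2), of x w] by simp
    qed
    then have "a x = (q x / \<kappa>) * b x" for x using qr'[of x] k by (simp add: field_simps)
    moreover have "polynomial_fun (\<lambda>x. q x / \<kappa>)" by (intro polynomial_fun_divide_const qr)
    ultimately show ?thesis by blast
  qed
qed

text \<open>A nonzero \<open>f\<close> in the ideal of minimal degree along \<open>v\<close> divides a power of its top coefficient \<open>c\<close>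
  times \<open>f1\<close>, so its roots along \<open>v\<close> are bounded by those of \<open>f1\<close>. Hence \<open>f / c\<close> is locally bounded,
  so it is a polynomial; being monic along \<open>v\<close>, it generates the ideal.\<close>

theorem principal_vanishing_ideal:
  assumes prime: "\<And>f g. polynomial_fun f \<Longrightarrow> polynomial_fun g \<Longrightarrow> (\<forall>x\<in>X. f x * g x = 0) \<Longrightarrow>
      (\<forall>x\<in>X. f x = 0) \<or> (\<forall>x\<in>X. g x = 0)"
    and f1: "polynomial_fun f1" "\<forall>x\<in>X. f1 x = 0" "\<kappa> \<noteq> 0"
      "\<And>z. coeff (line f1 z v) n = \<kappa>" "\<And>z i. i > n \<Longrightarrow> coeff (line f1 z v) i = 0"
    and inv: "\<And>h x. polynomial_fun h \<Longrightarrow> \<forall>x\<in>X. h x = 0 \<Longrightarrow> (\<And>x s. h (\<lambda>u. x u + s * v u) = h x) \<Longrightarrow> h x = 0"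
    and v: "v s \<noteq> 0"
  shows "\<exists>F d. polynomial_fun F \<and> (\<forall>x\<in>X. F x = 0) \<and> d \<noteq> 0 \<and> (\<forall>z. coeff (line F z v) d = 1) \<and>
    (\<forall>g. polynomial_fun g \<longrightarrow> (\<forall>x\<in>X. g x = 0) \<longrightarrow> (\<exists>q. \<forall>x. g x = q x * F x))"
proof -
  define Q where "Q = (\<lambda>n. \<exists>f. polynomial_fun f \<and> (\<forall>x\<in>X. f x = 0) \<and> (\<exists>x. f x \<noteq> 0) \<and> line_degree_less v f n)"
  have "Q (Suc n)"
  proof -
    have "\<exists>x. f1 x \<noteq> 0"
    proof (rule ccontr)
      assume "\<not> ?thesis"
      then have "line f1 v v = 0" by (intro line_eqI) auto
      then show False using f1(3) f1(4)[of v] by simp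
    qed
    then show ?thesis unfolding Q_def using f1(1,2,5)
      by (intro exI[of _ f1]) (auto simp: line_degree_less_def)
  qed
  then obtain N where N: "Q N" "\<And>m. m < N \<Longrightarrow> \<not> Q m" by (metis exists_least_iff)
  then obtain f x0 where f: "polynomial_fun f" "\<forall>x\<in>X. f x = 0" "f x0 \<noteq> 0" "line_degree_less v f N"
    unfolding Q_def by blast
  have "N \<noteq> 0"
  proof
    assume "N = 0"
    then have "coeff (line f x0 v) 0 = 0" using f(4) by (simp add: line_degree_less_def)
    then show False using f(3) poly_line_0[OF f(1)] by (simp add: poly_0_coeff_0)
  qed
  then obtain d where d: "N = Suc d" by (cases N) auto
  note fd = f(4)[unfolded d]
  have small: "r x = 0" if "polynomial_fun r" "\<forall>x\<in>X. r x = 0" "line_degree_less v r d" for r x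
    using N(2)[of d] that unfolding Q_def d by blast
  define c where "c = (\<lambda>x. coeff (line f x v) d)"
  have cp: "polynomial_fun c" unfolding c_def by (rule polynomial_fun_top_coeff[OF f(1)])
  have lc: "line c z v = [:c z:]" for z unfolding c_def by (rule line_top_coeff[OF f(1) fd])
  have c_inv: "c (\<lambda>u. x u + s * v u) = c x" for x s
    unfolding c_def by (rule top_coeff_invariant[OF f(1) fd])
  have c_ne: "\<exists>x. c x \<noteq> 0"
  proof (rule ccontr)
    assume "\<not> ?thesis"
    then have "line_degree_less v f d" using fd unfolding line_degree_less_def c_def
      by (metis Suc_leI le_neq_implies_less)
    then show False using small[OF f(1,2)] f(3) by blast
  qed
  then obtain x1 where x1: "c x1 \<noteq> 0" by blast
  \<comment> \<open>The nonzero \<open>c\<close> is constant along \<open>v\<close>, so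
    \<open>inv\<close> keeps it out of the ideal. This is what allows primality to pass from
    \<open>F * c\<close> to \<open>F\<close>.\<close>
  have c_notin: "\<not> (\<forall>x\<in>X. c x = 0)" using inv[OF cp _ c_inv] x1 by blast
  have cancel: "h x = 0" if "polynomial_fun h" "\<And>x. h x * c x = 0" for h x
    using polynomial_fun_mult_nonzero[OF that(1) cp] x1 that(2) by (metis mult_eq_0_iff)
  have "d \<noteq> 0"
  proof
    assume "d = 0"
    then have "c x = f x" for x using poly_line_0[OF f(1)] by (simp add: c_def poly_0_coeff_0)
    then show False using f(2) c_notin by simp
  qed
  obtain m q r where qr: "polynomial_fun q" "polynomial_fun r" "line_degree_less v r d"
    "\<And>x. c x ^ m * f1 x = q x * f x + r x"
    using pseudo_division[where v = v and s = s, OF f(1) fd f1(1) v] unfolding c_def by blast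
  have "\<forall>x\<in>X. r x = 0"
  proof
    fix x assume "x \<in> X"
    then show "r x = 0" using qr(4)[of x] f(2) f1(2) by simp
  qed
  with qr have r0: "c x ^ m * f1 x = q x * f x" for x using small[of r] by simp
  \<comment> \<open>The root bound for \<open>f1\<close> along \<open>v\<close>. By
    \<open>r0\<close> it also bounds the roots of \<open>f\<close> wherever \<open>c\<close> is
    nonzero, and it is continuous in \<open>x\<close> because the leading coefficient
    \<open>\<kappa>\<close> is constant.\<close>
  define \<rho> where "\<rho> = (\<lambda>x. 1 + (\<Sum>i<n. norm (coeff (line f1 x v) i)) / norm \<kappa>)"
  have "\<exists>F. polynomial_fun F \<and> (\<forall>x. f x = F x * c x)"
  proof (rule polynomial_fun_dvd_if_bounded_quotient[OF f(1) cp x1])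
    fix z w
    have "continuous_on UNIV (\<lambda>T. coeff (line f1 (\<lambda>v. z v + T * w v) v) i)" for i
      unfolding poly_line[OF polynomial_fun_top_coeff[OF f1(1)], symmetric] by (intro continuous_intros)
    then show "continuous_on UNIV (\<lambda>T. \<rho> (\<lambda>v. z v + T * w v) ^ d)"
      unfolding \<rho>_def using f1(3) by (intro continuous_intros) auto
  next
    fix x assume cx: "c x \<noteq> 0"
    have deg: "degree (line f x v) = d"
      using cx fd unfolding c_def line_degree_less_def
      by (intro antisym degree_le le_degree) auto
    have "norm (poly (line f x v) 0) \<le> norm (lead_coeff (line f x v)) * \<rho> x ^ degree (line f x v)"
    proof (rule norm_poly_0_le)
      fix t assume "poly (line f x v) t = 0"
      then have "f (\<lambda>u. x u + t * v u) = 0" by (simp add: poly_line f)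
      with r0[of "\<lambda>u. x u + t * v u"] have "f1 (\<lambda>u. x u + t * v u) = 0" using cx by (simp add: c_inv)
      then have "poly (line f1 x v) t = 0" by (simp add: poly_line f1)
      from norm_poly_root_le[OF this, of n] show "norm t \<le> \<rho> x" using f1(3-5) by (simp add: \<rho>_def)
    qed (use cx in \<open>auto simp: c_def\<close>)
    then show "norm (f x) \<le> \<rho> x ^ d * norm (c x)" by (simp add: poly_line_0 f deg c_def mult.commute)
  qed
  then obtain F where F: "polynomial_fun F" "\<And>x. f x = F x * c x" by blast
  have FX: "\<forall>x\<in>X. F x = 0" using prime[OF F(1) cp] f(2) F(2) c_notin by auto
  have "f = (\<lambda>x. F x * c x)" using F(2) by auto
  then have "line f z v = line F z v * line c z v" for z
    by (rule ssubst) (rule line_mult[OF F(1) cp])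
  then have coeff_F: "coeff (line f z v) i = coeff (line F z v) i * c z" for z i
    by (simp add: lc mult.commute)
  \<comment> \<open>\<open>c\<close> is both the top coefficient of \<open>f\<close> and its
    cofactor in \<open>f = F * c\<close>; being a nonzero polynomial, it cancels.\<close>
  have F_top: "coeff (line F z v) d = 1" for z
  proof -
    have "polynomial_fun (\<lambda>z. coeff (line F z v) d - 1)"
      by (intro polynomial_fun_intros polynomial_fun_top_coeff F)
    moreover have "(coeff (line F z v) d - 1) * c z = 0" for z
      using coeff_F[of z d] by (simp add: left_diff_distrib flip: c_def) (simp add: c_def)
    ultimately have "coeff (line F z v) d - 1 = 0" by (rule cancel)
    then show ?thesis by simp
  qed
  have F_high: "line_degree_less v F (Suc d)"
    unfolding line_degree_less_def
  proof (intro allI impI)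
    fix z i assume "Suc d \<le> i"
    then have "coeff (line F z v) i * c z = 0" for z
      using fd coeff_F[of z i] by (simp add: line_degree_less_def)
    then show "coeff (line F z v) i = 0" by (rule cancel[OF polynomial_fun_top_coeff[OF F(1)]])
  qed
  show ?thesis
  proof (rule exI[of _ F], rule exI[of _ d], intro conjI F(1) FX \<open>d \<noteq> 0\<close> allI F_top impI)
    fix g assume g: "polynomial_fun g" "\<forall>x\<in>X. g x = 0"
    obtain m q r where qr: "polynomial_fun q" "polynomial_fun r" "line_degree_less v r d"
      "\<And>x. coeff (line F x v) d ^ m * g x = q x * F x + r x"
      using pseudo_division[where v = v and s = s, OF F(1) F_high g(1) v] by blast
    then have eq: "g x = q x * F x + r x" for x by (simp add: F_top)
    have "\<forall>x\<in>X. r x = 0"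
    proof
      fix x assume "x \<in> X"
      then show "r x = 0" using eq[of x] g(2) FX by simp
    qed
    then have "r x = 0" for x using small qr by blast
    then show "\<exists>q. \<forall>x. g x = q x * F x" using eq by auto
  qed
qed

section \<open>Algebraic dependence\<close>

lemma sum_fun_apply: "(\<Sum>i\<in>I. f i) x = (\<Sum>i\<in>I. f i x)"
  for f :: "'i \<Rightarrow> 'b \<Rightarrow> 'c::comm_monoid_add"
  by (induction I rule: infinite_finite_induct) auto

interpretation complex_fun: vector_space "\<lambda>c (f :: 'a \<Rightarrow> complex) x. c * f x"
  by unfold_locales (auto simp: fun_eq_iff algebra_simps)

section \<open>Spaces of polynomials with bounded degree in each variable\<close>

definition monomial_fun :: "'p set \<Rightarrow> ('p \<Rightarrow> nat) \<Rightarrow> ('p \<Rightarrow> complex) \<Rightarrow> complex" where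
  "monomial_fun P e t = (\<Prod>p\<in>P. t p ^ e p)"

text \<open>Bounding each exponent separately, rather than the total degree, bounds the number of
  spanning monomials by the pure power \<open>(n + 1) ^ card P\<close>.\<close>

definition box_polynomials :: "'p set \<Rightarrow> nat \<Rightarrow> (('p \<Rightarrow> complex) \<Rightarrow> complex) set" where
  "box_polynomials P n = complex_fun.span (monomial_fun P ` (P \<rightarrow>\<^sub>E {..n}))"

lemma box_polynomials_add:
  "f \<in> box_polynomials P n \<Longrightarrow> g \<in> box_polynomials P n \<Longrightarrow> (\<lambda>t. f t + g t) \<in> box_polynomials P n"
  unfolding box_polynomials_def using complex_fun.span_add[of f _ g] by (simp add: plus_fun_def)

lemma box_polynomials_scale:
  "f \<in> box_polynomials P n \<Longrightarrow> (\<lambda>t. c * f t) \<in> box_polynomials P n"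
  unfolding box_polynomials_def by (rule complex_fun.span_scale)

lemma box_polynomials_zero: "(\<lambda>t. 0) \<in> box_polynomials P n"
  unfolding box_polynomials_def using complex_fun.span_zero by (simp add: zero_fun_def)

lemma box_polynomials_mono: "m \<le> n \<Longrightarrow> box_polynomials P m \<subseteq> box_polynomials P n"
  unfolding box_polynomials_def by (intro complex_fun.span_mono image_mono PiE_mono) auto

lemma monomial_in_box:
  assumes "\<And>p. p \<in> P \<Longrightarrow> e p \<le> n"
  shows "monomial_fun P e \<in> box_polynomials P n"
proof -
  have "monomial_fun P e = monomial_fun P (restrict e P)" by (auto simp: monomial_fun_def intro!: prod.cong)
  then show ?thesis using assms unfolding box_polynomials_def
    by (auto intro!: complex_fun.span_base imageI)
qed

lemma box_polynomials_induct [consumes 1, case_names zero step]: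
  assumes "f \<in> box_polynomials P n"
    and "Q (\<lambda>t. 0)"
    and "\<And>c e f. (\<And>p. p \<in> P \<Longrightarrow> e p \<le> n) \<Longrightarrow> Q f \<Longrightarrow> Q (\<lambda>t. c * monomial_fun P e t + f t)"
  shows "Q f"
  using assms(1) unfolding box_polynomials_def
proof (induction rule: complex_fun.span_induct_alt)
  case base
  then show ?case using assms(2) by (simp add: zero_fun_def)
next
  case (step c x y)
  then obtain e where "x = monomial_fun P e" "e \<in> P \<rightarrow>\<^sub>E {..n}" by auto
  then show ?case using assms(3)[of e y c] step by (auto simp: plus_fun_def PiE_iff)
qed

lemma box_polynomials_mult:
  assumes "f \<in> box_polynomials P m" "g \<in> box_polynomials P n"
  shows "(\<lambda>t. f t * g t) \<in> box_polynomials P (m + n)"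
  using assms(1)
proof (induction rule: box_polynomials_induct)
  case zero
  then show ?case using box_polynomials_zero by simp
next
  case (step c e f)
  have "(\<lambda>t. monomial_fun P e t * g t) \<in> box_polynomials P (m + n)"
    using assms(2)
  proof (induction rule: box_polynomials_induct)
    case zero
    then show ?case using box_polynomials_zero by simp
  next
    case (step c' e' g)
    have "monomial_fun P (\<lambda>p. e p + e' p) \<in> box_polynomials P (m + n)"
      using step.hyps \<open>\<And>p. p \<in> P \<Longrightarrow> e p \<le> m\<close> by (intro monomial_in_box add_mono)
    from box_polynomials_add[OF box_polynomials_scale[OF this, of c'] step.IH]
    show ?case by (simp add: monomial_fun_def power_add prod.distrib algebra_simps)
  qed
  from box_polynomials_add[OF box_polynomials_scale[OF this, of c] step.IH]
  show ?case by (simp add: algebra_simps)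
qed

lemma box_polynomials_one: "(\<lambda>t. 1) \<in> box_polynomials P n"
  using monomial_in_box[of P "\<lambda>p. 0" n] by (simp add: monomial_fun_def[abs_def])

lemma box_polynomials_power:
  "f \<in> box_polynomials P n \<Longrightarrow> (\<lambda>t. f t ^ k) \<in> box_polynomials P (k * n)"
  by (induction k) (auto intro: box_polynomials_mult box_polynomials_one)

lemma box_polynomials_prod:
  "finite S \<Longrightarrow> (\<And>v. v \<in> S \<Longrightarrow> f v \<in> box_polynomials P n) \<Longrightarrow>
    (\<lambda>t. \<Prod>v\<in>S. f v t) \<in> box_polynomials P (card S * n)"
  by (induction S rule: finite_induct) (auto intro: box_polynomials_mult box_polynomials_one)

lemma polynomial_fun_in_box:
  assumes "polynomial_fun f" "finite P"
  shows "\<exists>n. (\<lambda>t. f (\<lambda>p. if p \<in> P then t p else 0)) \<in> box_polynomials P n"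
  using assms(1)
proof induction
  case (const c)
  then show ?case using box_polynomials_scale[OF box_polynomials_one, of c] by auto
next
  case (coord p)
  show ?case
  proof (cases "p \<in> P")
    case True
    have "(\<lambda>t. t p) = monomial_fun P (\<lambda>q. if q = p then 1 else 0)"
    proof
      fix t :: "'a \<Rightarrow> complex"
      have "monomial_fun P (\<lambda>q. if q = p then 1 else 0) t = (\<Prod>q\<in>P. if q = p then t q else 1)"
        unfolding monomial_fun_def by (intro prod.cong) auto
      then show "t p = monomial_fun P (\<lambda>q. if q = p then 1 else 0) t"
        using True assms(2) by (simp add: prod.delta)
    qed
    moreover have "monomial_fun P (\<lambda>q. if q = p then 1 else 0) \<in> box_polynomials P 1"
      by (rule monomial_in_box) auto
    ultimately show ?thesis using True by auto
  next
    case False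
    then show ?thesis using box_polynomials_zero by auto
  qed
next
  case (add f g)
  then obtain m n where "(\<lambda>t. f (\<lambda>p. if p \<in> P then t p else 0)) \<in> box_polynomials P m"
    "(\<lambda>t. g (\<lambda>p. if p \<in> P then t p else 0)) \<in> box_polynomials P n" by blast
  then show ?case using box_polynomials_mono[of m "max m n" P] box_polynomials_mono[of n "max m n" P]
    by (intro exI[of _ "max m n"] box_polynomials_add) auto
next
  case (mult f g)
  then show ?case using box_polynomials_mult by blast
qed

text \<open>With \<open>T\<close> substituted for one variable the relation is a polynomial in
  \<open>T\<close> that vanishes identically; its coefficients are relations among monomials in the
  remaining variables.\<close>

lemma monomials_independent:
  assumes "finite S" "\<And>x :: 'v \<Rightarrow> complex. (\<Sum>d\<in>S \<rightarrow>\<^sub>E {..D}. \<alpha> d * monomial_fun S d x) = 0"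
    and "d \<in> S \<rightarrow>\<^sub>E {..D}"
  shows "\<alpha> d = 0"
  using assms
proof (induction S arbitrary: \<alpha> d rule: finite_induct)
  case empty
  then show ?case by (simp add: monomial_fun_def)
next
  case (insert v S)
  define p where "p = (\<lambda>x i. \<Sum>e\<in>S \<rightarrow>\<^sub>E {..D}. \<alpha> (e(v := i)) * monomial_fun S e x)"
  have "(\<Sum>i\<le>D. p x i * T ^ i) = 0" for x T
  proof -
    have "(\<Sum>i\<le>D. p x i * T ^ i) = (\<Sum>(i, e)\<in>{..D} \<times> (S \<rightarrow>\<^sub>E {..D}). \<alpha> (e(v := i)) * (T ^ i * monomial_fun S e x))"
      by (simp add: p_def sum_distrib_left sum_distrib_right sum.cartesian_product[symmetric] ac_simps)
    also have "\<dots> = (\<Sum>(i, e)\<in>{..D} \<times> (S \<rightarrow>\<^sub>E {..D}). \<alpha> (e(v := i)) * monomial_fun (insert v S) (e(v := i)) (x(v := T)))"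
    proof (intro sum.cong refl, clarify)
      fix i e
      have "monomial_fun S (e(v := i)) (x(v := T)) = monomial_fun S e x"
        unfolding monomial_fun_def using insert.hyps by (intro prod.cong) auto
      then show "\<alpha> (e(v := i)) * (T ^ i * monomial_fun S e x) =
          \<alpha> (e(v := i)) * monomial_fun (insert v S) (e(v := i)) (x(v := T))"
        using insert.hyps by (simp add: monomial_fun_def)
    qed
    also have "\<dots> = (\<Sum>d\<in>insert v S \<rightarrow>\<^sub>E {..D}. \<alpha> d * monomial_fun (insert v S) d (x(v := T)))"
      unfolding PiE_insert_eq using insert.hyps
      by (subst sum.reindex[OF inj_combinator]) (auto simp: o_def case_prod_beta)
    finally show ?thesis using insert.prems by simp
  qed
  then have "p x i = 0" if "i \<le> D" for x i
    using zero_polynom_imp_zero_coeffs[of "p x" D] that by blast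
  moreover have dv: "d v \<le> D" "restrict d S \<in> S \<rightarrow>\<^sub>E {..D}" using insert.prems(2) by (auto simp: PiE_iff)
  ultimately have "(\<Sum>e\<in>S \<rightarrow>\<^sub>E {..D}. \<alpha> (e(v := d v)) * monomial_fun S e x) = 0" for x
    by (simp add: p_def)
  from insert.IH[of "\<lambda>e. \<alpha> (e(v := d v))", OF this dv(2)] have "\<alpha> ((restrict d S)(v := d v)) = 0" .
  also have "(restrict d S)(v := d v) = d"
    using insert.prems(2) by (auto simp: fun_eq_iff PiE_iff extensional_def)
  finally show ?case .
qed

text \<open>Counting: the \<open>(D + 1) ^ card S\<close> monomials in the \<open>X v\<close> lie in a space of dimension
  \<open>O(D ^ card P)\<close>.\<close>

lemma algebraic_dependence:
  assumes S: "finite S" and P: "finite P" and card: "card P < card S"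
    and X: "\<And>v. v \<in> S \<Longrightarrow> polynomial_fun (X v)"
  shows "\<exists>f. polynomial_fun f \<and> (\<exists>x. f x \<noteq> 0) \<and>
    (\<forall>x x'. (\<forall>v\<in>S. x v = x' v) \<longrightarrow> f x = f x') \<and> (\<forall>t\<in>coord_space P. f (\<lambda>v. X v t) = 0)"
proof -
  define Y where "Y = (\<lambda>v t. X v (\<lambda>p. if p \<in> P then t p else 0))"
  have "\<forall>v\<in>S. \<exists>n. Y v \<in> box_polynomials P n"
    unfolding Y_def using polynomial_fun_in_box[OF X P] by blast
  then obtain b where b: "\<And>v. v \<in> S \<Longrightarrow> Y v \<in> box_polynomials P (b v)" by metis
  define B where "B = Suc (Max (insert 0 (b ` S)))"
  have YB: "Y v \<in> box_polynomials P B" if "v \<in> S" for v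
  proof -
    have "b v \<le> B" using that S by (auto simp: B_def intro!: le_SucI Max_ge)
    then show ?thesis using b[OF that] box_polynomials_mono by blast
  qed
  define C where "C = card S * B"
  have C: "C \<ge> 1" using card by (simp add: C_def B_def)
  \<comment> \<open>This choice turns \<open>(C * (D + 1)) ^ card P\<close> into
    \<open>D * (D + 1) ^ card P\<close>, which is less than \<open>(D + 1) ^ card S\<close>.\<close>
  define D where "D = C ^ card P"
  define u where "u = (\<lambda>d t. \<Prod>v\<in>S. Y v t ^ d v)"
  let ?I = "S \<rightarrow>\<^sub>E {..D}"
  let ?M = "monomial_fun P ` (P \<rightarrow>\<^sub>E {..C * D})"
  have finI: "finite ?I" using S by (intro finite_PiE) auto
  have finM: "finite ?M" using P by (intro finite_imageI finite_PiE) auto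
  have "card ?M \<le> (C * D + 1) ^ card P"
    using card_image_le[of "P \<rightarrow>\<^sub>E {..C * D}" "monomial_fun P"] P
    by (simp add: card_PiE finite_PiE)
  also have "\<dots> \<le> (C * (D + 1)) ^ card P"
    using C by (intro power_mono) auto
  also have "\<dots> = D * (D + 1) ^ card P" by (simp only: power_mult_distrib D_def)
  also have "\<dots> < (D + 1) ^ Suc (card P)" by simp
  also have "\<dots> \<le> (D + 1) ^ card S" using card by (intro power_increasing) auto
  also have "\<dots> = card ?I" using S by (simp add: card_PiE)
  finally have card_lt: "card ?M < card ?I" .
  have u_span: "u d \<in> complex_fun.span ?M" if "d \<in> ?I" for d
  proof -
    have "(\<lambda>t. Y v t ^ d v) \<in> box_polynomials P (D * B)" if "v \<in> S" for v
    proof -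
      have "d v \<le> D" using that \<open>d \<in> ?I\<close> by (auto simp: PiE_iff)
      then show ?thesis using box_polynomials_power[OF YB[OF that], of "d v"]
          box_polynomials_mono[of "d v * B" "D * B" P] by auto
    qed
    from box_polynomials_prod[OF S this] show ?thesis
      by (simp add: u_def C_def box_polynomials_def ac_simps)
  qed
  have "\<exists>\<alpha>. (\<exists>d\<in>?I. \<alpha> d \<noteq> 0) \<and> (\<forall>t. (\<Sum>d\<in>?I. \<alpha> d * u d t) = 0)"
  proof (cases "inj_on u ?I")
    \<comment> \<open>Linear dependence is a property of sets. If two exponents give the same
      product, their difference is already a relation.\<close>
    case False
    then obtain d d' where d: "d \<in> ?I" "d' \<in> ?I" "d \<noteq> d'" "u d = u d'" by (auto simp: inj_on_def)
    define \<alpha> where "\<alpha> = (\<lambda>e. (if e = d then 1 else 0) - (if e = d' then 1 else 0 :: complex))"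
    have "(\<Sum>e\<in>?I. \<alpha> e * u e t) = 0" for t
      using d finI by (simp add: \<alpha>_def left_diff_distrib sum_subtractf if_distrib[of "\<lambda>x. x * _"] sum.delta cong: if_cong)
    moreover have "\<alpha> d \<noteq> 0" using d by (simp add: \<alpha>_def)
    ultimately show ?thesis using d(1) by blast
  next
    case True
    have "complex_fun.dependent (u ` ?I)"
    proof (rule ccontr)
      assume "\<not> ?thesis"
      from complex_fun.independent_span_bound[OF finM this] have "card (u ` ?I) \<le> card ?M"
        using u_span by auto
      then show False using card_lt by (simp add: card_image True)
    qed
    then obtain c where c: "\<exists>w\<in>u ` ?I. c w \<noteq> 0" "(\<Sum>w\<in>u ` ?I. (\<lambda>x. c w * w x)) = 0"
      using complex_fun.dependent_finite[of "u ` ?I"] finI by auto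
    have "(\<Sum>d\<in>?I. c (u d) * u d t) = 0" for t
    proof -
      have "(\<Sum>d\<in>?I. c (u d) * u d t) = (\<Sum>w\<in>u ` ?I. c w * w t)"
        by (subst sum.reindex[OF True]) (simp add: o_def)
      also have "\<dots> = (\<Sum>w\<in>u ` ?I. (\<lambda>x. c w * w x)) t"
        by (rule sum_fun_apply[symmetric])
      finally show ?thesis by (simp add: c)
    qed
    then show ?thesis using c(1) by (intro exI[of _ "\<lambda>d. c (u d)"]) auto
  qed
  then obtain \<alpha> d0 where \<alpha>: "d0 \<in> ?I" "\<alpha> d0 \<noteq> 0" "\<And>t. (\<Sum>d\<in>?I. \<alpha> d * u d t) = 0" by blast
  show ?thesis
  proof (intro exI[of _ "\<lambda>x. \<Sum>d\<in>?I. \<alpha> d * monomial_fun S d x"] conjI allI impI ballI)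
    show "polynomial_fun (\<lambda>x. \<Sum>d\<in>?I. \<alpha> d * monomial_fun S d x)"
      unfolding monomial_fun_def by (intro polynomial_fun_intros)
    show "\<exists>x. (\<Sum>d\<in>?I. \<alpha> d * monomial_fun S d x) \<noteq> 0"
      using monomials_independent[OF S _ \<alpha>(1), of \<alpha>] \<alpha>(2) by blast
    show "(\<Sum>d\<in>?I. \<alpha> d * monomial_fun S d x) = (\<Sum>d\<in>?I. \<alpha> d * monomial_fun S d x')"
      if "\<forall>v\<in>S. x v = x' v" for x x'
      using that by (simp add: monomial_fun_def)
    fix t assume t: "t \<in> coord_space P"
    then have "(\<lambda>p. if p \<in> P then t p else 0) = t" by (auto simp: coord_space_def)
    then have "Y v t = X v t" for v by (simp add: Y_def)
    then show "(\<Sum>d\<in>?I. \<alpha> d * monomial_fun S d (\<lambda>v. X v t)) = 0"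
      using \<alpha>(3)[of t] by (simp add: u_def monomial_fun_def)
  qed
qed

section \<open>Discriminants in exponential coordinates\<close>

definition pairing :: "complex ^ 'k \<Rightarrow> int ^ 'k \<Rightarrow> complex" where
  "pairing \<eta> a = (\<Sum>j\<in>UNIV. \<eta> $ j * of_int (a $ j))"

definition exp_vec :: "complex ^ 'k \<Rightarrow> complex ^ 'k" where
  "exp_vec \<eta> = (\<chi> j. exp (\<eta> $ j))"

lemma torus_eq_range_exp_vec: "torus = range exp_vec"
proof (intro equalityI subsetI)
  fix y :: "complex ^ 'k" assume "y \<in> torus"
  then have "y = exp_vec (\<chi> j. Ln (y $ j))" by (simp add: torus_def exp_vec_def vec_eq_iff)
  then show "y \<in> range exp_vec" by blast
qed (auto simp: torus_def exp_vec_def)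

lemma prod_exp_vec_powi: "(\<Prod>j\<in>UNIV. (exp_vec \<eta> $ j) powi (a $ j)) = exp (pairing \<eta> a)"
  by (simp add: exp_vec_def pairing_def exp_sum exp_power_int mult.commute)

lemma laurent_exp_vec: "laurent A c (exp_vec \<eta>) = (\<Sum>a\<in>A. c a * exp (pairing \<eta> a))"
  by (simp add: laurent_def prod_exp_vec_powi)

text \<open>Logarithmic differentiation: the operator \<open>y $ j\<close> times the
  \<open>j\<close>-th partial derivative multiplies the monomial with exponent \<open>a\<close> by
  \<open>a $ j\<close>.\<close>

lemma differential_eq:
  fixes y :: "complex ^ 'k"
  assumes "finite A" and y: "y \<in> torus"
  shows "differential A c y v =
    (\<Sum>j\<in>UNIV. v $ j / y $ j * (\<Sum>a\<in>A. c a * (\<Prod>j\<in>UNIV. (y $ j) powi (a $ j)) * of_int (a $ j)))"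
proof -
  let ?m = "\<lambda>a. \<Prod>j\<in>UNIV. (y $ j) powi (a $ j)"
  have nz: "y $ j \<noteq> 0" for j using y by (simp add: torus_def)
  have "((\<lambda>y. (y $ j) powi n) has_derivative (\<lambda>v. of_int n * (y $ j) powi (n - 1) * v $ j)) (at y)"
    for j n
  proof -
    have "((\<lambda>y. y $ j) has_derivative (\<lambda>v. v $ j)) (at y)"
      by (intro bounded_linear_imp_has_derivative bounded_linear_vec_nth)
    from has_derivative_power_int[where f = "\<lambda>y. y $ j", OF nz this] show ?thesis by (simp add: ac_simps)
  qed
  then have "((\<lambda>y. \<Prod>j\<in>UNIV. (y $ j) powi (a $ j)) has_derivative
      (\<lambda>v. \<Sum>j\<in>UNIV. of_int (a $ j) * (y $ j) powi (a $ j - 1) * v $ j *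
        (\<Prod>i\<in>UNIV - {j}. (y $ i) powi (a $ i)))) (at y)" for a :: "int ^ 'k"
    by (rule has_derivative_prod)
  moreover have "of_int (a $ j) * (y $ j) powi (a $ j - 1) * v $ j * (\<Prod>i\<in>UNIV - {j}. (y $ i) powi (a $ i))
      = v $ j / y $ j * (?m a * of_int (a $ j))" for a :: "int ^ 'k" and v j
  proof -
    have "?m a = (y $ j) powi (a $ j) * (\<Prod>i\<in>UNIV - {j}. (y $ i) powi (a $ i))"
      by (rule prod.remove) auto
    moreover have "(y $ j) powi (a $ j) = y $ j * (y $ j) powi (a $ j - 1)"
      using nz[of j] by (simp add: power_int_diff)
    ultimately show ?thesis using nz[of j] by (simp add: field_simps)
  qed
  ultimately have "((\<lambda>y. \<Prod>j\<in>UNIV. (y $ j) powi (a $ j)) has_derivative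
      (\<lambda>v. \<Sum>j\<in>UNIV. v $ j / y $ j * (?m a * of_int (a $ j)))) (at y)" for a :: "int ^ 'k"
    by simp
  then have "((\<lambda>y. \<Sum>a\<in>A. c a * (\<Prod>j\<in>UNIV. (y $ j) powi (a $ j))) has_derivative
      (\<lambda>v. \<Sum>a\<in>A. c a * (\<Sum>j\<in>UNIV. v $ j / y $ j * (?m a * of_int (a $ j))))) (at y)"
    by (intro has_derivative_sum has_derivative_mult_right)
  then have "differential A c y = (\<lambda>v. \<Sum>a\<in>A. c a * (\<Sum>j\<in>UNIV. v $ j / y $ j * (?m a * of_int (a $ j))))"
    unfolding laurent_def by (rule frechet_derivative_at[symmetric])
  then show ?thesis
    by (simp add: sum_distrib_left sum.swap[of _ A] ac_simps)
qed

text \<open>On the torus the factors \<open>v $ j / y $ j\<close> are arbitrary complex numbers, so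
  ordinary and logarithmic gradients satisfy the same linear relations. The test vector
  \<open>axis j (y $ j)\<close> isolates the \<open>j\<close>-th one.\<close>

lemma differential_combination_zero_iff:
  fixes \<phi> :: "nat \<Rightarrow> int ^ 'k \<Rightarrow> complex"
  assumes "finite I" "\<And>i. i \<in> I \<Longrightarrow> finite (A i)"
  shows "(\<forall>v. (\<Sum>i\<in>I. \<mu> i * differential (A i) (\<phi> i) (exp_vec \<eta>) v) = 0) \<longleftrightarrow>
    (\<forall>j. (\<Sum>i\<in>I. \<mu> i * (\<Sum>a\<in>A i. \<phi> i a * exp (pairing \<eta> a) * of_int (a $ j))) = 0)"
proof -
  let ?g = "\<lambda>i j. \<Sum>a\<in>A i. \<phi> i a * exp (pairing \<eta> a) * of_int (a $ j)"
  have "exp_vec \<eta> \<in> torus" by (simp add: torus_eq_range_exp_vec)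
  then have "(\<Sum>i\<in>I. \<mu> i * differential (A i) (\<phi> i) (exp_vec \<eta>) v)
      = (\<Sum>i\<in>I. \<mu> i * (\<Sum>j\<in>UNIV. v $ j / exp_vec \<eta> $ j * ?g i j))" for v
    using assms by (intro sum.cong refl) (simp add: differential_eq prod_exp_vec_powi)
  then have eq: "(\<Sum>i\<in>I. \<mu> i * differential (A i) (\<phi> i) (exp_vec \<eta>) v)
      = (\<Sum>j\<in>UNIV. v $ j / exp_vec \<eta> $ j * (\<Sum>i\<in>I. \<mu> i * ?g i j))" for v
    by (simp add: sum_distrib_left sum.swap[of _ I] ac_simps)
  show ?thesis unfolding eq
  proof safe
    fix j assume *: "\<forall>v. (\<Sum>j\<in>UNIV. v $ j / exp_vec \<eta> $ j * (\<Sum>i\<in>I. \<mu> i * ?g i j)) = 0"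
    have "(\<Sum>i\<in>UNIV. (axis j (exp_vec \<eta> $ j)) $ i / exp_vec \<eta> $ i * (\<Sum>m\<in>I. \<mu> m * ?g m i))
       = (\<Sum>i\<in>UNIV. if i = j then \<Sum>m\<in>I. \<mu> m * ?g m j else 0)"
      by (intro sum.cong) (auto simp: axis_def exp_vec_def)
    with spec[OF *, of "axis j (exp_vec \<eta> $ j)"] show "(\<Sum>i\<in>I. \<mu> i * ?g i j) = 0" by simp
  qed simp
qed

lemma Sigma_single_iff:
  fixes A :: "(int ^ 'k) set"
  assumes "finite A"
  shows "c \<in> Sigma_single A \<longleftrightarrow> c \<in> coord_space A \<and> (\<exists>\<eta>. (\<Sum>a\<in>A. c a * exp (pairing \<eta> a)) = 0 \<and>
    (\<forall>j. (\<Sum>a\<in>A. c a * exp (pairing \<eta> a) * of_int (a $ j)) = 0))"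
  using differential_combination_zero_iff[of "{0}" "\<lambda>_. A" "\<lambda>_. 1" "\<lambda>_. c"] assms
  by (simp add: Sigma_single_def torus_eq_range_exp_vec laurent_exp_vec)

text \<open>Coordinates outside \<open>exponents l A\<close> are left free here. Polynomial
  functions depend on all coordinates, so the ideal is studied on this cylinder and cut back to
  \<open>coord_space\<close> only at the end.\<close>

definition discriminant_cylinder ::
    "nat \<Rightarrow> (nat \<Rightarrow> (int ^ 'k) set) \<Rightarrow> (nat \<times> (int ^ 'k) \<Rightarrow> complex) set" where
  "discriminant_cylinder l A = {x. \<exists>\<eta> \<mu>. (\<exists>i\<le>l. \<mu> i \<noteq> 0) \<and>
     (\<forall>i\<le>l. (\<Sum>a\<in>A i. x (i, a) * exp (pairing \<eta> a)) = 0) \<and>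
     (\<forall>j. (\<Sum>i\<le>l. \<mu> i * (\<Sum>a\<in>A i. x (i, a) * exp (pairing \<eta> a) * of_int (a $ j))) = 0)}"

lemma Sigma_collection_eq:
  assumes "\<And>i. i \<le> l \<Longrightarrow> finite (A i)"
  shows "Sigma_collection l A = coord_space (exponents l A) \<inter> discriminant_cylinder l A"
proof -
  have "(\<forall>v. (\<Sum>i\<le>l. \<mu> i * differential (A i) (\<lambda>a. \<phi> (i, a)) (exp_vec \<eta>) v) = 0) \<longleftrightarrow>
    (\<forall>j. (\<Sum>i\<le>l. \<mu> i * (\<Sum>a\<in>A i. \<phi> (i, a) * exp (pairing \<eta> a) * of_int (a $ j))) = 0)" for \<mu> \<phi> \<eta>
    using assms by (intro differential_combination_zero_iff[where \<phi> = "\<lambda>i a. \<phi> (i, a)"]) auto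
  then show ?thesis
    unfolding Sigma_collection_def discriminant_cylinder_def torus_eq_range_exp_vec
    by (auto simp: laurent_exp_vec)
qed

text \<open>\<open>B\<close> consists of \<open>k + 1\<close> affinely independent points, and the
  affine function with constant term \<open>\<rho>0 b\<close> and linear part
  \<open>\<rho> b\<close> is the barycentric coordinate of \<open>b\<close>. The last four
  conditions say that the same matrix is inverse from the other side.\<close>

definition affine_dual_basis ::
    "(int ^ 'k) set \<Rightarrow> (int ^ 'k) set \<Rightarrow> (int ^ 'k \<Rightarrow> complex) \<Rightarrow> (int ^ 'k \<Rightarrow> 'k \<Rightarrow> complex) \<Rightarrow> bool" where
  "affine_dual_basis A B \<rho>0 \<rho> \<longleftrightarrow> B \<subseteq> A \<and> card B = Suc CARD('k) \<and>
    (\<forall>b\<in>B. \<forall>b'\<in>B. \<rho>0 b + (\<Sum>p\<in>UNIV. \<rho> b p * of_int (b' $ p)) = (if b = b' then 1 else 0)) \<and>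
    (\<Sum>b\<in>B. \<rho>0 b) = 1 \<and> (\<forall>q. (\<Sum>b\<in>B. \<rho>0 b * of_int (b $ q)) = 0) \<and>
    (\<forall>p. (\<Sum>b\<in>B. \<rho> b p) = 0) \<and>
    (\<forall>p q. (\<Sum>b\<in>B. \<rho> b p * of_int (b $ q)) = (if p = q then 1 else 0))"

text \<open>The lifts \<open>(1, a)\<close> span the whole space because no affine hyperplane
  contains \<open>A\<close>. A basis among them gives \<open>B\<close>, and its coordinate
  functionals give \<open>\<rho>0\<close> and \<open>\<rho>\<close>.\<close>

lemma affine_dual_basis_exists:
  fixes A :: "(int ^ 'k) set"
  assumes A: "finite A" "\<not> in_affine_hyperplane A"
  obtains B \<rho>0 \<rho> where "affine_dual_basis A B \<rho>0 \<rho>"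
proof -
  define \<iota> :: "int ^ 'k \<Rightarrow> real \<times> (real ^ 'k)" where "\<iota> a = (1, \<chi> j. real_of_int (a $ j))" for a
  have inj: "inj \<iota>" by (auto simp: inj_def \<iota>_def vec_eq_iff)
  have "A \<noteq> {}"
  proof
    assume "A = {}"
    then have "in_affine_hyperplane A" unfolding in_affine_hyperplane_def
      by (intro exI[of _ "axis undefined 1"] exI[of _ 0]) (auto simp: axis_eq_0_iff)
    then show False using A by simp
  qed
  have span: "span (\<iota> ` A) = UNIV"
  proof (rule ccontr)
    assume "span (\<iota> ` A) \<noteq> UNIV"
    then obtain u where u: "u \<noteq> 0" "span (\<iota> ` A) \<subseteq> {x. u \<bullet> x = 0}"
      using span_not_univ_subset_hyperplane by blast
    obtain \<beta> n where un: "u = (\<beta>, n)" by (cases u)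
    have *: "\<beta> + n \<bullet> (\<chi> j. real_of_int (a $ j)) = 0" if "a \<in> A" for a
      using u(2) span_base[of "\<iota> a" "\<iota> ` A"] that by (auto simp: un \<iota>_def)
    \<comment> \<open>At any point of \<open>A\<close> the case \<open>n = 0\<close> would force
      \<open>\<beta> = 0\<close>, hence \<open>u = 0\<close>.\<close>
    have "n \<noteq> 0" using * u(1) \<open>A \<noteq> {}\<close> un by (auto simp: zero_prod_def)
    then have "in_affine_hyperplane A" unfolding in_affine_hyperplane_def
      using * by (intro exI[of _ n] exI[of _ "- \<beta>"]) (auto simp: eq_neg_iff_add_eq_0 add.commute)
    then show False using A by simp
  qed
  obtain D where D: "D \<subseteq> \<iota> ` A" "independent D" "\<iota> ` A \<subseteq> span D" "card D = dim (\<iota> ` A)"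
    by (rule basis_exists)
  have spanD: "span D = UNIV" using span_mono[OF D(3)] unfolding span span_span by blast
  have "dim (\<iota> ` A) = dim (UNIV :: (real \<times> (real ^ 'k)) set)" by (metis dim_span span)
  then have cardD: "card D = Suc CARD('k)" using D(4) by (simp add: dim_UNIV)
  define B where "B = {a \<in> A. \<iota> a \<in> D}"
  have \<iota>B: "\<iota> ` B = D" using D(1) by (auto simp: B_def)
  have finB: "finite B" using A by (simp add: B_def)
  have cardB: "card B = Suc CARD('k)"
    using cardD card_image[OF inj_on_subset[OF inj subset_UNIV], of B] \<iota>B by simp
  define r where "r b v = representation D v (\<iota> b)" for b v
  have lin: "linear (r b)" for b
    unfolding r_def using D(2) by (intro linearI) (auto simp: representation_add representation_scale spanD)
  have r_basis: "r b (\<iota> b') = (if b = b' then 1 else 0)" if "b \<in> B" "b' \<in> B" for b b'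
    using that representation_basis[OF D(2), of "\<iota> b'"] inj by (auto simp: r_def B_def inj_eq)
  have r_sum: "(\<Sum>b\<in>B. r b v *\<^sub>R \<iota> b) = v" for v
  proof -
    have "(\<Sum>b\<in>D. representation D v b *\<^sub>R b) = v"
      using D(2) finB \<iota>B spanD by (intro sum_representation_eq) auto
    moreover have "bij_betw \<iota> B D" unfolding bij_betw_def using \<iota>B inj inj_on_subset by blast
    ultimately show ?thesis
      unfolding r_def by (subst sum.reindex_bij_betw[of \<iota> B D "\<lambda>b. representation D v b *\<^sub>R b"])
  qed
  have decomp: "v = fst v *\<^sub>R (1, 0) + (\<Sum>p\<in>UNIV. (snd v $ p) *\<^sub>R (0, axis p 1))" for v :: "real \<times> (real ^ 'k)"
    by (simp add: prod_eq_iff fst_sum snd_sum vec_eq_iff axis_def if_distrib[of "\<lambda>x. _ * x"] cong: if_cong)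
  show ?thesis
  proof (rule that[of B "\<lambda>b. of_real (r b (1, 0))" "\<lambda>b p. of_real (r b (0, axis p 1))"],
      unfold affine_dual_basis_def, intro conjI ballI allI)
    show "B \<subseteq> A" by (auto simp: B_def)
    show "card B = Suc CARD('k)" by (rule cardB)
    fix b b' assume b: "b \<in> B" "b' \<in> B"
    have "r b (\<iota> b') = r b (fst (\<iota> b') *\<^sub>R (1, 0) + (\<Sum>p\<in>UNIV. (snd (\<iota> b') $ p) *\<^sub>R (0, axis p 1)))"
      using decomp[of "\<iota> b'"] by simp
    also have "\<dots> = r b (1, 0) + (\<Sum>p\<in>UNIV. real_of_int (b' $ p) * r b (0, axis p 1))"
      unfolding linear_add[OF lin] linear_sum[OF lin] linear_scale[OF lin] by (simp add: \<iota>_def)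
    finally have "r b (1, 0) + (\<Sum>p\<in>UNIV. r b (0, axis p 1) * real_of_int (b' $ p)) = (if b = b' then 1 else 0)"
      using r_basis[OF b] by (simp add: mult.commute)
    from arg_cong[OF this, of complex_of_real]
    show "complex_of_real (r b (1, 0)) + (\<Sum>p\<in>UNIV. of_real (r b (0, axis p 1)) * of_int (b' $ p)) =
        (if b = b' then 1 else 0)"
      by (simp split: if_splits)
  next
    have c: "(\<Sum>b\<in>B. r b v) = fst v" for v
      using arg_cong[OF r_sum[of v], of fst] by (simp add: fst_sum \<iota>_def)
    have s: "(\<Sum>b\<in>B. r b v * real_of_int (b $ q)) = snd v $ q" for v q
      using arg_cong[OF r_sum[of v], of "\<lambda>v. snd v $ q"] by (simp add: snd_sum \<iota>_def sum_component)
    show "(\<Sum>b\<in>B. complex_of_real (r b (1, 0))) = 1"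
      using arg_cong[OF c[of "(1, 0)"], of complex_of_real] by simp
    show "(\<Sum>b\<in>B. complex_of_real (r b (1, 0)) * of_int (b $ q)) = 0" for q
      using arg_cong[OF s[of "(1, 0)" q], of complex_of_real] by simp
    show "(\<Sum>b\<in>B. complex_of_real (r b (0, axis p 1))) = 0" for p
      using arg_cong[OF c[of "(0, axis p 1)"], of complex_of_real] by simp
    show "(\<Sum>b\<in>B. complex_of_real (r b (0, axis p 1)) * of_int (b $ q)) = (if p = q then 1 else 0)" for p q
      using arg_cong[OF s[of "(0, axis p 1)" q], of complex_of_real] by (simp add: axis_def split: if_splits)
  qed
qed

text \<open>Barycentric coordinates recover a vector supported on \<open>B\<close> from its sum and
  its first moments. This eliminates \<open>k + 1\<close> coefficients in the parameter
  counts.\<close>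

lemma affine_dual_basis_coeff:
  fixes A :: "(int ^ 'k) set"
  assumes A: "finite A" and B: "affine_dual_basis A B \<rho>0 \<rho>" and b: "b \<in> B"
  shows "c b = \<rho>0 b * ((\<Sum>a\<in>A. c a) - (\<Sum>a\<in>A - B. c a)) +
    (\<Sum>q\<in>UNIV. \<rho> b q * ((\<Sum>a\<in>A. c a * of_int (a $ q)) - (\<Sum>a\<in>A - B. c a * of_int (a $ q))))"
proof -
  have BA: "B \<subseteq> A" using B by (simp add: affine_dual_basis_def)
  then have finB: "finite B" using A finite_subset by blast
  have split: "(\<Sum>a\<in>A. g a) - (\<Sum>a\<in>A - B. g a) = (\<Sum>a\<in>B. g a)" for g :: "int ^ 'k \<Rightarrow> complex"
    using sum.subset_diff[OF BA A, of g] by simp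
  have "\<rho>0 b * (\<Sum>a\<in>B. c a) + (\<Sum>q\<in>UNIV. \<rho> b q * (\<Sum>a\<in>B. c a * of_int (a $ q)))
      = (\<Sum>a\<in>B. c a * (\<rho>0 b + (\<Sum>q\<in>UNIV. \<rho> b q * of_int (a $ q))))"
    by (simp add: sum_distrib_left sum.distrib distrib_left sum.swap[of _ UNIV] ac_simps)
  also have "\<dots> = (\<Sum>a\<in>B. if a = b then c b else 0)"
    using b B by (intro sum.cong) (auto simp: affine_dual_basis_def)
  also have "\<dots> = c b" using b finB by simp
  finally show ?thesis by (simp add: split)
qed

text \<open>Placing \<open>\<rho>\<close> on the dual basis and zero elsewhere gives a right inverse
  of the gradient map on coefficient vectors with sum zero: a gradient can be prescribed without
  changing the value.\<close>

lemma affine_section: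
  fixes A :: "(int ^ 'k) set"
  assumes A: "finite A" "\<not> in_affine_hyperplane A"
  shows "\<exists>R. (\<forall>p. (\<Sum>a\<in>A. R p a) = 0) \<and>
    (\<forall>p q. (\<Sum>a\<in>A. R p a * complex_of_int (a $ q)) = (if p = q then 1 else 0))"
proof -
  obtain B \<rho>0 \<rho> where B: "affine_dual_basis A B \<rho>0 \<rho>" by (rule affine_dual_basis_exists[OF A])
  have "(\<Sum>a\<in>A. (if a \<in> B then g a else 0) * r a) = (\<Sum>a\<in>B. g a * r a)" for g r :: "int ^ 'k \<Rightarrow> complex"
    using A(1) B by (intro sum.mono_neutral_cong_right) (auto simp: affine_dual_basis_def)
  from this[of _ "\<lambda>_. 1"] this show ?thesis
    using B by (intro exI[of _ "\<lambda>p a. if a \<in> B then \<rho> a p else 0"]) (simp add: affine_dual_basis_def)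
qed

section \<open>Clearing negative exponents\<close>

lemma exponents_bounded_below:
  assumes "finite A"
  shows "\<exists>M. \<forall>a\<in>A. \<forall>q :: 'k. (a :: int ^ 'k) $ q + int M \<ge> 0"
proof -
  have "- (a $ q) \<le> Max ((\<lambda>(a, q). - (a $ q)) ` (A \<times> UNIV))" if "a \<in> A" for a :: "int ^ 'k" and q
    using assms that by (intro Max_ge) auto
  then have "a $ q + int (nat (Max ((\<lambda>(a, q). - (a $ q)) ` (A \<times> UNIV)))) \<ge> 0"
    if "a \<in> A" for a :: "int ^ 'k" and q using that by (smt (verit) nat_0_le int_nat_eq)
  then show ?thesis by blast
qed

text \<open>Multiplication by the \<open>M\<close>-th power of the product of all torus coordinates
  makes each monomial a polynomial; the second factor undoes it. The conditions on the coefficients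
  are homogeneous, so the coefficients can absorb that factor.\<close>

lemma prod_exp_shifted:
  assumes "\<And>q. a $ q + int M \<ge> 0"
  shows "(\<Prod>q\<in>UNIV. exp (\<eta> $ q) ^ nat (a $ q + int M)) * exp (- (of_nat M * (\<Sum>q\<in>UNIV. \<eta> $ q))) = exp (pairing \<eta> a)"
proof -
  have "(\<Prod>q\<in>UNIV. exp (\<eta> $ q) ^ nat (a $ q + int M)) = (\<Prod>q\<in>UNIV. exp (of_int (a $ q + int M) * \<eta> $ q))"
    using assms by (intro prod.cong) (simp_all add: exp_of_nat_mult[symmetric] of_nat_nat)
  also have "\<dots> = exp (\<Sum>q\<in>UNIV. of_int (a $ q + int M) * \<eta> $ q)" by (simp add: exp_sum)
  finally show ?thesis
    by (simp add: mult_exp_exp pairing_def algebra_simps sum.distrib sum_distrib_left)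
qed

text \<open>Otherwise \<open>g\<close> would vanish on the nonempty open set where \<open>f\<close>
  does not, hence everywhere by the identity theorem.\<close>

lemma holomorphic_product_nonzero:
  assumes "f holomorphic_on UNIV" "g holomorphic_on UNIV" "f a \<noteq> 0" "g b \<noteq> (0::complex)"
  shows "\<exists>s. f s * g s \<noteq> 0"
proof (rule ccontr)
  assume "\<not> ?thesis"
  then have *: "f s = 0 \<or> g s = 0" for s by auto
  let ?U = "{s. f s \<noteq> 0}"
  have cont: "continuous_on UNIV f" using assms(1) by (rule holomorphic_on_imp_continuous_on)
  have "open ?U" using open_Collect_neq[OF cont continuous_on_const] by simp
  moreover have "g s = 0" if "s \<in> ?U" for s using * that by auto
  ultimately have "g b = 0"
    using analytic_continuation_open[of ?U UNIV g "\<lambda>s. 0" b] assms by auto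
  then show False using assms by simp
qed

section \<open>The Hessian of a set that is not dual defect\<close>

lemma constant_if_coordinatewise_constant:
  assumes "finite S" "\<And>j x T. j \<in> S \<Longrightarrow> g (x(j := T)) = g x"
  shows "g (\<lambda>a. if a \<in> S then x a else y a) = g y"
  using assms
proof (induction S rule: finite_induct)
  case (insert j S)
  have "(\<lambda>a. if a \<in> insert j S then x a else y a) = (\<lambda>a. if a \<in> S then x a else y a)(j := x j)"
    by auto
  then have "g (\<lambda>a. if a \<in> insert j S then x a else y a) = g (\<lambda>a. if a \<in> S then x a else y a)"
    by (simp only: insert.prems[OF insertI1])
  also have "\<dots> = g y" using insert by simp
  finally show ?case .
qed simp

text \<open>For generic values of the other coordinates, an equation depending on the coordinate \<open>j\<close> has a root,
  so the projection of the hypersurface along \<open>j\<close> is dominant.\<close>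

lemma hypersurface_dominant_projection:
  assumes S: "finite S" and hyp: "hypersurface S (zariski_closure S X)"
  obtains j where "j \<in> S"
    "\<forall>h. polynomial_fun h \<longrightarrow> (\<forall>x T. h (x(j := T)) = h x) \<longrightarrow> (\<forall>x\<in>X. h x = 0) \<longrightarrow>
      (\<forall>x\<in>coord_space S. h x = 0)"
proof -
  obtain f where f: "polynomial_fun f" "\<not> f constant_on coord_space S"
    "zariski_closure S X = {x \<in> coord_space S. f x = 0}"
    using hyp by (auto simp: hypersurface_def)
  \<comment> \<open>Polynomial functions see every coordinate; \<open>res\<close> forgets those
    outside \<open>S\<close> and so carries arbitrary points into
    \<open>coord_space S\<close>.\<close>
  define res where "res = (\<lambda>x a. if a \<in> S then x a else (0::complex))"
  have res_in: "res x \<in> coord_space S" for x by (auto simp: res_def coord_space_def)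
  have res_id: "res x = x" if "x \<in> coord_space S" for x using that by (auto simp: res_def coord_space_def)
  have res_poly: "polynomial_fun (\<lambda>x. g (res x))" if "polynomial_fun g" for g
  proof (rule polynomial_fun_compose[OF that])
    show "polynomial_fun (\<lambda>x. res x v)" for v
      by (cases "v \<in> S") (auto simp: res_def intro: polynomial_fun.intros)
  qed
  have "\<exists>j\<in>S. \<exists>x T. f (res (x(j := T))) \<noteq> f (res x)"
  proof (rule ccontr)
    assume *: "\<not> ?thesis"
    have "f x = f (res (\<lambda>a. 0))" if "x \<in> coord_space S" for x
    proof -
      have "f (res x) = f (res (\<lambda>a. if a \<in> S then x a else 0))"
        using res_id[OF that] by (simp add: res_def)
      also have "\<dots> = f (res (\<lambda>a. 0))"
        using * by (intro constant_if_coordinatewise_constant[OF S, of "\<lambda>x. f (res x)"]) auto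
      finally show ?thesis by (simp add: res_id that)
    qed
    then show False using f(2) by (auto simp: constant_on_def)
  qed
  then obtain j x2 T2 where j: "j \<in> S" "f (res (x2(j := T2))) \<noteq> f (res x2)" by blast
  define e where "e = (\<lambda>a. if a = j then 1 else 0 :: complex)"
  define g where "g = (\<lambda>x. f (res x))"
  have gp: "polynomial_fun g" unfolding g_def by (rule res_poly[OF f(1)])
  have upd: "(\<lambda>a. x a + T * e a) = x(j := x j + T)" for x T by (auto simp: e_def)
  have "\<exists>i\<ge>1. coeff (line g x2 e) i \<noteq> 0"
  proof (rule ccontr)
    assume "\<not> ?thesis"
    then have "degree (line g x2 e) = 0" by (metis le_degree leading_coeff_0_iff degree_0 less_one not_le)
    then obtain c where c: "line g x2 e = [:c:]" by (metis degree_eq_zeroE)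
    have "g (x2(j := x2 j + T)) = c" for T
      using poly_line[OF gp, of x2 e T] by (simp add: c upd)
    from this[of 0] this[of "T2 - x2 j"] show False using j by (simp add: g_def)
  qed
  then obtain i where i: "i \<ge> 1" "coeff (line g x2 e) i \<noteq> 0" by blast
  show ?thesis
  proof (rule that[OF j(1)], intro allI impI ballI)
    fix h x assume h: "polynomial_fun h" "\<forall>x T. h (x(j := T)) = h x" "\<forall>x\<in>X. h x = 0"
      "x \<in> coord_space S"
    show "h x = 0"
    proof (rule ccontr)
      assume "h x \<noteq> 0"
      then have "h (res x) \<noteq> 0" by (simp add: res_id h)
      from polynomial_fun_mult_nonzero[OF polynomial_fun_coeff_line[OF gp polynomial_fun.coord polynomial_fun.const]
          res_poly[OF h(1)], OF i(2) this]
      obtain z where z: "coeff (line g z e) i \<noteq> 0" "h (res z) \<noteq> 0" by blast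
      have "degree (line g z e) \<noteq> 0" using le_degree[OF z(1)] i(1) by linarith
      then obtain T where "poly (line g z e) T = 0" by (rule complex_root_exists)
      then have "g (z(j := z j + T)) = 0" by (simp only: poly_line[OF gp] upd)
      then have "f (res (z(j := z j + T))) = 0" by (simp only: g_def)
      then have "res (z(j := z j + T)) \<in> zariski_closure S X" using f(3) res_in by auto
      then have "h (res (z(j := z j + T))) = 0" using h(1,3) by (auto simp: zariski_closure_def)
      moreover have "res (z(j := z j + T)) = (res z)(j := z j + T)" using j(1) by (auto simp: res_def)
      ultimately show False using h(2) z(2) by simp
    qed
  qed
qed

text \<open>The Laurent polynomials of the single set, after scaling the coefficients by a power of the
  monomial \<open>y\<^sub>1 \<cdots> y\<^sub>k\<close>, become polynomials in \<open>y\<close> and in the coefficients off a dual basis.\<close>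

lemma single_set_relation:
  fixes A :: "(int ^ 'k) set" and p :: 'k
  assumes A: "finite A" "\<not> in_affine_hyperplane A" and j: "j \<in> A"
  shows "\<exists>Q. polynomial_fun Q \<and> (\<exists>x. Q x \<noteq> 0) \<and>
    (\<forall>x x'. (\<forall>a\<in>A. x a = x' a) \<longrightarrow> Q x = Q x') \<and>
    (\<forall>c \<eta>. (\<Sum>a\<in>A. c a) = 0 \<longrightarrow> (\<forall>q. (\<Sum>a\<in>A. c a * of_int (a $ q)) = 0) \<longrightarrow>
      Q ((\<lambda>a. c a * exp (pairing \<eta> a))(j := exp (\<eta> $ p))) = 0)"
proof -
  obtain B \<rho>0 \<rho> where dual: "affine_dual_basis A B \<rho>0 \<rho>" by (rule affine_dual_basis_exists[OF A])
  then have B: "B \<subseteq> A" "card B = Suc CARD('k)" unfolding affine_dual_basis_def by blast+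
  have finB: "finite B" using B(1) A(1) finite_subset by blast
  obtain M where M: "\<And>a q. a \<in> A \<Longrightarrow> a $ q + int M \<ge> 0" using exponents_bounded_below[OF A(1)] by blast
  define P :: "('k + (int ^ 'k)) set" where "P = range Inl \<union> Inr ` (A - B)"
  define m where "m = (\<lambda>a (t :: 'k + (int ^ 'k) \<Rightarrow> complex). \<Prod>q\<in>UNIV. t (Inl q) ^ nat (a $ q + int M))"
  define w where "w = (\<lambda>a (t :: 'k + (int ^ 'k) \<Rightarrow> complex). if a \<in> B then
\<rho>0 a * (0 - (\<Sum>b\<in>A - B. t (Inr b))) +
      (\<Sum>q\<in>UNIV. \<rho> a q * (0 - (\<Sum>b\<in>A - B. t (Inr b) * of_int (b $ q))))
      else t (Inr a))"
  define X where "X = (\<lambda>a t. if a = j then t (Inl p) else w a t * m a t)"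
  \<comment> \<open>The \<open>k\<close> torus coordinates replace the \<open>k + 1\<close>
    coefficients at the dual basis, which leaves one parameter fewer than there are slots.\<close>
  have "card P = CARD('k) + (card A - Suc CARD('k))"
    unfolding P_def using A(1) finB B(1,2)
    by (subst card_Un_disjoint) (auto simp: card_image card_Diff_subset)
  moreover have "card A \<ge> Suc CARD('k)" using card_mono[OF A(1) B(1)] B(2) by simp
  ultimately have card: "card P < card A" by simp
  have "finite P" using A(1) by (simp add: P_def)
  have "polynomial_fun (X a)" for a
  proof -
    have "polynomial_fun (m a)" unfolding m_def by (intro polynomial_fun_intros)
    moreover have "polynomial_fun (w a)"
    proof (cases "a \<in> B")
      case True
      have "polynomial_fun (\<lambda>t. \<rho>0 a * (0 - (\<Sum>b\<in>A - B. t (Inr b))) +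
          (\<Sum>q\<in>UNIV. \<rho> a q * (0 - (\<Sum>b\<in>A - B. t (Inr b) * of_int (b $ q)))))"
        by (intro polynomial_fun_intros)
      then show ?thesis unfolding w_def using True by (simp only: if_True)
    next
      case False
      then show ?thesis using polynomial_fun.coord by (simp add: w_def)
    qed
    ultimately show ?thesis unfolding X_def
      by (cases "a = j") (auto intro: polynomial_fun.intros)
  qed
  from algebraic_dependence[where X = X, OF A(1) \<open>finite P\<close> card this]
  obtain Q where Q: "polynomial_fun Q" "\<exists>x. Q x \<noteq> 0"
    "\<forall>x x'. (\<forall>a\<in>A. x a = x' a) \<longrightarrow> Q x = Q x'" "\<forall>t\<in>coord_space P. Q (\<lambda>a. X a t) = 0" by blast
  show ?thesis
  proof (intro exI[of _ Q] conjI Q(1-3) allI impI)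
    fix c :: "int ^ 'k \<Rightarrow> complex" and \<eta> :: "complex ^ 'k"
    assume c0: "(\<Sum>a\<in>A. c a) = 0" and "\<forall>q. (\<Sum>a\<in>A. c a * of_int (a $ q)) = 0"
    then have c1: "(\<Sum>a\<in>A. c a * of_int (a $ q)) = 0" for q by blast
    define \<epsilon> where "\<epsilon> = exp (- (of_nat M * (\<Sum>q\<in>UNIV. \<eta> $ q)))"
    define t where "t = (\<lambda>v. case v of Inl q \<Rightarrow> exp (\<eta> $ q) | Inr a \<Rightarrow> if a \<in> A - B then c a * \<epsilon> else 0)"
    have t: "t \<in> coord_space P" by (auto simp: t_def P_def coord_space_def split: sum.splits)
    have w: "w a t = c a * \<epsilon>" if "a \<in> A" for a
    proof (cases "a \<in> B")
      case True
      have "(\<Sum>a\<in>A. c a * \<epsilon>) = 0" "(\<Sum>a\<in>A. c a * \<epsilon> * of_int (a $ q)) = 0" for q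
        using c0 c1[of q] by (simp_all add: mult.commute[of _ \<epsilon>] mult.assoc flip: sum_distrib_left)
      then show ?thesis
        using affine_dual_basis_coeff[OF A(1) dual True, of "\<lambda>a. c a * \<epsilon>"] True by (simp add: w_def t_def)
    qed (use that in \<open>simp add: w_def t_def\<close>)
    have m: "m a t * \<epsilon> = exp (pairing \<eta> a)" if "a \<in> A" for a
      using prod_exp_shifted[of a M \<eta>] M[OF that] by (simp add: m_def t_def \<epsilon>_def)
    have "X a t = ((\<lambda>a. c a * exp (pairing \<eta> a))(j := exp (\<eta> $ p))) a" if "a \<in> A" for a
    proof (cases "a = j")
      case False
      then have "X a t = c a * (m a t * \<epsilon>)" by (simp add: X_def w[OF that])
      then show ?thesis using False m[OF that] by simp
    qed (simp add: X_def t_def)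
    then have "Q (\<lambda>a. X a t) = Q ((\<lambda>a. c a * exp (pairing \<eta> a))(j := exp (\<eta> $ p)))"
      by (intro Q(3)[rule_format])
    with Q(4) t show "Q ((\<lambda>a. c a * exp (pairing \<eta> a))(j := exp (\<eta> $ p))) = 0" by simp
  qed
qed

text \<open>The linear coefficient after shifting the base point by \<open>T\<close> is the
  derivative at \<open>T\<close>. Hence differentiation in direction \<open>e\<close> lowers the
  degree along \<open>e\<close>.\<close>

lemma line_first_coeff:
  assumes "polynomial_fun Q"
  shows "line (\<lambda>x. coeff (line Q x e) 1) z e = pderiv (line Q z e)"
proof (rule line_eqI)
  fix T
  have "coeff (line Q (\<lambda>v. z v + T * e v) e) 1 = coeff (pcompose (line Q z e) [:T, 1:]) 1"
    by (simp add: line_shift assms)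
  also have "\<dots> = poly (pderiv (pcompose (line Q z e) [:T, 1:])) 0"
    by (simp add: poly_0_coeff_0 coeff_pderiv)
  also have "\<dots> = poly (pderiv (line Q z e)) T"
    by (simp add: pderiv_pcompose poly_pcompose pderiv_pCons)
  finally show "poly (pderiv (line Q z e)) T = coeff (line Q (\<lambda>v. z v + T * e v) e) 1" by simp
qed

text \<open>\<open>y\<^sub>p\<close> is algebraic over the coordinates of the dominant projection, hence a separating relation
  \<open>Q\<close> exists: the slot of the omitted coordinate \<open>j\<close> is used for \<open>y\<^sub>p\<close>.\<close>

lemma separating_relation:
  fixes A :: "(int ^ 'k) set" and p :: 'k
  assumes A: "finite A" "\<not> in_affine_hyperplane A" and j: "j \<in> A"
    and dom: "\<forall>h. polynomial_fun h \<longrightarrow> (\<forall>x T. h (x(j := T)) = h x) \<longrightarrow>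
      (\<forall>x\<in>Sigma_single A. h x = 0) \<longrightarrow> (\<forall>x\<in>coord_space A. h x = 0)"
  defines "W \<equiv> {c. (\<Sum>a\<in>A. c a) = 0 \<and> (\<forall>q. (\<Sum>a\<in>A. c a * of_int (a $ q)) = 0)}"
    and "pt \<equiv> \<lambda>c \<eta>. (\<lambda>a. c a * exp (pairing \<eta> a))(j := exp (\<eta> $ p))"
    and "e \<equiv> \<lambda>a. if a = j then 1 else 0"
  obtains Q where "polynomial_fun Q" "\<And>c \<eta>. c \<in> W \<Longrightarrow> Q (pt c \<eta>) = 0"
    "\<exists>c\<in>W. \<exists>\<eta>. coeff (line Q (pt c \<eta>) e) 1 \<noteq> 0"
proof -
  define good where "good = (\<lambda>Q. polynomial_fun Q \<and> (\<exists>x. Q x \<noteq> 0) \<and>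
    (\<forall>x x'. (\<forall>a\<in>A. x a = x' a) \<longrightarrow> Q x = Q x') \<and> (\<forall>c\<in>W. \<forall>\<eta>. Q (pt c \<eta>) = 0))"
  have "\<exists>N Q. good Q \<and> line_degree_less e Q N"
  proof -
    have "\<exists>Q. good Q"
      using single_set_relation[OF A j, of p] unfolding good_def W_def pt_def by (simp add: imp_conjL)
    then obtain Q where "good Q" by blast
    then show ?thesis using line_degree_less_exists[of Q e] by (auto simp: good_def)
  qed
  then obtain N Q where Q: "good Q" "line_degree_less e Q N"
    and min: "\<And>m Q. m < N \<Longrightarrow> good Q \<Longrightarrow> \<not> line_degree_less e Q m"
    using exists_least_iff[of "\<lambda>N. \<exists>Q. good Q \<and> line_degree_less e Q N"] by blast
  have Qp: "polynomial_fun Q" and Qdep: "\<And>x x'. \<forall>a\<in>A. x a = x' a \<Longrightarrow> Q x = Q x'"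
    and Qz: "\<And>c \<eta>. c \<in> W \<Longrightarrow> Q (pt c \<eta>) = 0"
    using Q(1) unfolding good_def by blast+
  obtain x1 where x1: "Q x1 \<noteq> 0" using Q(1) by (auto simp: good_def)
  have "N \<noteq> 0"
  proof
    assume "N = 0"
    then have "coeff (line Q x1 e) 0 = 0" using Q(2) by (simp add: line_degree_less_def)
    then show False using x1 poly_line_0[OF Qp] by (simp add: poly_0_coeff_0)
  qed
  then obtain d where N: "N = Suc d" by (cases N) auto
  have upd: "(\<lambda>a. x a + s * e a) = x(j := x j + s)" for x s by (auto simp: e_def)
  \<comment> \<open>For \<open>d = 0\<close> the relation ignores slot \<open>j\<close>, hence
    vanishes on the whole singular locus, against the dominance of the projection.\<close>
  have "d \<noteq> 0"
  proof
    assume "d = 0"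
    have "Q (x(j := T)) = Q x" for x T
      using top_coeff_invariant[OF Qp Q(2)[unfolded N], of x "T - x j"] poly_line_0[OF Qp]
      by (simp add: \<open>d = 0\<close> upd poly_0_coeff_0)
    moreover have "Q x = 0" if x: "x \<in> Sigma_single A" for x
    proof -
      obtain \<eta> where \<eta>: "(\<Sum>a\<in>A. x a * exp (pairing \<eta> a)) = 0"
        "\<And>q. (\<Sum>a\<in>A. x a * exp (pairing \<eta> a) * of_int (a $ q)) = 0"
        using x Sigma_single_iff[OF A(1), of x] by blast
      have "(\<lambda>a. x a * exp (pairing \<eta> a)) \<in> W" unfolding W_def mem_Collect_eq using \<eta> by blast
      \<comment> \<open>The weights satisfy the linear equations defining \<open>W\<close>;
        evaluation at \<open>- \<eta>\<close> removes the exponential factors and restores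
        \<open>x\<close>.\<close>
      then have "Q (pt (\<lambda>a. x a * exp (pairing \<eta> a)) (- \<eta>)) = 0" by (rule Qz)
      moreover have "x a * exp (pairing \<eta> a) * exp (pairing (- \<eta>) a) = x a" for a
      proof -
        have "pairing (- \<eta>) a = - pairing \<eta> a" by (simp add: pairing_def sum_negf)
        then show ?thesis by (simp add: exp_minus)
      qed
      ultimately have "Q (x(j := exp ((- \<eta>) $ p))) = 0" by (simp only: pt_def)
      then show ?thesis by (simp add: \<open>\<And>x T. Q (x(j := T)) = Q x\<close>)
    qed
    ultimately have "Q x = 0" if "x \<in> coord_space A" for x using dom Qp that by blast
    moreover have "Q x1 = Q (\<lambda>a. if a \<in> A then x1 a else 0)" by (rule Qdep) simp
    ultimately show False using x1 by (simp add: coord_space_def)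
  qed
  \<comment> \<open>The derivative in slot \<open>j\<close> has smaller degree and, as
    \<open>d\<close> is invertible in characteristic zero, does not vanish identically. By
    minimality it is not a relation, so it is nonzero somewhere on the parametrised set.\<close>
  define Q' where "Q' = (\<lambda>x. coeff (line Q x e) 1)"
  have Q'p: "polynomial_fun Q'" unfolding Q'_def by (rule polynomial_fun_top_coeff[OF Qp])
  have lQ': "line Q' z e = pderiv (line Q z e)" for z unfolding Q'_def by (rule line_first_coeff[OF Qp])
  have "line_degree_less e Q' d"
    using Q(2) by (simp add: line_degree_less_def lQ' coeff_pderiv N)
  then have "\<not> good Q'" using min[of d Q'] N by blast
  moreover have "\<exists>x. Q' x \<noteq> 0"
  proof (rule ccontr)
    assume "\<not> ?thesis"
    then have "line Q' z e = 0" for z by (intro line_eqI) simp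
    then have "coeff (line Q z e) d = 0" for z
      using lQ'[of z] \<open>d \<noteq> 0\<close> by (metis coeff_0 coeff_pderiv mult_eq_0_iff of_nat_eq_0_iff old.nat.exhaust)
    then have "line_degree_less e Q d" using Q(2) unfolding line_degree_less_def N
      by (metis Suc_leI le_neq_implies_less)
    then show False using min[of d Q] Q(1) N by blast
  qed
  moreover have "Q' x = Q' x'" if "\<forall>a\<in>A. x a = x' a" for x x'
  proof -
    have "line Q x e = line Q x' e"
      using Qdep that by (intro line_eqI) (auto simp: poly_line[OF Qp] intro!: Qdep)
    then show ?thesis by (simp add: Q'_def)
  qed
  ultimately have "\<exists>c\<in>W. \<exists>\<eta>. Q' (pt c \<eta>) \<noteq> 0" using Q'p unfolding good_def by blast
  then show ?thesis using that[OF Qp Qz] by (simp add: Q'_def)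
qed

text \<open>At a point where all separating relations have nonzero derivative, a vector in the kernel of
  the Hessian lifts to a tangent direction along which \<open>y\<close> is stationary.\<close>

lemma nondegenerate_hessian_exists:
  fixes A :: "(int ^ 'k) set"
  assumes A: "finite A" "\<not> in_affine_hyperplane A" and nd: "\<not> dual_defect_single A"
  obtains c :: "int ^ 'k \<Rightarrow> complex" where "(\<Sum>a\<in>A. c a) = 0" "\<And>q. (\<Sum>a\<in>A. c a * of_int (a $ q)) = 0"
    "\<And>\<eta>. (\<And>q. (\<Sum>a\<in>A. c a * pairing \<eta> a * of_int (a $ q)) = 0) \<Longrightarrow> \<eta> = 0"
proof -
  have "hypersurface A (zariski_closure A (Sigma_single A))" using nd by (simp add: dual_defect_single_def)
  from hypersurface_dominant_projection[OF A(1) this] obtain j where j: "j \<in> A"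
    and dom: "\<forall>h. polynomial_fun h \<longrightarrow> (\<forall>x T. h (x(j := T)) = h x) \<longrightarrow>
      (\<forall>x\<in>Sigma_single A. h x = 0) \<longrightarrow> (\<forall>x\<in>coord_space A. h x = 0)" by blast
  define W where "W = {c :: int ^ 'k \<Rightarrow> complex. (\<Sum>a\<in>A. c a) = 0 \<and> (\<forall>q. (\<Sum>a\<in>A. c a * of_int (a $ q)) = 0)}"
  define pt where "pt = (\<lambda>p c (\<eta> :: complex ^ 'k). (\<lambda>a. c a * exp (pairing \<eta> a))(j := exp (\<eta> $ p)))"
  define e where "e = (\<lambda>a. if a = j then 1 else 0 :: complex)"
  have "\<exists>Q. polynomial_fun Q \<and> (\<forall>c\<in>W. \<forall>\<eta>. Q (pt p c \<eta>) = 0) \<and>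
    (\<exists>c\<in>W. \<exists>\<eta>. coeff (line Q (pt p c \<eta>) e) 1 \<noteq> 0)" for p
    unfolding W_def pt_def e_def by (rule separating_relation[OF A j dom, of p]) blast
  then obtain Q where Q: "\<And>p. polynomial_fun (Q p)" "\<And>p c \<eta>. c \<in> W \<Longrightarrow> Q p (pt p c \<eta>) = 0"
    "\<And>p. \<exists>c\<in>W. \<exists>\<eta>. coeff (line (Q p) (pt p c \<eta>) e) 1 \<noteq> 0" by metis
  define G where "G = (\<lambda>p c \<eta>. coeff (line (Q p) (pt p c \<eta>) e) 1)"
  have hol_pt: "(\<lambda>s. pt p (\<lambda>a. c a + s * c' a) (\<chi> q. \<eta> $ q + s * \<eta>' $ q) v) holomorphic_on UNIV"
    for p c c' v \<eta> \<eta>'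
    by (cases "v = j") (auto simp: pt_def pairing_def intro!: holomorphic_intros)
  have hol_G: "(\<lambda>s. G p (\<lambda>a. c a + s * c' a) (\<chi> q. \<eta> $ q + s * \<eta>' $ q)) holomorphic_on UNIV" for p c c' \<eta> \<eta>'
    unfolding G_def
    by (rule polynomial_fun_holomorphic[OF polynomial_fun_top_coeff[OF Q(1)] hol_pt])
  \<comment> \<open>The parameters form a vector space, so good points for different relations are
    joined by a complex line, on which the identity theorem provides a common one.\<close>
  have "\<exists>c\<in>W. \<exists>\<eta>. (\<Prod>p\<in>I. G p c \<eta>) \<noteq> 0" if "finite I" for I
    using that
  proof (induction I rule: finite_induct)
    case empty
    have "(\<lambda>a. 0) \<in> W" by (simp add: W_def)
    then show ?case by auto
  next
    case (insert p I)
    then obtain c1 \<eta>1 where 1: "c1 \<in> W" "(\<Prod>p\<in>I. G p c1 \<eta>1) \<noteq> 0" by blast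
    obtain c2 \<eta>2 where 2: "c2 \<in> W" "G p c2 \<eta>2 \<noteq> 0" using Q(3)[of p] by (auto simp: G_def)
    define cs where "cs = (\<lambda>s a. c1 a + s * (c2 a - c1 a))"
    define \<eta>s where "\<eta>s = (\<lambda>s. \<chi> q. \<eta>1 $ q + s * (\<eta>2 - \<eta>1) $ q)"
    have "\<exists>s. (\<Prod>p\<in>I. G p (cs s) (\<eta>s s)) * G p (cs s) (\<eta>s s) \<noteq> 0"
    proof (rule holomorphic_product_nonzero)
      show "(\<lambda>s. \<Prod>p\<in>I. G p (cs s) (\<eta>s s)) holomorphic_on UNIV" "(\<lambda>s. G p (cs s) (\<eta>s s)) holomorphic_on UNIV"
        unfolding cs_def \<eta>s_def by (intro holomorphic_intros hol_G)+
      have "\<eta>s 0 = \<eta>1" "\<eta>s 1 = \<eta>2" by (simp_all add: \<eta>s_def vec_eq_iff)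
      then show "(\<Prod>p\<in>I. G p (cs 0) (\<eta>s 0)) \<noteq> 0" "G p (cs 1) (\<eta>s 1) \<noteq> 0"
        using 1 2 by (simp_all add: cs_def)
    qed
    then obtain s where "(\<Prod>p\<in>I. G p (cs s) (\<eta>s s)) * G p (cs s) (\<eta>s s) \<noteq> 0" by blast
    moreover have "cs s \<in> W"
    proof -
      have "(\<Sum>a\<in>A. cs s a * r a) = (\<Sum>a\<in>A. c1 a * r a) + s * ((\<Sum>a\<in>A. c2 a * r a) - (\<Sum>a\<in>A. c1 a * r a))" for r
        by (simp add: cs_def algebra_simps sum.distrib sum_subtractf sum_distrib_left)
      from this[of "\<lambda>_. 1"] this show ?thesis using 1(1) 2(1) by (simp add: W_def)
    qed
    ultimately show ?case using insert.hyps by (intro bexI[of _ "cs s"] exI[of _ "\<eta>s s"]) (auto simp: mult.commute)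
  qed
  from this[of UNIV] obtain c \<eta> where c: "c \<in> W" "\<And>p. G p c \<eta> \<noteq> 0" by auto
  show ?thesis
  proof (rule that[of c])
    show "(\<Sum>a\<in>A. c a) = 0" "\<And>q. (\<Sum>a\<in>A. c a * of_int (a $ q)) = 0" using c(1) by (auto simp: W_def)
    fix \<tau> :: "complex ^ 'k" assume ker: "\<And>q. (\<Sum>a\<in>A. c a * pairing \<tau> a * of_int (a $ q)) = 0"
    have "\<tau> $ p = 0" for p
    proof -
      \<comment> \<open>The change of \<open>c\<close> cancels the first-order change of the
        exponentials, so only slot \<open>j\<close> moves, with velocity
        \<open>\<tau> $ p * exp (\<eta> $ p)\<close>. The kernel condition keeps \<open>cs s\<close>
        in \<open>W\<close>.\<close>
      define cs where "cs = (\<lambda>s a. c a + s * (- c a * pairing \<tau> a))"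
      define \<eta>s where "\<eta>s = (\<lambda>s. \<chi> q. \<eta> $ q + s * \<tau> $ q)"
      have "(\<Sum>a\<in>A. c a * pairing \<tau> a) = (\<Sum>q\<in>UNIV. \<tau> $ q * (\<Sum>a\<in>A. c a * of_int (a $ q)))"
        by (simp add: pairing_def sum_distrib_left sum.swap[of _ A] ac_simps)
      also have "\<dots> = 0" using c(1) by (simp add: W_def)
      finally have "cs s \<in> W" for s using c(1) ker
        by (simp add: W_def cs_def algebra_simps sum.distrib sum_subtractf flip: sum_distrib_left)
      then have zero: "Q p (pt p (cs s) (\<eta>s s)) = 0" for s by (rule Q)
      have \<eta>s: "pairing (\<eta>s s) a = pairing \<eta> a + s * pairing \<tau> a" for s a
        by (simp add: \<eta>s_def pairing_def algebra_simps sum.distrib sum_distrib_left)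
      define \<sigma> where "\<sigma> = \<tau> $ p * exp (\<eta> $ p)"
      have at0: "pt p (cs 0) (\<eta>s 0) = pt p c \<eta>"
        by (simp add: cs_def \<eta>s_def)
      have "((\<lambda>s. pt p (cs s) (\<eta>s s) v) has_field_derivative \<sigma> * e v) (at 0)" for v
      proof (cases "v = j")
        case True
        then show ?thesis unfolding pt_def \<eta>s_def e_def \<sigma>_def
          by (auto intro!: derivative_eq_intros)
      next
        case False
        then show ?thesis unfolding pt_def \<eta>s cs_def e_def
          by (auto intro!: derivative_eq_intros)
      qed
      from polynomial_fun_has_field_derivative[where f = "Q p" and g = "\<lambda>s. pt p (cs s) (\<eta>s s)"
          and w = "\<lambda>v. \<sigma> * e v", OF Q(1) this]
      have "((\<lambda>s. 0) has_field_derivative coeff (line (Q p) (pt p c \<eta>) (\<lambda>v. \<sigma> * e v)) 1) (at (0::complex))"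
        unfolding at0 zero .
      then have "coeff (line (Q p) (pt p c \<eta>) (\<lambda>v. \<sigma> * e v)) 1 = 0"
        using DERIV_unique DERIV_const by blast
      then have "\<sigma> * G p c \<eta> = 0" using line_scale[OF Q(1), of p "pt p c \<eta>" \<sigma> e 1] by (simp add: G_def)
      then show ?thesis using c(2) by (simp add: \<sigma>_def)
    qed
    then show "\<tau> = 0" by (simp add: vec_eq_iff)
  qed
qed

section \<open>Collections\<close>

lemma pairing_add: "pairing (\<eta> + \<tau>) a = pairing \<eta> a + pairing \<tau> a"
  by (simp add: pairing_def algebra_simps sum.distrib)

lemma pairing_scale: "pairing (s *s \<eta>) a = s * pairing \<eta> a"
  by (simp add: pairing_def sum_distrib_left mult.assoc)

lemma pairing_uminus: "pairing (- \<eta>) a = - pairing \<eta> a"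
  by (simp add: pairing_def sum_negf)

lemma pairing_diff: "pairing (\<eta> - \<tau>) a = pairing \<eta> a - pairing \<tau> a"
  by (simp add: pairing_def algebra_simps sum_subtractf)

lemma pairing_axis: "pairing (axis q 1) a = of_int (a $ q)"
  by (simp add: pairing_def axis_def if_distrib[of "\<lambda>x. x * _"] cong: if_cong)

lemma sum_pairing:
  "(\<Sum>a\<in>A. w a * pairing \<eta> a) = (\<Sum>q\<in>UNIV. \<eta> $ q * (\<Sum>a\<in>A. w a * of_int (a $ q)))"
  by (simp add: pairing_def sum_distrib_left sum.swap[of _ A] ac_simps)

text \<open>The second differential at \<open>\<eta> = 0\<close> of the exponential sum with
  coefficients \<open>c\<close>. It is complex bilinear and symmetric, not Hermitian, so nonzero
  isotropic vectors may occur.\<close>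

definition hessian :: "(int ^ 'k) set \<Rightarrow> (int ^ 'k \<Rightarrow> complex) \<Rightarrow> complex ^ 'k \<Rightarrow> complex ^ 'k \<Rightarrow> complex" where
  "hessian A c \<eta> \<tau> = (\<Sum>a\<in>A. c a * pairing \<eta> a * pairing \<tau> a)"

lemma hessian_sym: "hessian A c \<eta> \<tau> = hessian A c \<tau> \<eta>"
  by (simp add: hessian_def ac_simps)

lemma hessian_axis: "hessian A c \<eta> (axis q 1) = (\<Sum>a\<in>A. c a * pairing \<eta> a * of_int (a $ q))"
  by (simp add: hessian_def pairing_axis)

lemma hessian_expand: "hessian A c \<eta> \<tau> = (\<Sum>q\<in>UNIV. \<tau> $ q * hessian A c \<eta> (axis q 1))"
  by (simp add: hessian_axis hessian_def[of A c \<eta> \<tau>] sum_pairing)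

lemma hessian_add: "hessian A c \<eta> (\<tau> + \<sigma>) = hessian A c \<eta> \<tau> + hessian A c \<eta> \<sigma>"
  by (simp add: hessian_def pairing_add distrib_left sum.distrib)

lemma hessian_diff: "hessian A c \<eta> (\<tau> - \<sigma>) = hessian A c \<eta> \<tau> - hessian A c \<eta> \<sigma>"
  by (simp add: hessian_def pairing_diff right_diff_distrib sum_subtractf)

lemma hessian_uminus: "hessian A c \<eta> (- \<tau>) = - hessian A c \<eta> \<tau>"
  by (simp add: hessian_def pairing_uminus sum_negf)

lemma hessian_scale: "hessian A c \<eta> (s *s \<tau>) = s * hessian A c \<eta> \<tau>"
  by (simp add: hessian_def pairing_scale sum_distrib_left ac_simps)

lemma hessian_sum: "hessian A c \<eta> (\<Sum>i\<in>I. \<tau> i) = (\<Sum>i\<in>I. hessian A c \<eta> (\<tau> i))"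
  by (induction I rule: infinite_finite_induct) (auto simp: hessian_add hessian_def[of _ _ _ 0] pairing_def[of 0])

text \<open>Gram-Schmidt for a symmetric form. If the orthogonal complement \<open>U\<close> of the
  family had only isotropic vectors, polarisation would make the form zero on \<open>U\<close>, and
  a nonzero vector of \<open>U\<close> would be orthogonal to everything.\<close>

lemma hessian_orthogonal_family:
  fixes c :: "int ^ 'k \<Rightarrow> complex" and J :: "'k set"
  assumes nd: "\<And>\<eta>. (\<And>q. hessian A c \<eta> (axis q 1) = 0) \<Longrightarrow> \<eta> = 0"
  shows "\<exists>u :: 'k \<Rightarrow> complex ^ 'k. (\<forall>p\<in>J. hessian A c (u p) (u p) \<noteq> 0) \<and>
    (\<forall>p\<in>J. \<forall>q\<in>J. p \<noteq> q \<longrightarrow> hessian A c (u p) (u q) = 0)"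
  using finite[of J]
proof (induction J rule: finite_induct)
  case (insert p J)
  let ?h = "hessian A c"
  obtain u where u: "\<And>q. q \<in> J \<Longrightarrow> ?h (u q) (u q) \<noteq> 0"
    "\<And>q r. q \<in> J \<Longrightarrow> r \<in> J \<Longrightarrow> q \<noteq> r \<Longrightarrow> ?h (u q) (u r) = 0"
    using insert.IH by (elim exE conjE) metis
  define U where "U = {x. \<forall>q\<in>J. ?h (u q) x = 0}"
  have "\<exists>x\<in>U. ?h x x \<noteq> 0"
  proof (rule ccontr)
    assume "\<not> ?thesis"
    then have iso: "?h x x = 0" if "x \<in> U" for x using that by blast
    have polar: "?h x y = 0" if "x \<in> U" "y \<in> U" for x y
    proof -
      have "x + y \<in> U" using that by (simp add: U_def hessian_add)
      from iso[OF this] have "?h x x + ?h x y + (?h y x + ?h y y) = 0"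
        by (simp add: hessian_add hessian_sym[of A c "x + y"] ac_simps)
      then show ?thesis using iso that by (simp add: hessian_sym[of A c y x])
    qed
    \<comment> \<open>The row at \<open>p\<close> is zero since \<open>p\<close> is not in
      \<open>J\<close>; so \<open>M\<close> is singular and \<open>U\<close> contains a nonzero
      vector.\<close>
    define M :: "complex ^ 'k ^ 'k" where "M = (\<chi> q r. if q \<in> J then ?h (u q) (axis r 1) else 0)"
    have "\<exists>x. M *v x = 0 \<and> x \<noteq> 0"
    proof (rule ccontr)
      assume "\<not> ?thesis"
      then obtain N where "N ** M = mat 1" using matrix_left_invertible_ker[of M] by blast
      then have "M ** N = mat 1" by (simp add: matrix_left_right_inverse)
      then have "(M ** N) $ p $ p = 1" by (simp add: mat_def)
      then show False using insert.hyps(2) by (simp add: matrix_matrix_mult_def M_def)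
    qed
    then obtain x where x: "M *v x = 0" "x \<noteq> 0" by blast
    have xU: "x \<in> U" unfolding U_def
    proof (intro CollectI ballI)
      fix q assume "q \<in> J"
      then have "?h (u q) x = (M *v x) $ q"
        by (subst hessian_expand) (simp add: matrix_vector_mult_def M_def mult.commute)
      then show "?h (u q) x = 0" by (simp add: x)
    qed
    have "?h x z = 0" for z
    proof -
      \<comment> \<open>The projection of \<open>z\<close> to \<open>U\<close>. The subtracted part
        is a combination of the \<open>u q\<close>, all orthogonal to \<open>x\<close>.\<close>
      define z' where "z' = z - (\<Sum>q\<in>J. (?h (u q) z / ?h (u q) (u q)) *s u q)"
      have "z' \<in> U" unfolding U_def
      proof (intro CollectI ballI)
        fix r assume r: "r \<in> J"
        have "(\<Sum>q\<in>J. ?h (u q) z / ?h (u q) (u q) * ?h (u r) (u q)) =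
            (\<Sum>q\<in>J. if q = r then ?h (u r) z else 0)"
          using u r by (intro sum.cong) auto
        then show "?h (u r) z' = 0" using r insert.hyps(1)
          by (simp add: z'_def hessian_diff hessian_sum hessian_scale)
      qed
      from polar[OF xU this] show ?thesis
        using xU by (simp add: z'_def hessian_diff hessian_sum hessian_scale U_def hessian_sym[of A c x "u _"])
    qed
    then show False using nd x(2) by blast
  qed
  then obtain x where x: "x \<in> U" "?h x x \<noteq> 0" by blast
  have ux: "?h (u q) x = 0" "?h x (u q) = 0" if "q \<in> J" for q
    using x(1) that hessian_sym[of A c x "u q"] by (auto simp: U_def)
  have "q \<noteq> p" if "q \<in> J" for q using insert.hyps(2) that by blast
  then show ?case using u x(2) ux
    by (intro exI[of _ "u(p := x)"]) simp
qed simp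

lemma hessian_surjective:
  fixes c :: "int ^ 'k \<Rightarrow> complex"
  assumes nd: "\<And>\<eta>. (\<And>q. hessian A c \<eta> (axis q 1) = 0) \<Longrightarrow> \<eta> = 0"
  shows "\<exists>\<xi>. \<forall>q. hessian A c \<xi> (axis q 1) = g q"
proof -
  define G :: "complex ^ 'k ^ 'k" where "G = (\<chi> q r. hessian A c (axis r 1) (axis q 1))"
  have G: "(G *v x) $ q = hessian A c x (axis q 1)" for x q
    by (subst hessian_sym, subst hessian_expand)
       (simp add: matrix_vector_mult_def G_def mult.commute hessian_sym[of A c "axis q 1"])
  have "G *v x = 0 \<longrightarrow> x = 0" for x using nd[of x] G[of x] by (auto simp: vec_eq_iff)
  then obtain N where "N ** G = mat 1" using matrix_left_invertible_ker[of G] by blast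
  then have "G ** N = mat 1" by (simp add: matrix_left_right_inverse)
  then have "G *v (N *v (\<chi> q. g q)) = (\<chi> q. g q)" by (simp add: matrix_vector_mul_assoc)
  then show ?thesis using G by (metis vec_lambda_beta)
qed

section \<open>Irreducibility of the discriminant\<close>

lemma discriminant_cylinderI:
  assumes "i0 \<le> l" "\<mu> i0 \<noteq> 0" "\<And>i. i \<le> l \<Longrightarrow> (\<Sum>a\<in>A i. x (i, a) * exp (pairing \<eta> a)) = 0"
    "\<And>j. (\<Sum>i\<le>l. \<mu> i * (\<Sum>a\<in>A i. x (i, a) * exp (pairing \<eta> a) * of_int (a $ j))) = 0"
  shows "x \<in> discriminant_cylinder l A"
  using assms unfolding discriminant_cylinder_def by blast

text \<open>The multiplier \<open>\<mu>\<close> only matters up to scaling; two of them can be scaled so that some linear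
  form \<open>\<theta>\<close> takes the value \<open>1\<close> on both, hence on the line through them.\<close>

lemma common_normalising_form:
  assumes "\<exists>i\<le>l. \<mu> i \<noteq> (0::complex)" "\<exists>i\<le>l. \<mu>' i \<noteq> (0::complex)"
  shows "\<exists>\<theta>. (\<Sum>i\<le>(l::nat). \<theta> i * \<mu> i) \<noteq> 0 \<and> (\<Sum>i\<le>l. \<theta> i * \<mu>' i) \<noteq> 0"
proof -
  obtain i i' where i: "i \<le> l" "\<mu> i \<noteq> 0" "i' \<le> l" "\<mu>' i' \<noteq> 0" using assms by blast
  have delta: "(\<Sum>m\<le>l. (if m = n then 1 else 0) * \<nu> m) = \<nu> n" if "n \<le> l" for n and \<nu> :: "nat \<Rightarrow> complex"
    using that by (simp add: if_distrib[of "\<lambda>x. x * _"] cong: if_cong)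
  show ?thesis
  proof (cases "\<mu>' i \<noteq> 0 \<or> \<mu> i' \<noteq> 0")
    case True
    then obtain n where "n \<le> l" "\<mu> n \<noteq> 0" "\<mu>' n \<noteq> 0" using i by blast
    then show ?thesis
      by (intro exI[of _ "\<lambda>m. if m = n then 1 else 0"]) (simp only: delta simp_thms)
  next
    case False
    have "(\<Sum>m\<le>l. ((if m = i then 1 else 0) + (if m = i' then 1 else 0)) * \<nu> m) = \<nu> i + \<nu> i'"
      for \<nu> :: "nat \<Rightarrow> complex"
      by (simp add: distrib_right sum.distrib delta i)
    then show ?thesis using False i
      by (intro exI[of _ "\<lambda>m. (if m = i then 1 else 0) + (if m = i' then 1 else 0)"]) auto
  qed
qed

text \<open>Interpolating \<open>\<eta>\<close>, \<open>\<mu>\<close> and the weights linearly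
  preserves the value equations, but not the gradient equation, which is bilinear in multiplier and
  weights. Once its error is corrected, the two points are joined by an entire curve inside the
  discriminant, and the identity theorem applies.\<close>

lemma discriminant_cylinder_prime:
  fixes A :: "nat \<Rightarrow> (int ^ 'k) set"
  assumes A: "\<And>i. i \<le> l \<Longrightarrow> finite (A i)" "\<And>i. i \<le> l \<Longrightarrow> \<not> in_affine_hyperplane (A i)"
    and fg: "polynomial_fun f" "polynomial_fun g" and zero: "\<forall>x\<in>discriminant_cylinder l A. f x * g x = 0"
  shows "(\<forall>x\<in>discriminant_cylinder l A. f x = 0) \<or> (\<forall>x\<in>discriminant_cylinder l A. g x = 0)"
proof (rule ccontr)
  assume "\<not> ?thesis"
  then obtain x x' where x: "x \<in> discriminant_cylinder l A" "f x \<noteq> 0"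
    and x': "x' \<in> discriminant_cylinder l A" "g x' \<noteq> 0" by blast
  let ?eq0 = "\<lambda>x \<eta>. \<forall>i\<le>l. (\<Sum>a\<in>A i. x (i, a) * exp (pairing \<eta> a)) = 0"
  let ?eq1 = "\<lambda>x \<eta> \<mu>. \<forall>j. (\<Sum>i\<le>l. \<mu> i * (\<Sum>a\<in>A i. x (i, a) * exp (pairing \<eta> a) * of_int (a $ j))) = (0::complex)"
  obtain \<eta> \<mu>0 where e: "\<exists>i\<le>l. \<mu>0 i \<noteq> 0" "?eq0 x \<eta>" "?eq1 x \<eta> \<mu>0"
    using x(1) unfolding discriminant_cylinder_def by blast
  obtain \<eta>' \<mu>0' where e': "\<exists>i\<le>l. \<mu>0' i \<noteq> 0" "?eq0 x' \<eta>'" "?eq1 x' \<eta>' \<mu>0'"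
    using x'(1) unfolding discriminant_cylinder_def by blast
  obtain \<theta> where \<theta>: "(\<Sum>i\<le>l. \<theta> i * \<mu>0 i) \<noteq> 0" "(\<Sum>i\<le>l. \<theta> i * \<mu>0' i) \<noteq> 0"
    using common_normalising_form[OF e(1) e'(1)] by blast
  define \<mu> where "\<mu> = (\<lambda>i. \<mu>0 i / (\<Sum>i\<le>l. \<theta> i * \<mu>0 i))"
  define \<mu>' where "\<mu>' = (\<lambda>i. \<mu>0' i / (\<Sum>i\<le>l. \<theta> i * \<mu>0' i))"
  have \<theta>\<mu>: "(\<Sum>i\<le>l. \<theta> i * \<mu> i) = 1" "(\<Sum>i\<le>l. \<theta> i * \<mu>' i) = 1"
    using \<theta> by (simp_all add: \<mu>_def \<mu>'_def sum_divide_distrib[symmetric])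
  have eq\<mu>: "?eq1 x \<eta> \<mu>" "?eq1 x' \<eta>' \<mu>'"
    using e(3) e'(3) by (simp_all add: \<mu>_def \<mu>'_def sum_divide_distrib[symmetric])
  have "\<forall>i\<le>l. \<exists>R. (\<forall>p. (\<Sum>a\<in>A i. R p a) = 0) \<and>
    (\<forall>p q. (\<Sum>a\<in>A i. R p a * complex_of_int (a $ q)) = (if p = q then 1 else 0))"
    using affine_section[OF A] by blast
  then obtain R where R: "\<And>i p. i \<le> l \<Longrightarrow> (\<Sum>a\<in>A i. R i p a) = 0"
    "\<And>i p q. i \<le> l \<Longrightarrow> (\<Sum>a\<in>A i. R i p a * complex_of_int (a $ q)) = (if p = q then 1 else 0)"
    by metis
  define w where "w = (\<lambda>i a. x (i, a) * exp (pairing \<eta> a))"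
  define w' where "w' = (\<lambda>i a. x' (i, a) * exp (pairing \<eta>' a))"
  define \<mu>s where "\<mu>s = (\<lambda>s i. \<mu> i + s * (\<mu>' i - \<mu> i))"
  define ws where "ws = (\<lambda>s i a. w i a + s * (w' i a - w i a))"
  define err where "err = (\<lambda>s q. \<Sum>i\<le>l. \<mu>s s i * (\<Sum>a\<in>A i. ws s i a * of_int (a $ q)))"
  \<comment> \<open>The error is shared among the members with weights \<open>\<theta> i\<close>,
    whose \<open>\<mu>s\<close>-weighted sum is one along the whole line; \<open>R\<close> turns it
    into coefficients with sum zero. As \<open>err\<close> vanishes at both ends, the end points do
    not move.\<close>
  define Ws where "Ws = (\<lambda>s i a. ws s i a - \<theta> i * (\<Sum>p\<in>UNIV. err s p * R i p a))"
  define \<eta>s where "\<eta>s = (\<lambda>s. \<eta> + s *s (\<eta>' - \<eta>))"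
  define xs where "xs = (\<lambda>s (i, a). Ws s i a * exp (- pairing (\<eta>s s) a))"
  have err0: "err 0 q = 0" "err 1 q = 0" for q
    using eq\<mu> by (simp_all add: err_def \<mu>s_def ws_def w_def w'_def)
  have xs01: "xs 0 = x" "xs 1 = x'"
    by (auto simp: xs_def Ws_def err0 ws_def w_def w'_def \<eta>s_def exp_minus fun_eq_iff)
  have \<theta>s: "(\<Sum>i\<le>l. \<mu>s s i * \<theta> i) = 1" for s
  proof -
    have "(\<Sum>i\<le>l. \<mu>s s i * \<theta> i) = (\<Sum>i\<le>l. \<theta> i * \<mu> i) + s * ((\<Sum>i\<le>l. \<theta> i * \<mu>' i) - (\<Sum>i\<le>l. \<theta> i * \<mu> i))"
      by (simp add: \<mu>s_def algebra_simps sum.distrib sum_subtractf sum_distrib_left)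
    then show ?thesis by (simp add: \<theta>\<mu>)
  qed
  have corr0: "(\<Sum>a\<in>A i. Ws s i a) = 0" if i: "i \<le> l" for s i
  proof -
    have "(\<Sum>a\<in>A i. Ws s i a) = (\<Sum>a\<in>A i. ws s i a) - \<theta> i * (\<Sum>p\<in>UNIV. err s p * (\<Sum>a\<in>A i. R i p a))"
      by (simp add: Ws_def sum_subtractf sum_distrib_left sum.swap[of _ "A i"])
    also have "(\<Sum>a\<in>A i. ws s i a) = (\<Sum>a\<in>A i. w i a) + s * ((\<Sum>a\<in>A i. w' i a) - (\<Sum>a\<in>A i. w i a))"
      by (simp add: ws_def sum.distrib sum_subtractf flip: sum_distrib_left)
    finally show ?thesis using e(2) e'(2) i by (simp add: R w_def w'_def)
  qed
  have corr1: "(\<Sum>a\<in>A i. Ws s i a * of_int (a $ q)) = (\<Sum>a\<in>A i. ws s i a * of_int (a $ q)) - \<theta> i * err s q"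
    if i: "i \<le> l" for s i q
  proof -
    have "(\<Sum>a\<in>A i. Ws s i a * of_int (a $ q)) = (\<Sum>a\<in>A i. ws s i a * of_int (a $ q))
        - \<theta> i * (\<Sum>p\<in>UNIV. err s p * (\<Sum>a\<in>A i. R i p a * of_int (a $ q)))"
      by (simp add: Ws_def left_diff_distrib sum_subtractf sum_distrib_left sum_distrib_right
          sum.swap[of _ "A i"] mult.assoc)
    also have "(\<Sum>p\<in>UNIV. err s p * (\<Sum>a\<in>A i. R i p a * of_int (a $ q))) = err s q"
      by (simp add: R i if_distrib[of "\<lambda>x. _ * x"] cong: if_cong)
    finally show ?thesis .
  qed
  have xs_in: "xs s \<in> discriminant_cylinder l A" for s
  proof -
    have xs_exp: "xs s (i, a) * exp (pairing (\<eta>s s) a) = Ws s i a" for i a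
      by (simp add: xs_def exp_minus)
    have "\<exists>i\<le>l. \<mu>s s i \<noteq> 0"
    proof (rule ccontr)
      assume "\<not> ?thesis"
      then show False using \<theta>s[of s] by simp
    qed
    then obtain i0 where i0: "i0 \<le> l" "\<mu>s s i0 \<noteq> 0" by blast
    show ?thesis
    proof (rule discriminant_cylinderI[where \<eta> = "\<eta>s s" and \<mu> = "\<mu>s s", OF i0])
      show "(\<Sum>a\<in>A i. xs s (i, a) * exp (pairing (\<eta>s s) a)) = 0" if "i \<le> l" for i
        using corr0[OF that] by (simp add: xs_exp)
      fix q
      have "(\<Sum>i\<le>l. \<mu>s s i * (\<Sum>a\<in>A i. xs s (i, a) * exp (pairing (\<eta>s s) a) * of_int (a $ q)))
          = (\<Sum>i\<le>l. \<mu>s s i * ((\<Sum>a\<in>A i. ws s i a * of_int (a $ q)) - \<theta> i * err s q))"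
        by (intro sum.cong) (simp_all add: xs_exp corr1)
      also have "\<dots> = err s q - (\<Sum>i\<le>l. \<mu>s s i * \<theta> i) * err s q"
        by (simp add: right_diff_distrib sum_subtractf err_def sum_distrib_right mult.assoc)
      finally show "(\<Sum>i\<le>l. \<mu>s s i * (\<Sum>a\<in>A i. xs s (i, a) * exp (pairing (\<eta>s s) a) * of_int (a $ q))) = 0"
        by (simp add: \<theta>s)
    qed
  qed
  have hol: "(\<lambda>s. xs s v) holomorphic_on UNIV" for v
  proof -
    obtain i a where "v = (i, a)" by (cases v)
    then show ?thesis
      unfolding xs_def Ws_def err_def ws_def \<mu>s_def \<eta>s_def pairing_def
      by (auto intro!: holomorphic_intros)
  qed
  have "\<exists>s. f (xs s) * g (xs s) \<noteq> 0"
    by (rule holomorphic_product_nonzero[where a = 0 and b = 1])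
       (auto simp: xs01 x x' intro: polynomial_fun_holomorphic fg hol)
  then show False using zero xs_in by blast
qed

text \<open>Near a point whose member \<open>i0\<close> is singular with nondegenerate Hessian and whose other members
  have Hessian-orthogonal, nonisotropic gradients, curves in the discriminant have arbitrary
  velocity modulo \<open>v\<close>.\<close>

lemma no_invariant_relation:
  fixes A :: "nat \<Rightarrow> (int ^ 'k) set"
  assumes l: "l \<le> CARD('k)"
    and A: "\<And>i. i \<le> l \<Longrightarrow> finite (A i)" "\<And>i. i \<le> l \<Longrightarrow> \<not> in_affine_hyperplane (A i)"
    and i0: "i0 \<le> l" and nd: "\<not> dual_defect_single (A i0)"
    and v: "(\<Sum>a\<in>A i0. v (i0, a)) \<noteq> 0"
    and h: "polynomial_fun h" "\<forall>x\<in>discriminant_cylinder l A. h x = 0" "\<And>x s. h (\<lambda>u. x u + s * v u) = h x"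
  shows "h x = 0"
proof -
  obtain c where c0: "(\<Sum>a\<in>A i0. c a) = 0" and c1: "\<And>q. (\<Sum>a\<in>A i0. c a * of_int (a $ q)) = (0::complex)"
    and "\<And>\<eta>. (\<And>q. (\<Sum>a\<in>A i0. c a * pairing \<eta> a * of_int (a $ q)) = 0) \<Longrightarrow> \<eta> = 0"
    using nondegenerate_hessian_exists[OF A(1)[OF i0] A(2)[OF i0] nd] by blast
  then have nondeg: "\<eta> = 0" if "\<And>q. hessian (A i0) c \<eta> (axis q 1) = 0" for \<eta>
    using that by (simp add: hessian_axis)
  let ?h = "hessian (A i0) c"
  let ?J = "{..l} - {i0}"
  have "card ?J \<le> card (UNIV :: 'k set)" using l i0 by simp
  then obtain \<epsilon> :: "nat \<Rightarrow> 'k" where \<epsilon>: "inj_on \<epsilon> ?J"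
    using card_le_inj[of ?J "UNIV :: 'k set"] by auto
  obtain u' :: "'k \<Rightarrow> complex ^ 'k" where u': "(\<forall>p\<in>UNIV. ?h (u' p) (u' p) \<noteq> 0) \<and>
      (\<forall>p\<in>UNIV. \<forall>q\<in>UNIV. p \<noteq> q \<longrightarrow> ?h (u' p) (u' q) = 0)"
    using hessian_orthogonal_family[where A = "A i0" and c = c and J = UNIV, OF nondeg] by (rule exE)
  define u where "u = (\<lambda>i. u' (\<epsilon> i))"
  have u: "?h (u i) (u i) \<noteq> 0" "i \<in> ?J \<Longrightarrow> j \<in> ?J \<Longrightarrow> i \<noteq> j \<Longrightarrow> ?h (u i) (u j) = 0" for i j
    using u' inj_on_eq_iff[OF \<epsilon>, of i j] by (simp_all add: u_def)
  define V where "V = (\<lambda>i q. ?h (u i) (axis q 1))"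
  have "\<forall>i\<le>l. \<exists>R. (\<forall>p. (\<Sum>a\<in>A i. R p a) = 0) \<and>
    (\<forall>p q. (\<Sum>a\<in>A i. R p a * complex_of_int (a $ q)) = (if p = q then 1 else 0))"
    using affine_section[OF A] by blast
  then obtain R where R: "\<And>i p. i \<le> l \<Longrightarrow> (\<Sum>a\<in>A i. R i p a) = 0"
    "\<And>i p q. i \<le> l \<Longrightarrow> (\<Sum>a\<in>A i. R i p a * complex_of_int (a $ q)) = (if p = q then 1 else 0)"
    by metis
  have R0: "(\<Sum>a\<in>A i. \<Sum>p\<in>UNIV. t p * R i p a) = 0" if "i \<le> l" for i t
    by (subst sum.swap) (simp add: R(1)[OF that] flip: sum_distrib_left)
  have R1: "(\<Sum>a\<in>A i. (\<Sum>p\<in>UNIV. t p * R i p a) * of_int (a $ q)) = t q" if "i \<le> l" for i t q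
  proof -
    have "(\<Sum>a\<in>A i. (\<Sum>p\<in>UNIV. t p * R i p a) * of_int (a $ q))
        = (\<Sum>p\<in>UNIV. t p * (\<Sum>a\<in>A i. R i p a * of_int (a $ q)))"
      by (simp add: sum_distrib_left sum_distrib_right sum.swap[of _ "A i"] mult.assoc)
    then show ?thesis by (simp add: R(2)[OF that] if_distrib[of "\<lambda>x. _ * x"] cong: if_cong)
  qed
  define x0 where "x0 = (\<lambda>(i, a). if i = i0 then c a else \<Sum>p\<in>UNIV. V i p * R i p a)"
  have x0_sum: "(\<Sum>a\<in>A i. x0 (i, a)) = 0" if "i \<le> l" for i
    using that c0 R0 by (cases "i = i0") (simp_all add: x0_def)
  have x0_grad: "(\<Sum>a\<in>A i. x0 (i, a) * of_int (a $ q)) = (if i = i0 then 0 else V i q)" if "i \<le> l" for i q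
    using that c1 R1 by (cases "i = i0") (simp_all add: x0_def)
  have x0_pairing: "(\<Sum>a\<in>A i. pairing \<tau> a * x0 (i, a)) = (if i = i0 then 0 else ?h (u i) \<tau>)" if "i \<le> l" for i \<tau>
    using sum_pairing[of "\<lambda>a. x0 (i, a)" \<tau> "A i"] x0_grad[OF that] hessian_expand[of "A i0" c "u i" \<tau>]
    by (simp add: mult.commute V_def)
  show ?thesis
  proof (rule polynomial_fun_zero_if_all_tangents[OF h(1), of x0])
    fix \<psi> :: "nat \<times> (int ^ 'k) \<Rightarrow> complex"
    \<comment> \<open>Removes the transversal part of the velocity: \<open>\<psi>'\<close> has sum
      zero on member \<open>i0\<close>, and the part along \<open>v\<close> is restored in
      \<open>\<gamma>\<close> by the invariance of \<open>h\<close>.\<close>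
    define \<kappa> where "\<kappa> = (\<Sum>a\<in>A i0. \<psi> (i0, a)) / (\<Sum>a\<in>A i0. v (i0, a))"
    define \<psi>' where "\<psi>' = (\<lambda>w. \<psi> w - \<kappa> * v w)"
    have \<psi>'0: "(\<Sum>a\<in>A i0. \<psi>' (i0, a)) = 0"
    proof -
      have "(\<Sum>a\<in>A i0. \<psi>' (i0, a)) = (\<Sum>a\<in>A i0. \<psi> (i0, a)) - \<kappa> * (\<Sum>a\<in>A i0. v (i0, a))"
        by (simp add: \<psi>'_def sum_subtractf flip: sum_distrib_left)
      then show ?thesis using v by (simp add: \<kappa>_def)
    qed
    define b where "b = (\<lambda>i. \<Sum>a\<in>A i. \<psi>' (i, a))"
    obtain \<xi> where \<xi>: "\<And>q. ?h \<xi> (axis q 1) = (\<Sum>a\<in>A i0. \<psi>' (i0, a) * of_int (a $ q))"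
      using hessian_surjective[where A = "A i0" and c = c
          and g = "\<lambda>q. \<Sum>a\<in>A i0. \<psi>' (i0, a) * of_int (a $ q)", OF nondeg] by blast
    \<comment> \<open>The first-order multipliers. Orthogonality decouples the value equations
      \<open>?h (u i) \<tau> = - b i\<close> of the other members, and nonisotropy makes each
      solvable for \<open>\<nu> i\<close>.\<close>
    define \<nu> where "\<nu> = (\<lambda>i. (b i - ?h (u i) \<xi>) / ?h (u i) (u i))"
    \<comment> \<open>The velocity of the singular point, read off from the first-order gradient
      equation: \<open>\<xi>\<close> offsets the gradient of \<open>\<psi>'\<close> in member
      \<open>i0\<close>, and the sum offsets the gradients of the other members.\<close>
    define \<tau> where "\<tau> = - \<xi> - (\<Sum>i\<in>?J. \<nu> i *s u i)"
    define W' where "W' = (\<lambda>i a. \<psi>' (i, a) + pairing \<tau> a * x0 (i, a))"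
    have W'_sum: "(\<Sum>a\<in>A i. W' i a) = 0" if i: "i \<le> l" for i
    proof (cases "i = i0")
      case True
      then show ?thesis using \<psi>'0 x0_pairing[OF i] by (simp add: W'_def sum.distrib)
    next
      case False
      have "(\<Sum>j\<in>?J. \<nu> j * ?h (u i) (u j)) = (\<Sum>j\<in>?J. if j = i then \<nu> i * ?h (u i) (u i) else 0)"
        using u(2) i False by (intro sum.cong) auto
      also have "\<dots> = \<nu> i * ?h (u i) (u i)" using i False by simp
      finally have "?h (u i) \<tau> = - ?h (u i) \<xi> - \<nu> i * ?h (u i) (u i)"
        by (simp add: \<tau>_def hessian_diff hessian_uminus hessian_sum hessian_scale)
      also have "\<dots> = - b i" using u(1)[of i] by (simp add: \<nu>_def)
      finally show ?thesis using x0_pairing[OF i] False by (simp add: W'_def sum.distrib b_def)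
    qed
    have grad0: "(\<Sum>a\<in>A i0. W' i0 a * of_int (a $ q)) + (\<Sum>i\<in>?J. \<nu> i * V i q) = 0" for q
    proof -
      have "(\<Sum>a\<in>A i0. pairing \<tau> a * x0 (i0, a) * of_int (a $ q)) = ?h (axis q 1) \<tau>"
        by (simp add: x0_def hessian_sym[of _ _ _ \<tau>] hessian_axis ac_simps)
      also have "\<dots> = - ?h \<xi> (axis q 1) - (\<Sum>i\<in>?J. \<nu> i * V i q)"
        by (simp add: \<tau>_def hessian_diff hessian_uminus hessian_sum hessian_scale V_def hessian_sym[of _ _ "axis q 1"])
      finally show ?thesis by (simp add: W'_def distrib_right sum.distrib \<xi>)
    qed
    \<comment> \<open>With multipliers linear in \<open>s\<close>, the gradient equation leaves just
      a term in \<open>s ^ 2\<close>. This correction cancels it, so the curve lies in the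
      discriminant exactly and not only to first order.\<close>
    define \<zeta> where "\<zeta> = (\<lambda>q. - (\<Sum>i\<in>?J. \<nu> i * (\<Sum>a\<in>A i. W' i a * of_int (a $ q))))"
    define \<omega> where "\<omega> = (\<lambda>i a. if i = i0 then \<Sum>p\<in>UNIV. \<zeta> p * R i0 p a else 0)"
    define W where "W = (\<lambda>s i a. x0 (i, a) + s * W' i a + s ^ 2 * \<omega> i a)"
    define xs where "xs = (\<lambda>s (i, a). W s i a * exp (- (s * pairing \<tau> a)))"
    define \<mu> where "\<mu> = (\<lambda>s i. if i = i0 then 1 else s * \<nu> i)"
    have \<omega>_sum: "(\<Sum>a\<in>A i. \<omega> i a) = 0" for i
      using R0[OF i0] by (cases "i = i0") (simp_all add: \<omega>_def)
    have \<omega>_grad: "(\<Sum>a\<in>A i. \<omega> i a * of_int (a $ q)) = (if i = i0 then \<zeta> q else 0)" for i q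
      using R1[OF i0] by (cases "i = i0") (simp_all add: \<omega>_def)
    have W_sum: "(\<Sum>a\<in>A i. W s i a) = 0" if i: "i \<le> l" for s i
      using x0_sum[OF i] W'_sum[OF i] \<omega>_sum[of i]
      by (simp add: W_def sum.distrib flip: sum_distrib_left)
    have W_grad: "(\<Sum>a\<in>A i. W s i a * of_int (a $ q)) = (if i = i0 then 0 else V i q) +
        s * (\<Sum>a\<in>A i. W' i a * of_int (a $ q)) + s ^ 2 * (if i = i0 then \<zeta> q else 0)" if i: "i \<le> l" for s i q
      using x0_grad[OF i, of q] \<omega>_grad[of i q]
      by (simp add: W_def distrib_right sum.distrib mult.assoc flip: sum_distrib_left)
    have xs_in: "xs s \<in> discriminant_cylinder l A" for s
    proof (rule discriminant_cylinderI[where \<eta> = "s *s \<tau>" and \<mu> = "\<mu> s", OF i0])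
      have xs_exp: "xs s (i, a) * exp (pairing (s *s \<tau>) a) = W s i a" for i a
        by (simp add: xs_def exp_minus pairing_scale)
      show "\<mu> s i0 \<noteq> 0" by (simp add: \<mu>_def)
      show "(\<Sum>a\<in>A i. xs s (i, a) * exp (pairing (s *s \<tau>) a)) = 0" if "i \<le> l" for i
        using W_sum[OF that] by (simp add: xs_exp)
      fix q
      let ?g = "\<lambda>i. \<Sum>a\<in>A i. W s i a * of_int (a $ q)"
      have "(\<Sum>i\<le>l. \<mu> s i * ?g i) = \<mu> s i0 * ?g i0 + (\<Sum>i\<in>?J. \<mu> s i * ?g i)"
        using i0 by (intro sum.remove) auto
      also have "(\<Sum>i\<in>?J. \<mu> s i * ?g i)
          = (\<Sum>i\<in>?J. s * (\<nu> i * V i q) + s ^ 2 * (\<nu> i * (\<Sum>a\<in>A i. W' i a * of_int (a $ q))))"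
        by (intro sum.cong)
           (auto simp: \<mu>_def W_grad power2_eq_square distrib_left mult.assoc mult.left_commute)
      also have "\<dots> = s * (\<Sum>i\<in>?J. \<nu> i * V i q) - s ^ 2 * \<zeta> q"
        by (simp add: sum.distrib \<zeta>_def flip: sum_distrib_left)
      also have "\<mu> s i0 * ?g i0 = s * (\<Sum>a\<in>A i0. W' i0 a * of_int (a $ q)) + s ^ 2 * \<zeta> q"
        using i0 by (simp add: \<mu>_def W_grad)
      finally have "(\<Sum>i\<le>l. \<mu> s i * ?g i)
          = s * ((\<Sum>a\<in>A i0. W' i0 a * of_int (a $ q)) + (\<Sum>i\<in>?J. \<nu> i * V i q))"
        by (simp add: distrib_left)
      then show "(\<Sum>i\<le>l. \<mu> s i * (\<Sum>a\<in>A i. xs s (i, a) * exp (pairing (s *s \<tau>) a) * of_int (a $ q))) = 0"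
        by (simp add: xs_exp grad0)
    qed
    define \<gamma> where "\<gamma> = (\<lambda>s w. xs s w + s * \<kappa> * v w)"
    show "\<exists>\<gamma>. \<gamma> 0 = x0 \<and> (\<forall>s. h (\<gamma> s) = 0) \<and>
      (\<forall>v. ((\<lambda>s. \<gamma> s v) has_field_derivative \<psi> v) (at (0::complex)))"
    proof (intro exI[of _ \<gamma>] conjI allI)
      show "\<gamma> 0 = x0" by (auto simp: \<gamma>_def xs_def W_def fun_eq_iff)
      show "h (\<gamma> s) = 0" for s
        using h(2,3) xs_in[of s] by (simp add: \<gamma>_def)
      fix w :: "nat \<times> (int ^ 'k)"
      obtain i a where w: "w = (i, a)" by (cases w)
      have "((\<lambda>s. W s i a * exp (- (s * pairing \<tau> a)) + s * \<kappa> * v (i, a)) has_field_derivative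
          W' i a - pairing \<tau> a * x0 (i, a) + \<kappa> * v (i, a)) (at 0)"
        unfolding W_def by (auto intro!: derivative_eq_intros)
      then show "((\<lambda>s. \<gamma> s w) has_field_derivative \<psi> w) (at 0)"
        by (simp add: \<gamma>_def xs_def w W'_def \<psi>'_def)
    qed
  qed
qed

text \<open>On the chart \<open>\<mu> i0 \<noteq> 0\<close> the coefficients of the member \<open>i0\<close> at a dual basis, and one coefficient
  of every other member, are polynomials in the remaining data.\<close>

lemma chart_relation:
  fixes A :: "nat \<Rightarrow> (int ^ 'k) set"
  assumes A: "\<And>i. i \<le> l \<Longrightarrow> finite (A i)" "\<And>i. i \<le> l \<Longrightarrow> \<not> in_affine_hyperplane (A i)"
    and i0: "i0 \<le> l"
  shows "\<exists>f. polynomial_fun f \<and> (\<exists>x. f x \<noteq> 0) \<and>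
    (\<forall>x x'. (\<forall>v\<in>exponents l A. x v = x' v) \<longrightarrow> f x = f x') \<and>
    (\<forall>x \<eta> \<mu>. \<mu> i0 \<noteq> 0 \<longrightarrow> (\<forall>i\<le>l. (\<Sum>a\<in>A i. x (i, a) * exp (pairing \<eta> a)) = 0) \<longrightarrow>
      (\<forall>j. (\<Sum>i\<le>l. \<mu> i * (\<Sum>a\<in>A i. x (i, a) * exp (pairing \<eta> a) * of_int (a $ j))) = 0) \<longrightarrow> f x = 0)"
proof -
  let ?E = "exponents l A"
  let ?J = "{..l} - {i0}"
  have finE: "finite ?E" using A(1) by (auto simp: exponents_def)
  obtain B \<rho>0 \<rho> where dual: "affine_dual_basis (A i0) B \<rho>0 \<rho>"
    by (rule affine_dual_basis_exists[OF A(1)[OF i0] A(2)[OF i0]])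
  then have B: "B \<subseteq> A i0" "card B = Suc CARD('k)" unfolding affine_dual_basis_def by blast+
  have finB: "finite B" using B(1) A(1)[OF i0] finite_subset by blast
  have "\<exists>b. b \<in> A i" if i: "i \<le> l" for i
  proof -
    obtain B \<rho>0 \<rho> where "affine_dual_basis (A i) B \<rho>0 \<rho>" by (rule affine_dual_basis_exists[OF A(1)[OF i] A(2)[OF i]])
    then have "B \<subseteq> A i" "B \<noteq> {}" unfolding affine_dual_basis_def by auto
    then show ?thesis by blast
  qed
  then obtain \<beta> where \<beta>: "\<And>i. i \<le> l \<Longrightarrow> \<beta> i \<in> A i" by metis
  have "finite (\<Union>i\<le>l. A i)" using A(1) by auto
  then obtain M where "\<forall>a\<in>(\<Union>i\<le>l. A i). \<forall>q. a $ q + int M \<ge> 0" using exponents_bounded_below by blast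
  then have M: "\<And>i a q. i \<le> l \<Longrightarrow> a \<in> A i \<Longrightarrow> a $ q + int M \<ge> 0" by blast
  \<comment> \<open>The eliminated coordinates: \<open>k + 1\<close> from member \<open>i0\<close>
    and one from each of the other \<open>l\<close> members. The \<open>k\<close> torus coordinates
    and \<open>l\<close> multiplier ratios that replace them are one fewer.\<close>
  define Rm where "Rm = Pair i0 ` B \<union> (\<lambda>i. (i, \<beta> i)) ` ?J"
  have Rm_sub: "Rm \<subseteq> ?E" using B(1) \<beta> i0 by (auto simp: Rm_def exponents_def)
  have card_Rm: "card Rm = Suc CARD('k) + l"
  proof -
    have "card Rm = card (Pair i0 ` B) + card ((\<lambda>i. (i, \<beta> i)) ` ?J)"
      unfolding Rm_def using finB by (intro card_Un_disjoint) auto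
    also have "card (Pair i0 ` B) = Suc CARD('k)" using B(2) by (subst card_image) (auto simp: inj_on_def)
    also have "card ((\<lambda>i. (i, \<beta> i)) ` ?J) = l" using i0 by (subst card_image) (auto simp: inj_on_def)
    finally show ?thesis .
  qed
  define P :: "('k + (nat + (nat \<times> (int ^ 'k)))) set" where
    "P = range Inl \<union> (Inr ` Inl ` ?J \<union> Inr ` Inr ` (?E - Rm))"
  have "card P = CARD('k) + (l + (card ?E - card Rm))"
  proof -
    have "card P = card (range Inl :: ('k + (nat + (nat \<times> (int ^ 'k)))) set) +
        (card (Inr ` Inl ` ?J :: ('k + (nat + (nat \<times> (int ^ 'k)))) set) +
         card (Inr ` Inr ` (?E - Rm) :: ('k + (nat + (nat \<times> (int ^ 'k)))) set))"
      unfolding P_def using finE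
      by (subst card_Un_disjoint, simp, simp, blast, subst card_Un_disjoint) auto
    then show ?thesis
      using i0 finE Rm_sub by (simp add: card_image card_Diff_subset finite_subset)
  qed
  moreover have "card ?E \<ge> card Rm" using card_mono[OF finE Rm_sub] .
  ultimately have card: "card P < card ?E" using card_Rm by simp
  have finP: "finite P" using finE by (simp add: P_def)
  define m where "m = (\<lambda>a (t :: 'k + (nat + (nat \<times> (int ^ 'k))) \<Rightarrow> complex). \<Prod>q\<in>UNIV. t (Inl q) ^ nat (a $ q + int M))"
  define w where "w = (\<lambda>i a (t :: 'k + (nat + (nat \<times> (int ^ 'k))) \<Rightarrow> complex).
    if a = \<beta> i then 0 - (\<Sum>a\<in>A i - {\<beta> i}. t (Inr (Inr (i, a)))) else t (Inr (Inr (i, a))))"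
  define E where "E = (\<lambda>q (t :: 'k + (nat + (nat \<times> (int ^ 'k))) \<Rightarrow> complex).
    \<Sum>i\<in>?J. t (Inr (Inl i)) * (\<Sum>a\<in>A i. w i a t * of_int (a $ q)))"
  define w0 where "w0 = (\<lambda>a (t :: 'k + (nat + (nat \<times> (int ^ 'k))) \<Rightarrow> complex). if a \<in> B then
      \<rho>0 a * (0 - (\<Sum>b\<in>A i0 - B. t (Inr (Inr (i0, b))))) +
      (\<Sum>q\<in>UNIV. \<rho> a q * (- E q t - (\<Sum>b\<in>A i0 - B. t (Inr (Inr (i0, b))) * of_int (b $ q))))
      else t (Inr (Inr (i0, a))))"
  define X where "X = (\<lambda>(i, a) t. (if i = i0 then w0 a t else w i a t) * m a t)"
  have wp: "polynomial_fun (w i a)" for i a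
  proof -
    have "polynomial_fun (\<lambda>t. 0 - (\<Sum>a\<in>A i - {\<beta> i}. t (Inr (Inr (i, a)))))" by (intro polynomial_fun_intros)
    then show ?thesis unfolding w_def using polynomial_fun.coord by (cases "a = \<beta> i") simp_all
  qed
  have w0p: "polynomial_fun (w0 a)" for a
  proof -
    have "polynomial_fun (\<lambda>t. \<rho>0 a * (0 - (\<Sum>b\<in>A i0 - B. t (Inr (Inr (i0, b))))) +
      (\<Sum>q\<in>UNIV. \<rho> a q * (- E q t - (\<Sum>b\<in>A i0 - B. t (Inr (Inr (i0, b))) * of_int (b $ q)))))"
      unfolding E_def by (intro polynomial_fun_intros wp)
    then show ?thesis unfolding w0_def using polynomial_fun.coord by (cases "a \<in> B") simp_all
  qed
  have "polynomial_fun (X v)" for v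
  proof -
    obtain i a where "v = (i, a)" by (cases v)
    moreover have "polynomial_fun (m a)" unfolding m_def by (intro polynomial_fun_intros)
    ultimately show ?thesis unfolding X_def
      by (cases "i = i0") (auto intro: polynomial_fun.intros w0p wp)
  qed
  from algebraic_dependence[where X = X, OF finE finP card this]
  obtain f where f: "polynomial_fun f" "\<exists>x. f x \<noteq> 0"
    "\<forall>x x'. (\<forall>v\<in>?E. x v = x' v) \<longrightarrow> f x = f x'" "\<forall>t\<in>coord_space P. f (\<lambda>v. X v t) = 0" by blast
  show ?thesis
  proof (intro exI[of _ f] conjI f(1-3) allI impI)
    fix x :: "nat \<times> (int ^ 'k) \<Rightarrow> complex" and \<eta> :: "complex ^ 'k" and \<mu> :: "nat \<Rightarrow> complex"
    assume \<mu>: "\<mu> i0 \<noteq> 0" and eq0: "\<forall>i\<le>l. (\<Sum>a\<in>A i. x (i, a) * exp (pairing \<eta> a)) = 0"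
      and eq1: "\<forall>j. (\<Sum>i\<le>l. \<mu> i * (\<Sum>a\<in>A i. x (i, a) * exp (pairing \<eta> a) * of_int (a $ j))) = 0"
    \<comment> \<open>The coordinates are weights times \<open>exp (pairing (- \<eta>) a)\<close>,
      hence the torus point is taken at \<open>- \<eta>\<close>; \<open>\<delta>\<close> undoes the
      shift of the exponents by \<open>M\<close>.\<close>
    define \<delta> where "\<delta> = exp (- (of_nat M * (\<Sum>q\<in>UNIV. (- \<eta>) $ q)))"
    define c where "c = (\<lambda>i a. x (i, a) * exp (pairing \<eta> a) * \<delta>)"
    define \<nu> where "\<nu> = (\<lambda>i. \<mu> i / \<mu> i0)"
    define t where "t = (\<lambda>v. case v of Inl q \<Rightarrow> exp ((- \<eta>) $ q)
      | Inr (Inl i) \<Rightarrow> if i \<in> ?J then \<nu> i else 0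
      | Inr (Inr (i, a)) \<Rightarrow> if (i, a) \<in> ?E - Rm then c i a else 0)"
    have t: "t \<in> coord_space P"
      by (auto simp: t_def P_def coord_space_def image_iff split: sum.splits)
    have c_sum: "(\<Sum>a\<in>A i. c i a) = 0" if "i \<le> l" for i
      using eq0 that by (simp add: c_def flip: sum_distrib_right)
    have c_grad: "(\<Sum>a\<in>A i0. c i0 a * of_int (a $ q)) = - (\<Sum>i\<in>?J. \<nu> i * (\<Sum>a\<in>A i. c i a * of_int (a $ q)))" for q
    proof -
      let ?g = "\<lambda>i. \<Sum>a\<in>A i. x (i, a) * exp (pairing \<eta> a) * of_int (a $ q)"
      have g: "(\<Sum>a\<in>A i. c i a * of_int (a $ q)) = \<delta> * ?g i" for i
        by (simp add: c_def sum_distrib_left ac_simps)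
      have "\<mu> i0 * ?g i0 + (\<Sum>i\<in>?J. \<mu> i * ?g i) = 0"
        using eq1 i0 sum.remove[of "{..l}" i0 "\<lambda>i. \<mu> i * ?g i"] by simp
      moreover have "(\<Sum>i\<in>?J. \<mu> i * ?g i) = \<mu> i0 * (\<Sum>i\<in>?J. \<nu> i * ?g i)"
        using \<mu> by (simp add: sum_distrib_left \<nu>_def)
      ultimately have "\<mu> i0 * (?g i0 + (\<Sum>i\<in>?J. \<nu> i * ?g i)) = 0" by (simp add: distrib_left)
      then have "?g i0 = - (\<Sum>i\<in>?J. \<nu> i * ?g i)" using \<mu> by (simp add: eq_neg_iff_add_eq_0)
      then have "\<delta> * ?g i0 = - (\<Sum>i\<in>?J. \<nu> i * (\<delta> * ?g i))" by (simp add: sum_distrib_left mult.left_commute)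
      then show ?thesis by (simp only: g)
    qed
    have tc: "t (Inr (Inr (i, a))) = c i a" if "i \<in> ?J" "a \<in> A i" "a \<noteq> \<beta> i" for i a
      using that by (auto simp: t_def exponents_def Rm_def)
    have tc0: "t (Inr (Inr (i0, a))) = c i0 a" if "a \<in> A i0" "a \<notin> B" for a
      using that i0 by (auto simp: t_def exponents_def Rm_def)
    have w: "w i a t = c i a" if i: "i \<in> ?J" and a: "a \<in> A i" for i a
    proof (cases "a = \<beta> i")
      case True
      have il: "i \<le> l" using i by simp
      have "(\<Sum>a\<in>A i - {\<beta> i}. t (Inr (Inr (i, a)))) = (\<Sum>a\<in>A i - {\<beta> i}. c i a)"
        using i tc by (intro sum.cong) auto
      moreover have "c i (\<beta> i) + (\<Sum>a\<in>A i - {\<beta> i}. c i a) = 0"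
        using c_sum[OF il] sum.remove[OF A(1)[OF il] \<beta>[OF il], of "c i"] by simp
      ultimately have "c i (\<beta> i) = - (\<Sum>a\<in>A i - {\<beta> i}. t (Inr (Inr (i, a))))"
        by (simp add: eq_neg_iff_add_eq_0)
      then show ?thesis using True by (simp add: w_def)
    qed (use i a tc in \<open>simp add: w_def\<close>)
    have E: "E q t = (\<Sum>i\<in>?J. \<nu> i * (\<Sum>a\<in>A i. c i a * of_int (a $ q)))" for q
    proof -
      have "t (Inr (Inl i)) = \<nu> i" if "i \<in> ?J" for i using that by (simp add: t_def)
      then show ?thesis unfolding E_def by (intro sum.cong) (simp_all add: w)
    qed
    have w0: "w0 a t = c i0 a" if a: "a \<in> A i0" for a
    proof (cases "a \<in> B")
      case True
      have "(\<Sum>b\<in>A i0 - B. t (Inr (Inr (i0, b)))) = (\<Sum>b\<in>A i0 - B. c i0 b)"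
        "\<And>q. (\<Sum>b\<in>A i0 - B. t (Inr (Inr (i0, b))) * of_int (b $ q)) = (\<Sum>b\<in>A i0 - B. c i0 b * of_int (b $ q))"
        using tc0 by (auto intro!: sum.cong)
      then show ?thesis
        using affine_dual_basis_coeff[OF A(1)[OF i0] dual True, of "c i0"] True c_sum[OF i0]
        by (simp add: w0_def E c_grad)
    qed (use a tc0 in \<open>simp add: w0_def\<close>)
    have "X v t = x v" if v: "v \<in> ?E" for v
    proof -
      obtain i a where ia: "v = (i, a)" "i \<le> l" "a \<in> A i" using v by (auto simp: exponents_def)
      have "X v t = c i a * m a t" using ia w[of i a] w0[of a] by (cases "i = i0") (simp_all add: X_def)
      also have "\<dots> = x (i, a) * exp (pairing \<eta> a) * (m a t * \<delta>)" by (simp add: c_def)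
      also have "m a t * \<delta> = exp (pairing (- \<eta>) a)"
        unfolding \<delta>_def prod_exp_shifted[of a M "- \<eta>", OF M[OF ia(2,3)], symmetric] by (simp add: m_def t_def)
      finally show ?thesis by (simp add: ia pairing_uminus exp_minus)
    qed
    then have "f (\<lambda>v. X v t) = f x" by (intro f(3)[rule_format])
    with f(4) t show "f x = 0" by simp
  qed
qed

theorem proposition2p24:
  fixes A :: "nat \<Rightarrow> (int ^ 'k) set" and l :: nat
  assumes "l \<le> CARD('k)"
    and "\<And>i. i \<le> l \<Longrightarrow> finite (A i)"
    and "\<And>i. i \<le> l \<Longrightarrow> \<not> in_affine_hyperplane (A i)"
    and "\<exists>i\<le>l. \<not> dual_defect_single (A i)"
  shows "\<not> dual_defect l A"
proof -
  let ?E = "exponents l A" and ?X = "discriminant_cylinder l A"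
  obtain i0 where i0: "i0 \<le> l" "\<not> dual_defect_single (A i0)" using assms(4) by blast
  have "\<forall>i\<in>{..l}. \<exists>f. polynomial_fun f \<and> (\<exists>x. f x \<noteq> 0) \<and>
    (\<forall>x x'. (\<forall>v\<in>?E. x v = x' v) \<longrightarrow> f x = f x') \<and>
    (\<forall>x \<eta> \<mu>. \<mu> i \<noteq> 0 \<longrightarrow> (\<forall>i\<le>l. (\<Sum>a\<in>A i. x (i, a) * exp (pairing \<eta> a)) = 0) \<longrightarrow>
      (\<forall>j. (\<Sum>i\<le>l. \<mu> i * (\<Sum>a\<in>A i. x (i, a) * exp (pairing \<eta> a) * of_int (a $ j))) = 0) \<longrightarrow> f x = 0)"
    using chart_relation[OF assms(2,3)] by simp
  then obtain f where f: "\<forall>i\<in>{..l}. polynomial_fun (f i) \<and> (\<exists>x. f i x \<noteq> 0) \<and>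
    (\<forall>x x'. (\<forall>v\<in>?E. x v = x' v) \<longrightarrow> f i x = f i x') \<and>
    (\<forall>x \<eta> \<mu>. \<mu> i \<noteq> 0 \<longrightarrow> (\<forall>i\<le>l. (\<Sum>a\<in>A i. x (i, a) * exp (pairing \<eta> a)) = 0) \<longrightarrow>
      (\<forall>j. (\<Sum>i\<le>l. \<mu> i * (\<Sum>a\<in>A i. x (i, a) * exp (pairing \<eta> a) * of_int (a $ j))) = 0) \<longrightarrow> f i x = 0)"
    unfolding bchoice_iff by blast
  \<comment> \<open>Some \<open>\<mu> i\<close> is nonzero at each point of the discriminant, so
    every point lies in a chart on which one factor vanishes.\<close>
  define f1 where "f1 = (\<lambda>x. \<Prod>i\<le>l. f i x)"
  have f1p: "polynomial_fun f1" unfolding f1_def using f by (intro polynomial_fun_prod) blast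
  obtain y where y: "f1 y \<noteq> 0"
    using polynomial_fun_prod_nonzero[of "{..l}" f] f unfolding f1_def by blast
  have f1_dep: "f1 x = f1 x'" if "\<forall>v\<in>?E. x v = x' v" for x x'
    unfolding f1_def using f that by (intro prod.cong) blast+
  have f1X: "\<forall>x\<in>?X. f1 x = 0"
  proof
    fix x assume "x \<in> ?X"
    then obtain \<eta> \<mu> i where "i \<le> l" "\<mu> i \<noteq> 0" "\<forall>i\<le>l. (\<Sum>a\<in>A i. x (i, a) * exp (pairing \<eta> a)) = 0"
      "\<forall>j. (\<Sum>i\<le>l. \<mu> i * (\<Sum>a\<in>A i. x (i, a) * exp (pairing \<eta> a) * of_int (a $ j))) = 0"
      unfolding discriminant_cylinder_def by blast
    then have "f i x = 0" "i \<in> {..l}" using f by blast+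
    then show "f1 x = 0" unfolding f1_def by (intro prod_zero) auto
  qed
  obtain n g w where g: "polynomial_fun g" "g w \<noteq> 0"
    "\<And>z w. coeff (line f1 z w) n = g w" "\<And>z w i. i > n \<Longrightarrow> coeff (line f1 z w) i = 0"
    using leading_form[of f1 y] f1p y by metis
  define res where "res = (\<lambda>x v. if v \<in> ?E then x v else (0::complex))"
  have res_in: "res x \<in> coord_space ?E" for x by (auto simp: res_def coord_space_def)
  have res_id: "res x = x" if "x \<in> coord_space ?E" for x using that by (auto simp: res_def coord_space_def)
  have res_X: "res x \<in> ?X \<longleftrightarrow> x \<in> ?X" for x
  proof -
    have "res x (i, a) = x (i, a)" if "i \<le> l" "a \<in> A i" for i a
      using that by (simp add: res_def exponents_def)
    then have "(\<Sum>a\<in>A i. res x (i, a) * exp (pairing \<eta> a)) = (\<Sum>a\<in>A i. x (i, a) * exp (pairing \<eta> a))"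
      "(\<Sum>a\<in>A i. res x (i, a) * exp (pairing \<eta> a) * of_int (a $ j)) =
        (\<Sum>a\<in>A i. x (i, a) * exp (pairing \<eta> a) * of_int (a $ j))" if "i \<le> l" for i \<eta> j
      using that by (auto intro!: sum.cong)
    then show ?thesis by (simp add: discriminant_cylinder_def)
  qed
  \<comment> \<open>The linear form that detects transversality in
    \<open>no_invariant_relation\<close>; \<open>v\<close> has to avoid its kernel as well as the
    zeros of the leading form \<open>g\<close>.\<close>
  define \<omega>0 where "\<omega>0 = (\<lambda>x :: nat \<times> (int ^ 'k) \<Rightarrow> complex. \<Sum>a\<in>A i0. x (i0, a))"
  have "\<omega>0 (\<lambda>_. 1) \<noteq> 0"
  proof -
    obtain B \<rho>0 \<rho> where "affine_dual_basis (A i0) B \<rho>0 \<rho>"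
      by (rule affine_dual_basis_exists[OF assms(2)[OF i0(1)] assms(3)[OF i0(1)]])
    then have "A i0 \<noteq> {}" by (auto simp: affine_dual_basis_def)
    then show ?thesis using assms(2)[OF i0(1)] by (simp add: \<omega>0_def)
  qed
  moreover have "polynomial_fun \<omega>0" unfolding \<omega>0_def by (intro polynomial_fun_intros)
  ultimately obtain v' where v': "g v' \<noteq> 0" "\<omega>0 v' \<noteq> 0"
    using polynomial_fun_mult_nonzero[OF g(1) _ g(2)] by blast
  \<comment> \<open>Truncation places \<open>v\<close> in \<open>coord_space ?E\<close>, so lines
    along \<open>v\<close> can show that \<open>F\<close> is not constant there. Neither
    \<open>f1\<close> nor \<open>\<omega>0\<close> notices the change.\<close>
  define v where "v = res v'"
  have "line f1 z v = line f1 z v'" for z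
    by (rule line_eqI) (auto simp: poly_line f1p v_def res_def intro: f1_dep)
  then have gv: "g v \<noteq> 0" using v'(1) g(3) by metis
  have \<omega>v: "\<omega>0 v \<noteq> 0" using v'(2) i0 by (simp add: \<omega>0_def v_def res_def exponents_def)
  then obtain s where s: "v s \<noteq> 0" unfolding \<omega>0_def by (metis sum.neutral)
  have "\<exists>F d. polynomial_fun F \<and> (\<forall>x\<in>?X. F x = 0) \<and> d \<noteq> 0 \<and> (\<forall>z. coeff (line F z v) d = 1) \<and>
    (\<forall>g. polynomial_fun g \<longrightarrow> (\<forall>x\<in>?X. g x = 0) \<longrightarrow> (\<exists>q. \<forall>x. g x = q x * F x))"
  proof (rule principal_vanishing_ideal[OF discriminant_cylinder_prime[OF assms(2,3)] f1p f1X gv g(3,4) _ s])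
    fix h x assume "polynomial_fun h" "\<forall>x\<in>?X. h x = 0" "\<And>x s. h (\<lambda>u. x u + s * v u) = h x"
    then show "h x = 0"
      using no_invariant_relation[where A = A and l = l and v = v and h = h, OF assms(1-3) i0] \<omega>v unfolding \<omega>0_def by blast
  qed
  then obtain F d where F: "polynomial_fun F" "\<forall>x\<in>?X. F x = 0" "d \<noteq> 0" "\<And>z. coeff (line F z v) d = 1"
    "\<And>g. polynomial_fun g \<Longrightarrow> \<forall>x\<in>?X. g x = 0 \<Longrightarrow> \<exists>q. \<forall>x. g x = q x * F x"
    by (elim exE conjE) metis
  have "\<not> F constant_on coord_space ?E"
  proof
    assume "F constant_on coord_space ?E"
    then obtain c where c: "\<And>x. x \<in> coord_space ?E \<Longrightarrow> F x = c" by (auto simp: constant_on_def)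
    have "(\<lambda>u. 0 + T * v u) \<in> coord_space ?E" for T by (auto simp: v_def res_def coord_space_def)
    then have "line F (\<lambda>_. 0) v = [:c:]" by (intro line_eqI) (simp only: c, simp)
    then show False using F(3) F(4)[of "\<lambda>_. 0"] by (cases d) auto
  qed
  moreover have "zariski_closure ?E (Sigma_collection l A) = {x \<in> coord_space ?E. F x = 0}"
  proof (intro equalityI subsetI)
    fix x assume "x \<in> zariski_closure ?E (Sigma_collection l A)"
    then show "x \<in> {x \<in> coord_space ?E. F x = 0}"
      using F(1,2) by (auto simp: zariski_closure_def Sigma_collection_eq[OF assms(2)])
  next
    fix x assume x: "x \<in> {x \<in> coord_space ?E. F x = 0}"
    have "f x = 0" if f: "polynomial_fun f" "\<forall>z\<in>Sigma_collection l A. f z = 0" for f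
    proof -
      \<comment> \<open>Composition with \<open>res\<close> extends a relation on the discriminant
        to the cylinder, where \<open>F\<close> generates the ideal.\<close>
      have "polynomial_fun (\<lambda>x. f (res x))"
      proof (rule polynomial_fun_compose[OF f(1)])
        show "polynomial_fun (\<lambda>x. res x u)" for u
          by (cases "u \<in> ?E") (auto simp: res_def intro: polynomial_fun.intros)
      qed
      moreover have "\<forall>x\<in>?X. f (res x) = 0"
        using f(2) res_in res_X by (simp add: Sigma_collection_eq[OF assms(2)])
      ultimately obtain q where "\<forall>x. f (res x) = q x * F x" using F(5) by blast
      then have "f (res x) = 0" using x by simp
      then show ?thesis using x by (simp add: res_id)
    qed
    then show "x \<in> zariski_closure ?E (Sigma_collection l A)" using x by (simp add: zariski_closure_def)
  qed
  ultimately have "hypersurface ?E (zariski_closure ?E (Sigma_collection l A))"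
    unfolding hypersurface_def using F(1) by blast
  then show ?thesis by (simp add: dual_defect_def)
qed

end
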